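(* Let $k\in\mathbb N$ ($k\ge1$), $C,D>0$, let $(X_n)_{n\in\mathbb N}$ be a sequence of complete metric spaces and let $T_n\in\mathbf I_k(X_n)$ satisfy $\mathbf M(T_n)+\mathbf M(\partial T_n)\le C$ and $\operatorname{diam}(\operatorname{spt}T_n)\le D$ for all $n\in\mathbb N$. Suppose there exist complete metric spaces $Z$, $Z'$ and isometric embeddings $\varphi_n:\operatorname{spt}T_n\hookrightarrow Z$ and $\varphi'_n:\operatorname{spt}T_n\hookrightarrow Z'$ such that $\varphi_{n\#}T_n$ converges in the flat distance in $Z$ to some $T\in\mathbf I_k(Z)$ and $\varphi'_{n\#}T_n$ converges in the flat distance in $Z'$ to some $T'\in\mathbf I_k(Z')$. If $T\neq0$, then $T'\ne0$ and there exists an isometry $\Psi:\operatorname{spt}T\to\operatorname{spt}T'$ with $\Psi_\#T=T'$.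
   Context: Isometric embeddings are distance-preserving maps; an isometry is a surjective isometric embedding. Metric currents (Ambrosio–Kirchheim). Let $(X,d)$ be a complete metric space and $k\ge 0$ an integer. $\mathcal D^k(X)$ is the set of $(k+1)$-tuples $(f,\pi_1,\dots,\pi_k)$ of real-valued Lipschitz functions on $X$ with $f$ bounded. A $k$-dimensional metric current $T$ on $X$ is a multilinear functional on $\mathcal D^k(X)$ such that: (i) if $\pi_i^j\to\pi_i$ pointwise as $j\to\infty$ and $\sup_{i,j}\operatorname{Lip}(\pi_i^j)<\infty$, then $T(f,\pi_1^j,\dots,\pi_k^j)\to T(f,\pi_1,\dots,\pi_k)$; (ii) if $\{f\ne0\}\subset\bigcup_{i=1}^kB_i$ with $B_i$ Borel and $\pi_i$ constant on $B_i$, then $T(f,\pi_1,\dots,\pi_k)=0$; (iii) there is a finite Borel measure $\mu$ on $X$ with $|T(f,\pi_1,\dots,\pi_k)|\le\prod_i\operatorname{Lip}(\pi_i)\int_X|f|\,d\mu$ for all tuples. The minimal such $\mu$ is $\|T\|$; $\mathbf M(T):=\|T\|(X)$ is the mass; $\operatorname{spt}T$ is the closed set of $x$ with $\|T\|(B(x,r))>0$ for all $r>0$. $T$ extends to tuples whose first entry is in $L^\infty(X,\|T\|)$, and for Borel $A$, $(T\llcorner A)(f,\pi):=T(f\chi_A,\pi)$. For $k\ge1$, $\partial T(f,\pi_1,\dots,\pi_{k-1}):=T(1,f,\pi_1,\dots,\pi_{k-1})$; $T$ is normal if $\partial T$ satisfies (iii) (every $0$-current is normal). For a Lipschitz map $\varphi:X\to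 Y$ into a complete metric space, $\varphi_\#T(g,\tau_1,\dots,\tau_k):=T(g\circ\varphi,\tau_1\circ\varphi,\dots,\tau_k\circ\varphi)$. For $\theta\in L^1(\mathbb R^k)$, $[\![\theta]\!](f,\pi):=\int\theta f\det(\partial\pi_i/\partial x_j)\,d\mathcal L^k$. A $0$-current is integer rectifiable if it is of the form $T(f)=\sum_{i=1}^n\theta_if(x_i)$ with $\theta_i\in\mathbb Z\setminus\{0\}$ and $x_i \in X$; for $k\ge1$, $T$ is integer rectifiable if $\|T\|$ is concentrated on a countably $\mathcal H^k$-rectifiable set and vanishes on $\mathcal H^k$-negligible Borel sets, and for every Lipschitz $\varphi:X\to\mathbb R^k$ and open $U\subset X$ there is $\theta\in L^1(\mathbb R^k,\mathbb Z)$ with $\varphi_\#(T\llcorner U)=[\![\theta]\!]$. Integral currents are integer rectifiable normal currents; their space is $\mathbf I_k(X)$. A current $T$ is naturally regarded as a current on the complete metric space $\operatorname{spt}T$ (with the restricted metric), so that it can be pushed forward under Lipschitz maps defined only on $\operatorname{spt}T$. For $S\in\mathbf I_k(Z)$: $\mathcal F(S):=\inf\{\mathbf M(U)+\mathbf M(V):S=U+\partial V,\ U\in\mathbf I_k(Z),\ V\in\mathbf I_{k+1}(Z)\}$; the flat distance of $T,T'\in\mathbf I_k(Z)$ is $\mathcal F(T-T')$. *)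

theory Defs
  imports "HOL-Analysis.Analysis"
begin

section \<open>Metric spaces, Borel sets, Lipschitz functions\<close>

definition borel_of :: "'a metric \<Rightarrow> 'a measure" where
  "borel_of X = sigma (mspace X) {U. openin (mtopology_of X) U}"

definition mdiam :: "'a metric \<Rightarrow> 'a set \<Rightarrow> ennreal" where
  "mdiam X S = (SUP x\<in>S. SUP y\<in>S. ennreal (mdist X x y))"

definition isometric_embedding :: "'a metric \<Rightarrow> 'b metric \<Rightarrow> ('a \<Rightarrow> 'b) \<Rightarrow> bool" where
  "isometric_embedding X Y \<phi> \<longleftrightarrow> \<phi> \<in> mspace X \<rightarrow> mspace Y \<and>
     (\<forall>x\<in>mspace X. \<forall>y\<in>mspace X. mdist Y (\<phi> x) (\<phi> y) = mdist X x y)"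

definition isometry :: "'a metric \<Rightarrow> 'b metric \<Rightarrow> ('a \<Rightarrow> 'b) \<Rightarrow> bool" where
  "isometry X Y \<phi> \<longleftrightarrow> isometric_embedding X Y \<phi> \<and> \<phi> ` mspace X = mspace Y"

abbreviation lipschitz_fun :: "'a metric \<Rightarrow> ('a \<Rightarrow> real) \<Rightarrow> bool" where
  "lipschitz_fun X f \<equiv> Lipschitz_continuous_map X euclidean_metric f"

definition Lip :: "'a metric \<Rightarrow> ('a \<Rightarrow> real) \<Rightarrow> real" where
  "Lip X f = Inf {L. 0 \<le> L \<and> (\<forall>x\<in>mspace X. \<forall>y\<in>mspace X. \<bar>f x - f y\<bar> \<le> L * mdist X x y)}"

section \<open>Euclidean space, Lebesgue measure and Hausdorff measure\<close>

text \<open>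
  The dimension has to be a term, since currents of dimension \<open>k\<close> and \<open>k + 1\<close> occur together.
  Points of Euclidean \<open>k\<close>-space are therefore functions on \<open>{..<k}\<close>, extended by \<open>undefined\<close>
  so as to match the carrier of the product measure.
\<close>

definition euclidean_space_metric :: "nat \<Rightarrow> (nat \<Rightarrow> real) metric" where
  "euclidean_space_metric k =
     metric ({..<k} \<rightarrow>\<^sub>E UNIV, \<lambda>x y. sqrt (\<Sum>i<k. (x i - y i)\<^sup>2))"

lemma Metric_space_euclidean:
  fixes k :: nat
  shows "Metric_space ({..<k} \<rightarrow>\<^sub>E (UNIV :: real set)) (\<lambda>x y. sqrt (\<Sum>i<k. (x i - y i)\<^sup>2))"
proof
  fix x y :: "nat \<Rightarrow> real"
  show "0 \<le> sqrt (\<Sum>i<k. (x i - y i)\<^sup>2)"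
    by (simp add: sum_nonneg)
  show "sqrt (\<Sum>i<k. (x i - y i)\<^sup>2) = sqrt (\<Sum>i<k. (y i - x i)\<^sup>2)"
    by (simp add: power2_commute)
  assume "x \<in> {..<k} \<rightarrow>\<^sub>E UNIV" "y \<in> {..<k} \<rightarrow>\<^sub>E UNIV"
  then show "sqrt (\<Sum>i<k. (x i - y i)\<^sup>2) = 0 \<longleftrightarrow> x = y"
    by (auto simp: sum_nonneg_eq_0_iff intro: PiE_ext)
next
  fix x y z :: "nat \<Rightarrow> real"
  show "sqrt (\<Sum>i<k. (x i - z i)\<^sup>2) \<le> sqrt (\<Sum>i<k. (x i - y i)\<^sup>2) + sqrt (\<Sum>i<k. (y i - z i)\<^sup>2)"
    using L2_set_triangle_ineq[of "\<lambda>i. x i - y i" "\<lambda>i. y i - z i" "{..<k}"]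
    by (simp add: L2_set_def)
qed

lemma mspace_euclidean_space_metric [simp]:
  "mspace (euclidean_space_metric k) = {..<k} \<rightarrow>\<^sub>E UNIV"
  unfolding euclidean_space_metric_def
  by (rule Metric_space.mspace_metric[OF Metric_space_euclidean])

lemma mdist_euclidean_space_metric [simp]:
  "mdist (euclidean_space_metric k) = (\<lambda>x y. sqrt (\<Sum>i<k. (x i - y i)\<^sup>2))"
  unfolding euclidean_space_metric_def
  by (rule Metric_space.mdist_metric[OF Metric_space_euclidean])

definition lebesgue_measure :: "nat \<Rightarrow> (nat \<Rightarrow> real) measure" where
  "lebesgue_measure k = completion (Pi\<^sub>M {..<k} (\<lambda>_. lborel))"

definition partial_deriv :: "((nat \<Rightarrow> real) \<Rightarrow> real) \<Rightarrow> nat \<Rightarrow> (nat \<Rightarrow> real) \<Rightarrow> real" where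
  "partial_deriv p j x = deriv (\<lambda>t. p (x(j := t))) (x j)"

definition jacobian_det :: "nat \<Rightarrow> ((nat \<Rightarrow> real) \<Rightarrow> real) list \<Rightarrow> (nat \<Rightarrow> real) \<Rightarrow> real" where
  "jacobian_det k \<pi> x =
     (\<Sum>\<sigma> | \<sigma> permutes {..<k}. of_int (sign \<sigma>) * (\<Prod>i<k. partial_deriv (\<pi> ! i) (\<sigma> i) x))"

text \<open>
  The Hausdorff measure is the outer measure on all subsets of the space, normalised so that
  it agrees with Lebesgue measure on Euclidean \<open>k\<close>-space; \<open>unit_ball_vol k\<close> is the volume of
  the Euclidean unit ball. Empty covering sets do not contribute, also for \<open>k = 0\<close>.
\<close>

definition hausdorff_pre :: "nat \<Rightarrow> 'a metric \<Rightarrow> ennreal \<Rightarrow> 'a set \<Rightarrow> ennreal" where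
  "hausdorff_pre k X \<delta> A =
     (INF E \<in> {E :: nat \<Rightarrow> 'a set. (\<forall>i. E i \<subseteq> mspace X \<and> mdiam X (E i) \<le> \<delta>) \<and> A \<subseteq> (\<Union>i. E i)}.
        \<Sum>i. if E i = {} then 0 else ennreal (unit_ball_vol (real k)) * (mdiam X (E i) / 2) ^ k)"

definition hausdorff :: "nat \<Rightarrow> 'a metric \<Rightarrow> 'a set \<Rightarrow> ennreal" where
  "hausdorff k X A = (SUP \<delta> \<in> {0<..}. hausdorff_pre k X \<delta> A)"

definition countably_rectifiable :: "nat \<Rightarrow> 'a metric \<Rightarrow> 'a set \<Rightarrow> bool" where
  "countably_rectifiable k X S \<longleftrightarrow> S \<subseteq> mspace X \<and>
     (\<exists>(B :: nat \<Rightarrow> (nat \<Rightarrow> real) set) g.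
        (\<forall>i. B i \<subseteq> mspace (euclidean_space_metric k) \<and>
             Lipschitz_continuous_map (submetric (euclidean_space_metric k) (B i)) X (g i)) \<and>
        hausdorff k X (S - (\<Union>i. g i ` B i)) = 0)"

section \<open>Metric currents\<close>

definition tuples :: "nat \<Rightarrow> 'a metric \<Rightarrow> (('a \<Rightarrow> real) \<times> ('a \<Rightarrow> real) list) set" where
  "tuples k X = {(f, \<pi>). lipschitz_fun X f \<and> bounded (f ` mspace X) \<and>
                         length \<pi> = k \<and> (\<forall>p\<in>set \<pi>. lipschitz_fun X p)}"

text \<open>
  A functional on \<open>tuples k X\<close> is represented by a function that is zero on all other arguments,
  so that equality of functionals is equality in HOL. The functions in a tuple are total
  on the type, but only their restrictions to \<open>mspace X\<close> are relevant: conditions (i) and (iii) below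
  force a current to depend on these restrictions only.
\<close>

type_synonym 'a functional = "('a \<Rightarrow> real) \<Rightarrow> ('a \<Rightarrow> real) list \<Rightarrow> real"

definition multilinear :: "nat \<Rightarrow> 'a metric \<Rightarrow> 'a functional \<Rightarrow> bool" where
  "multilinear k X T \<longleftrightarrow>
     (\<forall>f g \<pi> a b. (f, \<pi>) \<in> tuples k X \<and> (g, \<pi>) \<in> tuples k X \<longrightarrow>
        T (\<lambda>x. a * f x + b * g x) \<pi> = a * T f \<pi> + b * T g \<pi>) \<and>
     (\<forall>f \<pi> i p q a b. (f, \<pi>) \<in> tuples k X \<and> i < k \<and> lipschitz_fun X p \<and> lipschitz_fun X q \<longrightarrow>
        T f (\<pi>[i := \<lambda>x. a * p x + b * q x]) = a * T f (\<pi>[i := p]) + b * T f (\<pi>[i := q]))"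

definition continuity_axiom :: "nat \<Rightarrow> 'a metric \<Rightarrow> 'a functional \<Rightarrow> bool" where
  "continuity_axiom k X T \<longleftrightarrow>
     (\<forall>f \<pi> \<pi>s L. (f, \<pi>) \<in> tuples k X \<and> (\<forall>j. (f, \<pi>s j) \<in> tuples k X) \<and>
        (\<forall>i<k. \<forall>x\<in>mspace X. (\<lambda>j. (\<pi>s j ! i) x) \<longlonglongrightarrow> (\<pi> ! i) x) \<and>
        (\<forall>j. \<forall>i<k. Lip X (\<pi>s j ! i) \<le> L) \<longrightarrow>
        (\<lambda>j. T f (\<pi>s j)) \<longlonglongrightarrow> T f \<pi>)"

definition locality_axiom :: "nat \<Rightarrow> 'a metric \<Rightarrow> 'a functional \<Rightarrow> bool" where
  "locality_axiom k X T \<longleftrightarrow>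
     (\<forall>f \<pi> B. (f, \<pi>) \<in> tuples k X \<and> {x \<in> mspace X. f x \<noteq> 0} \<subseteq> (\<Union>i<k. B i) \<and>
        (\<forall>i<k. B i \<in> sets (borel_of X) \<and> (\<exists>c. \<forall>x\<in>B i. (\<pi> ! i) x = c)) \<longrightarrow>
        T f \<pi> = 0)"

definition mass_bound :: "nat \<Rightarrow> 'a metric \<Rightarrow> 'a functional \<Rightarrow> 'a measure \<Rightarrow> bool" where
  "mass_bound k X T \<mu> \<longleftrightarrow> sets \<mu> = sets (borel_of X) \<and> finite_measure \<mu> \<and>
     (\<forall>(f, \<pi>) \<in> tuples k X. \<bar>T f \<pi>\<bar> \<le> (\<Prod>p\<leftarrow>\<pi>. Lip X p) * (\<integral>x. \<bar>f x\<bar> \<partial>\<mu>))"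

definition current :: "nat \<Rightarrow> 'a metric \<Rightarrow> 'a functional \<Rightarrow> bool" where
  "current k X T \<longleftrightarrow> (\<forall>f \<pi>. (f, \<pi>) \<notin> tuples k X \<longrightarrow> T f \<pi> = 0) \<and>
     multilinear k X T \<and> continuity_axiom k X T \<and> locality_axiom k X T \<and> (\<exists>\<mu>. mass_bound k X T \<mu>)"

definition mass_measure :: "nat \<Rightarrow> 'a metric \<Rightarrow> 'a functional \<Rightarrow> 'a measure" where
  "mass_measure k X T = (THE \<mu>. mass_bound k X T \<mu> \<and>
     (\<forall>\<nu>. mass_bound k X T \<nu> \<longrightarrow> (\<forall>A\<in>sets (borel_of X). emeasure \<mu> A \<le> emeasure \<nu> A)))"

definition mass :: "nat \<Rightarrow> 'a metric \<Rightarrow> 'a functional \<Rightarrow> ennreal" where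
  "mass k X T = emeasure (mass_measure k X T) (mspace X)"

definition spt :: "nat \<Rightarrow> 'a metric \<Rightarrow> 'a functional \<Rightarrow> 'a set" where
  "spt k X T = {x \<in> mspace X. \<forall>r>0. emeasure (mass_measure k X T) (mball_of X x r) > 0}"

text \<open>
  The extension to bounded Borel functions in the first entry, by density of the bounded Lipschitz
  functions in \<open>L\<^sup>1\<close> of the mass measure.
\<close>

definition extended :: "nat \<Rightarrow> 'a metric \<Rightarrow> 'a functional \<Rightarrow> 'a functional" where
  "extended k X T f \<pi> = (THE l. \<forall>g. (\<forall>j. (g j, \<pi>) \<in> tuples k X) \<and>
     (\<lambda>j. \<integral>x. \<bar>g j x - f x\<bar> \<partial>mass_measure k X T) \<longlonglongrightarrow> 0 \<longrightarrow> (\<lambda>j. T (g j) \<pi>) \<longlonglongrightarrow> l)"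

definition restrict_current :: "nat \<Rightarrow> 'a metric \<Rightarrow> 'a functional \<Rightarrow> 'a set \<Rightarrow> 'a functional" where
  "restrict_current k X T A = (\<lambda>f \<pi>. if (f, \<pi>) \<in> tuples k X
     then extended k X T (\<lambda>x. f x * indicator A x) \<pi> else 0)"

text \<open>The boundary of a \<open>k\<close>-dimensional current, for \<open>k \<ge> 1\<close>.\<close>

definition boundary :: "nat \<Rightarrow> 'a metric \<Rightarrow> 'a functional \<Rightarrow> 'a functional" where
  "boundary k X T = (\<lambda>f \<pi>. if (f, \<pi>) \<in> tuples (k - 1) X then T (\<lambda>_. 1) (f # \<pi>) else 0)"

definition normal_current :: "nat \<Rightarrow> 'a metric \<Rightarrow> 'a functional \<Rightarrow> bool" where
  "normal_current k X T \<longleftrightarrow> current k X T \<and>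
     (k \<ge> 1 \<longrightarrow> (\<exists>\<mu>. mass_bound (k - 1) X (boundary k X T) \<mu>))"

definition pushforward :: "nat \<Rightarrow> 'b metric \<Rightarrow> ('a \<Rightarrow> 'b) \<Rightarrow> 'a functional \<Rightarrow> 'b functional" where
  "pushforward k Y \<phi> T = (\<lambda>g \<tau>. if (g, \<tau>) \<in> tuples k Y
     then T (g \<circ> \<phi>) (map (\<lambda>t. t \<circ> \<phi>) \<tau>) else 0)"

text \<open>
  The current regarded as a current on its support: a tuple on \<open>spt k X T\<close> is evaluated by
  extending its entries to Lipschitz functions on the whole space; the value does not
  depend on the extensions.
\<close>

definition on_spt :: "nat \<Rightarrow> 'a metric \<Rightarrow> 'a functional \<Rightarrow> 'a functional" where
  "on_spt k X T = (\<lambda>f \<pi>. if (f, \<pi>) \<in> tuples k (submetric X (spt k X T))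
     then (THE r. \<forall>F P. (F, P) \<in> tuples k X \<and>
             (\<forall>x\<in>spt k X T. F x = f x \<and> (\<forall>i<k. (P ! i) x = (\<pi> ! i) x)) \<longrightarrow> T F P = r)
     else 0)"

definition euclidean_current :: "nat \<Rightarrow> ((nat \<Rightarrow> real) \<Rightarrow> real) \<Rightarrow> (nat \<Rightarrow> real) functional" where
  "euclidean_current k \<theta> = (\<lambda>f \<pi>. if (f, \<pi>) \<in> tuples k (euclidean_space_metric k)
     then (\<integral>x. \<theta> x * f x * jacobian_det k \<pi> x \<partial>lebesgue_measure k) else 0)"

text \<open>
  ``Concentrated on \<open>S\<close>'' means that the complement of \<open>S\<close> is contained in a Borel set of measure
  zero, so \<open>S\<close> itself need not be Borel.
\<close>

definition integer_rectifiable :: "nat \<Rightarrow> 'a metric \<Rightarrow> 'a functional \<Rightarrow> bool" where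
  "integer_rectifiable k X T \<longleftrightarrow> current k X T \<and>
     (if k = 0 then
        (\<exists>n (\<theta> :: nat \<Rightarrow> int) x. (\<forall>i<n. \<theta> i \<noteq> 0 \<and> x i \<in> mspace X) \<and>
           (\<forall>(f, \<pi>) \<in> tuples 0 X. T f \<pi> = (\<Sum>i<n. of_int (\<theta> i) * f (x i))))
      else
        (\<exists>S. countably_rectifiable k X S \<and>
           (\<exists>N\<in>null_sets (mass_measure k X T). mspace X - S \<subseteq> N)) \<and>
        (\<forall>A\<in>sets (borel_of X). hausdorff k X A = 0 \<longrightarrow> emeasure (mass_measure k X T) A = 0) \<and>
        (\<forall>\<phi> U. Lipschitz_continuous_map X (euclidean_space_metric k) \<phi> \<and> openin (mtopology_of X) U \<longrightarrow>
           (\<exists>\<theta>. integrable (lebesgue_measure k) \<theta> \<and>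
                (\<forall>x\<in>mspace (euclidean_space_metric k). \<theta> x \<in> \<int>) \<and>
                pushforward k (euclidean_space_metric k) \<phi> (restrict_current k X T U) =
                  euclidean_current k \<theta>)))"

definition integral_current :: "nat \<Rightarrow> 'a metric \<Rightarrow> 'a functional \<Rightarrow> bool" where
  "integral_current k X T \<longleftrightarrow> integer_rectifiable k X T \<and> normal_current k X T"

definition flat_norm :: "nat \<Rightarrow> 'a metric \<Rightarrow> 'a functional \<Rightarrow> ennreal" where
  "flat_norm k Z S = (INF (U, V) \<in> {(U, V). integral_current k Z U \<and> integral_current (k + 1) Z V \<and>
        S = (\<lambda>f \<pi>. U f \<pi> + boundary (k + 1) Z V f \<pi>)}.
      mass k Z U + mass (k + 1) Z V)"

definition flat_dist :: "nat \<Rightarrow> 'a metric \<Rightarrow> 'a functional \<Rightarrow> 'a functional \<Rightarrow> ennreal" where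
  "flat_dist k Z T T' = flat_norm k Z (\<lambda>f \<pi>. T f \<pi> - T' f \<pi>)"

end

theory Submission
  imports Defs "HOL-Library.Diagonal_Subsequence"
begin

text \<open>
  Flat convergence implies convergence of values, uniformly on all tuples whose first entry and whose
  Lipschitz constants have a common bound (\<open>flat_norm_bound\<close>): in \<open>U + \<partial>V\<close> the first summand is
  controlled by the mass of \<open>U\<close> and the second, evaluated as \<open>V(1, f, \<pi>)\<close>, by the mass of \<open>V\<close>.
  This form of convergence is intrinsic. A tuple on \<open>Z\<close> can be transported to a tuple on \<open>Z'\<close> with the
  same bound that agrees with it on the common piece \<open>spt T\<^sub>n\<close>, by McShane extension, and there the
  approximating current does not distinguish the two. So the limits satisfy the symmetric relation
  \<open>linked\<close>: for large \<open>n\<close>, \<open>S\<close> and \<open>S'\<close> almost agree on bounded tuples that agree along the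
  \<open>n\<close>-th piece. In particular \<open>S' = 0\<close> forces \<open>S = 0\<close>.

  A point \<open>x\<close> of \<open>spt S\<close> is detected by tuples supported in small balls around it, hence it is a limit
  of points \<open>\<phi>\<^sub>n(y\<^sub>n)\<close> of the pieces. Transporting and cutting off such a tuple shows that \<open>S'\<close> has mass
  bounded below in every ball of fixed radius around \<open>\<phi>'\<^sub>n(y\<^sub>n)\<close> (\<open>spt_transport\<close>). As \<open>S'\<close> has finite
  mass, these points form a totally bounded sequence, which has a convergent subsequence, and the
  limit lies in \<open>spt S'\<close>. Passing to subsequences is unavoidable, since symmetries of the pieces may
  make \<open>\<phi>'\<^sub>n\<close> oscillate. The support of a rectifiable current is separable, so a diagonal
  sequence serves all \<open>x\<close> at once, and \<open>\<Psi> x = lim \<phi>'\<^sub>n(y\<^sub>n)\<close> preserves distances. It is onto by the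
  same argument with the two spaces exchanged.

  For the pushforward, a tuple on \<open>Z'\<close> is transported to \<open>Z\<close> along every piece. The resulting tuples
  are uniformly bounded and converge on \<open>spt S\<close> to the pullback under \<open>\<Psi>\<close>. The values of \<open>S\<close> then
  converge as well (\<open>current_tendsto\<close>): by locality, convergence almost everywhere with respect to
  the mass measure is enough. This uses that the mass measure exists (\<open>mass_measure_exists\<close>) and that it is
  concentrated on the support (\<open>integer_rectifiable_spt\<close>).
\<close>

section \<open>Lipschitz functions with explicit constants\<close>

definition lip_const :: "'a metric \<Rightarrow> real \<Rightarrow> ('a \<Rightarrow> real) \<Rightarrow> bool" where
  "lip_const X L f \<longleftrightarrow> 0 \<le> L \<and> (\<forall>x\<in>mspace X. \<forall>y\<in>mspace X. \<bar>f x - f y\<bar> \<le> L * mdist X x y)"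

lemma mdist_self: "x \<in> mspace X \<Longrightarrow> mdist X x x = 0"
  by simp

lemma lip_constI:
  assumes "0 \<le> L" "\<And>x y. x \<in> mspace X \<Longrightarrow> y \<in> mspace X \<Longrightarrow> f x - f y \<le> L * mdist X x y"
  shows "lip_const X L f"
  unfolding lip_const_def
proof (intro conjI ballI)
  fix x y assume "x \<in> mspace X" "y \<in> mspace X"
  then show "\<bar>f x - f y\<bar> \<le> L * mdist X x y"
    using assms(2)[of x y] assms(2)[of y x] by (simp add: abs_le_iff mdist_commute)
qed (use assms in auto)

lemma lip_constD:
  "lip_const X L f \<Longrightarrow> x \<in> mspace X \<Longrightarrow> y \<in> mspace X \<Longrightarrow> \<bar>f x - f y\<bar> \<le> L * mdist X x y"
  by (auto simp: lip_const_def)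

lemma lip_const_nonneg: "lip_const X L f \<Longrightarrow> 0 \<le> L"
  by (auto simp: lip_const_def)

lemma lip_const_mono:
  assumes "lip_const X L f" "L \<le> L'"
  shows "lip_const X L' f"
proof (rule lip_constI)
  show "0 \<le> L'" using assms lip_const_nonneg by fastforce
  fix x y assume "x \<in> mspace X" "y \<in> mspace X"
  then have "f x - f y \<le> L * mdist X x y" using lip_constD[OF assms(1)] by fastforce
  also have "\<dots> \<le> L' * mdist X x y" using assms by (intro mult_right_mono) auto
  finally show "f x - f y \<le> L' * mdist X x y" .
qed

lemma lipschitz_fun_iff: "lipschitz_fun X f \<longleftrightarrow> (\<exists>L. lip_const X L f)"
  unfolding Lipschitz_continuous_map_pos lip_const_def
  by (auto simp: dist_real_def intro: less_imp_le)
     (metis Lipschitz_continuous_map_pos Lipschitz_continuous_map_def UNIV_I Pi_I dist_real_def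
       mdist_euclidean_metric mspace_euclidean_metric)

lemma lip_const_Lip:
  assumes "lipschitz_fun X f"
  shows "lip_const X (Lip X f) f"
proof -
  obtain L0 where L0: "lip_const X L0 f" using assms by (auto simp: lipschitz_fun_iff)
  define A where "A = {L. lip_const X L f}"
  have A: "Lip X f = Inf A" "A \<noteq> {}" "\<And>L. L \<in> A \<Longrightarrow> 0 \<le> L"
    using L0 by (auto simp: Lip_def A_def lip_const_def)
  show ?thesis
  proof (rule lip_constI)
    show "0 \<le> Lip X f" using A by (metis cInf_greatest)
    fix x y assume xy: "x \<in> mspace X" "y \<in> mspace X"
    show "f x - f y \<le> Lip X f * mdist X x y"
    proof (cases "mdist X x y = 0")
      case True then show ?thesis using lip_constD[OF L0 xy] by auto
    next
      case False
      then have pos: "mdist X x y > 0" by (simp add: order_less_le)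
      have "(f x - f y) / mdist X x y \<le> Inf A"
      proof (rule cInf_greatest[OF A(2)])
        fix L assume "L \<in> A"
        then show "(f x - f y) / mdist X x y \<le> L"
          using lip_constD[of X L f x y] xy pos by (auto simp: A_def divide_simps mult.commute)
      qed
      then show ?thesis using A(1) pos by (simp add: divide_simps mult.commute)
    qed
  qed
qed

lemma Lip_le: "lip_const X L f \<Longrightarrow> Lip X f \<le> L"
  unfolding Lip_def lip_const_def by (rule cInf_lower) (auto intro: bdd_belowI[of _ 0])

lemma Lip_nonneg: "lipschitz_fun X f \<Longrightarrow> 0 \<le> Lip X f"
  using lip_const_Lip lip_const_nonneg by blast

lemma lip_const_const: "0 \<le> L \<Longrightarrow> lip_const X L (\<lambda>_. c)"
  by (rule lip_constI) auto

lemma lip_const_add: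
  assumes "lip_const X L f" "lip_const X M g"
  shows "lip_const X (L + M) (\<lambda>x. f x + g x)"
proof (rule lip_constI)
  show "0 \<le> L + M" using assms by (auto simp: lip_const_def)
  fix x y assume "x \<in> mspace X" "y \<in> mspace X"
  then show "f x + g x - (f y + g y) \<le> (L + M) * mdist X x y"
    using lip_constD[OF assms(1), of x y] lip_constD[OF assms(2), of x y] by (simp add: distrib_right)
qed

lemma lip_const_cmult:
  assumes "lip_const X L f"
  shows "lip_const X (\<bar>c\<bar> * L) (\<lambda>x. c * f x)"
proof (rule lip_constI)
  show "0 \<le> \<bar>c\<bar> * L" using assms by (auto simp: lip_const_def)
  fix x y assume xy: "x \<in> mspace X" "y \<in> mspace X"
  have "c * f x - c * f y \<le> \<bar>c\<bar> * \<bar>f x - f y\<bar>"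
    by (metis abs_ge_self abs_mult right_diff_distrib)
  also have "\<dots> \<le> \<bar>c\<bar> * (L * mdist X x y)"
    using lip_constD[OF assms xy] by (intro mult_left_mono) auto
  finally show "c * f x - c * f y \<le> \<bar>c\<bar> * L * mdist X x y" by (simp add: mult.assoc)
qed

lemma lip_const_diff:
  assumes "lip_const X L f" "lip_const X M g"
  shows "lip_const X (L + M) (\<lambda>x. f x - g x)"
  using lip_const_add[OF assms(1) lip_const_cmult[OF assms(2), of "-1"]] by simp

lemma lip_const_mult:
  assumes f: "lip_const X L f" "\<And>x. x \<in> mspace X \<Longrightarrow> \<bar>f x\<bar> \<le> A"
    and g: "lip_const X M g" "\<And>x. x \<in> mspace X \<Longrightarrow> \<bar>g x\<bar> \<le> B"
    and "0 \<le> A" "0 \<le> B"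
  shows "lip_const X (L * B + A * M) (\<lambda>x. f x * g x)"
proof (rule lip_constI)
  show "0 \<le> L * B + A * M" using assms by (auto simp: lip_const_def)
  fix x y assume xy: "x \<in> mspace X" "y \<in> mspace X"
  have "f x * g x - f y * g y = (f x - f y) * g x + f y * (g x - g y)" by (simp add: algebra_simps)
  also have "\<dots> \<le> \<bar>f x - f y\<bar> * \<bar>g x\<bar> + \<bar>f y\<bar> * \<bar>g x - g y\<bar>"
    by (metis abs_ge_self abs_mult add_mono)
  also have "\<dots> \<le> (L * mdist X x y) * B + A * (M * mdist X x y)"
    using xy assms by (intro add_mono mult_mono lip_constD) (auto simp: lip_const_nonneg)
  finally show "f x * g x - f y * g y \<le> (L * B + A * M) * mdist X x y"
    by (simp add: algebra_simps)
qed

lemma lip_const_compose: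
  assumes "lip_const X L f" "\<And>s t. \<bar>h s - h t\<bar> \<le> M * \<bar>s - t\<bar>" "0 \<le> M"
  shows "lip_const X (M * L) (\<lambda>x. h (f x))"
proof (rule lip_constI)
  show "0 \<le> M * L" using assms by (auto simp: lip_const_def)
  fix x y assume xy: "x \<in> mspace X" "y \<in> mspace X"
  have "h (f x) - h (f y) \<le> M * \<bar>f x - f y\<bar>" using assms(2) by (metis abs_le_D1)
  also have "\<dots> \<le> M * (L * mdist X x y)"
    using lip_constD[OF assms(1) xy] assms by (intro mult_left_mono) auto
  finally show "h (f x) - h (f y) \<le> M * L * mdist X x y" by (simp add: mult.assoc)
qed

lemma lip_const_abs: "lip_const X L f \<Longrightarrow> lip_const X L (\<lambda>x. \<bar>f x\<bar>)"
  using lip_const_compose[of X L f abs 1] by fastforce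

lemma lip_const_min: "lip_const X L f \<Longrightarrow> lip_const X L (\<lambda>x. min c (f x))"
  using lip_const_compose[of X L f "min c" 1] by (auto simp: min_def abs_if)

lemma lip_const_max: "lip_const X L f \<Longrightarrow> lip_const X L (\<lambda>x. max c (f x))"
  using lip_const_compose[of X L f "max c" 1] by (auto simp: max_def abs_if)

lemma lip_const_max2:
  assumes "lip_const X L f" "lip_const X L g"
  shows "lip_const X L (\<lambda>x. max (f x) (g x))"
proof (rule lip_constI)
  show "0 \<le> L" using assms by (auto simp: lip_const_def)
  fix x y assume xy: "x \<in> mspace X" "y \<in> mspace X"
  then show "max (f x) (g x) - max (f y) (g y) \<le> L * mdist X x y"
    using lip_constD[OF assms(1) xy] lip_constD[OF assms(2) xy] by (auto simp: max_def abs_le_iff)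
qed

lemma lip_const_mdist:
  assumes "a \<in> mspace X"
  shows "lip_const X 1 (mdist X a)"
proof (rule lip_constI)
  fix x y assume "x \<in> mspace X" "y \<in> mspace X"
  then show "mdist X a x - mdist X a y \<le> 1 * mdist X x y"
    using mdist_triangle[of a X y x] assms by (simp add: mdist_commute)
qed auto

text \<open>
  McShane's extension: the infimum of the cones with slope \<open>L\<close> over the prescribed values. The domain
  is parametrised by a map \<open>\<psi>\<close> so that functions can be carried from one space to another.
\<close>

lemma McShane_extension:
  assumes "0 \<le> L" and \<psi>: "\<And>y. y \<in> Y \<Longrightarrow> \<psi> y \<in> mspace W"
    and u: "\<And>y z. y \<in> Y \<Longrightarrow> z \<in> Y \<Longrightarrow> u y - u z \<le> L * mdist W (\<psi> y) (\<psi> z)"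
  shows "\<exists>U. lip_const W L U \<and> (\<forall>y\<in>Y. U (\<psi> y) = u y)"
proof (cases "Y = {}")
  case True
  then show ?thesis using lip_const_const[OF assms(1)] by blast
next
  case False
  define U where "U w = (INF y\<in>Y. u y + L * mdist W w (\<psi> y))" for w
  have tri: "mdist W (\<psi> y) (\<psi> z) \<le> mdist W w (\<psi> y) + mdist W w (\<psi> z)"
    if "w \<in> mspace W" "y \<in> Y" "z \<in> Y" for w y z
    using mdist_triangle[of "\<psi> y" W w "\<psi> z"] that \<psi> by (simp add: mdist_commute)
  have bdd: "bdd_below ((\<lambda>y. u y + L * mdist W w (\<psi> y)) ` Y)" if w: "w \<in> mspace W" for w
  proof -
    obtain z where z: "z \<in> Y" using False by blast
    show ?thesis
    proof (rule bdd_belowI2[where m = "u z - L * mdist W w (\<psi> z)"])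
      fix y assume y: "y \<in> Y"
      have "L * mdist W (\<psi> z) (\<psi> y) \<le> L * (mdist W w (\<psi> z) + mdist W w (\<psi> y))"
        using tri[OF w z y] assms(1) by (rule mult_left_mono)
      then show "u z - L * mdist W w (\<psi> z) \<le> u y + L * mdist W w (\<psi> y)"
        using u[OF z y] by (simp add: distrib_left)
    qed
  qed
  have "lip_const W L U"
  proof (rule lip_constI[OF assms(1)])
    fix v w assume vw: "v \<in> mspace W" "w \<in> mspace W"
    have "U v - L * mdist W v w \<le> U w"
      unfolding U_def[of w]
    proof (rule cINF_greatest[OF False])
      fix y assume y: "y \<in> Y"
      have "U v \<le> u y + L * mdist W v (\<psi> y)"
        unfolding U_def by (rule cINF_lower[OF bdd[OF vw(1)] y])
      moreover have "L * mdist W v (\<psi> y) \<le> L * (mdist W v w + mdist W w (\<psi> y))"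
        using mdist_triangle[of v W w "\<psi> y"] vw \<psi>[OF y] assms(1) by (intro mult_left_mono) auto
      ultimately show "U v - L * mdist W v w \<le> u y + L * mdist W w (\<psi> y)"
        by (simp add: distrib_left)
    qed
    then show "U v - U w \<le> L * mdist W v w" by simp
  qed
  moreover have "U (\<psi> y) = u y" if y: "y \<in> Y" for y
  proof (rule antisym)
    show "U (\<psi> y) \<le> u y"
      unfolding U_def using cINF_lower[OF bdd[OF \<psi>[OF y]] y] \<psi>[OF y] by (simp add: mdist_self)
    show "u y \<le> U (\<psi> y)"
      unfolding U_def using u[OF y] by (intro cINF_greatest[OF False]) (simp add: algebra_simps)
  qed
  ultimately show ?thesis by blast
qed

section \<open>Tuples with a common bound\<close>

text \<open>
  One constant for all entries expresses the uniformity in which flat convergence controls the values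
  of currents. A bounded tuple stays bounded when the constant grows, so several tuples can always
  share one.
\<close>

definition bdd_tuples :: "nat \<Rightarrow> 'a metric \<Rightarrow> real \<Rightarrow> (('a \<Rightarrow> real) \<times> ('a \<Rightarrow> real) list) set" where
  "bdd_tuples k X K = {(f, \<pi>). lip_const X K f \<and> (\<forall>x\<in>mspace X. \<bar>f x\<bar> \<le> K) \<and>
                         length \<pi> = k \<and> (\<forall>p\<in>set \<pi>. lip_const X K p)}"

lemma bdd_tuples_mono: "(f, \<pi>) \<in> bdd_tuples k X K \<Longrightarrow> K \<le> K' \<Longrightarrow> (f, \<pi>) \<in> bdd_tuples k X K'"
  by (force simp: bdd_tuples_def intro: lip_const_mono order_trans)

lemma bdd_tuples_nonneg: "(f, \<pi>) \<in> bdd_tuples k X K \<Longrightarrow> 0 \<le> K"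
  by (auto simp: bdd_tuples_def lip_const_nonneg)

lemma bdd_tuples_imp_tuples: "(f, \<pi>) \<in> bdd_tuples k X K \<Longrightarrow> (f, \<pi>) \<in> tuples k X"
  by (auto simp: bdd_tuples_def tuples_def lipschitz_fun_iff bounded_iff)

lemma tuples_imp_bdd_tuples:
  assumes "(f, \<pi>) \<in> tuples k X"
  shows "\<exists>K>0. (f, \<pi>) \<in> bdd_tuples k X K"
proof -
  have f: "lip_const X (Lip X f) f" and \<pi>: "\<forall>p\<in>set \<pi>. lip_const X (Lip X p) p" "length \<pi> = k"
    using assms by (auto simp: tuples_def lip_const_Lip)
  obtain M where M: "\<forall>x\<in>mspace X. \<bar>f x\<bar> \<le> M"
    using assms by (auto simp: tuples_def bounded_iff)
  define K where "K = 1 + Lip X f + \<bar>M\<bar> + (\<Sum>p\<in>set \<pi>. Lip X p)"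
  have nn: "0 \<le> Lip X f" "\<And>p. p \<in> set \<pi> \<Longrightarrow> 0 \<le> Lip X p"
    using f \<pi> lip_const_nonneg by blast+
  then have s: "0 \<le> (\<Sum>p\<in>set \<pi>. Lip X p)" by (simp add: sum_nonneg)
  have "Lip X p \<le> K" if "p \<in> set \<pi>" for p
    using member_le_sum[of p "set \<pi>" "Lip X"] nn that by (auto simp: K_def)
  then have "(f, \<pi>) \<in> bdd_tuples k X K"
    using f \<pi> M nn s by (force simp: bdd_tuples_def K_def intro: lip_const_mono)
  moreover have "K > 0" using nn s by (auto simp: K_def)
  ultimately show ?thesis by blast
qed

section \<open>Finite Borel measures and Lipschitz functions\<close>

lemma space_borel_of [simp]: "space (borel_of X) = mspace X"
  and sets_borel_of: "sets (borel_of X) = sigma_sets (mspace X) {U. openin (mtopology_of X) U}"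
proof -
  have "{U. openin (mtopology_of X) U} \<subseteq> Pow (mspace X)"
    using openin_subset[of "mtopology_of X"] by auto
  then show "space (borel_of X) = mspace X"
    "sets (borel_of X) = sigma_sets (mspace X) {U. openin (mtopology_of X) U}"
    by (auto simp: borel_of_def)
qed

lemma openin_borel_of: "openin (mtopology_of X) U \<Longrightarrow> U \<in> sets (borel_of X)"
  by (auto simp: sets_borel_of intro: sigma_sets.Basic)

lemma openin_mtopology_of_iff:
  "openin (mtopology_of X) U \<longleftrightarrow> U \<subseteq> mspace X \<and> (\<forall>x\<in>U. \<exists>r>0. mball_of X x r \<subseteq> U)"
  unfolding mtopology_of_def mball_of_def by (subst Metric_space.openin_mtopology) auto

lemma mball_of_borel: "mball_of X x r \<in> sets (borel_of X)"
  unfolding mball_of_def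
  by (intro openin_borel_of) (simp add: mtopology_of_def Metric_space.openin_mball)

lemma lip_const_measurable:
  assumes "lip_const X L f"
  shows "f \<in> borel_measurable (borel_of X)"
proof (rule borel_measurableI)
  fix S :: "real set" assume S: "open S"
  have "openin (mtopology_of X) (f -` S \<inter> mspace X)"
    unfolding openin_mtopology_of_iff
  proof (intro conjI ballI)
    fix x assume x: "x \<in> f -` S \<inter> mspace X"
    then obtain e where e: "e > 0" "\<And>t. \<bar>t - f x\<bar> < e \<Longrightarrow> t \<in> S"
      using S by (auto simp: open_dist dist_real_def)
    have L: "0 \<le> L" using assms lip_const_nonneg by blast
    have "mball_of X x (e / (L + 1)) \<subseteq> f -` S \<inter> mspace X"
    proof
      fix y assume "y \<in> mball_of X x (e / (L + 1))"
      then have y: "y \<in> mspace X" "mdist X x y < e / (L + 1)" by auto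
      have "\<bar>f y - f x\<bar> \<le> L * mdist X y x" using assms x y by (auto intro: lip_constD)
      also have "\<dots> \<le> (L + 1) * mdist X x y" by (simp add: mdist_commute mult_right_mono)
      also have "\<dots> < e" using y(2) L by (simp add: field_simps)
      finally show "y \<in> f -` S \<inter> mspace X" using e y by auto
    qed
    moreover have "e / (L + 1) > 0" using e L by simp
    ultimately show "\<exists>r>0. mball_of X x r \<subseteq> f -` S \<inter> mspace X" by blast
  qed auto
  then show "f -` S \<inter> space (borel_of X) \<in> sets (borel_of X)" by (simp add: openin_borel_of)
qed

definition finite_borel :: "'a metric \<Rightarrow> 'a measure \<Rightarrow> bool" where
  "finite_borel X \<mu> \<longleftrightarrow> sets \<mu> = sets (borel_of X) \<and> finite_measure \<mu>"

lemma finite_borelD: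
  assumes "finite_borel X \<mu>"
  shows "sets \<mu> = sets (borel_of X)" "finite_measure \<mu>" "space \<mu> = mspace X"
  using assms by (auto simp: finite_borel_def dest: sets_eq_imp_space_eq)

lemma lip_const_borel_measurable:
  "finite_borel X \<mu> \<Longrightarrow> lip_const X L f \<Longrightarrow> f \<in> borel_measurable \<mu>"
  using lip_const_measurable[of X L f] by (simp add: finite_borel_def cong: measurable_cong_sets)

lemma finite_borel_integrable:
  fixes f :: "'a \<Rightarrow> real"
  assumes "finite_borel X \<mu>" "f \<in> borel_measurable \<mu>" "\<And>x. x \<in> mspace X \<Longrightarrow> \<bar>f x\<bar> \<le> M"
  shows "integrable \<mu> f"
proof -
  interpret finite_measure \<mu> using assms finite_borelD by blast
  show ?thesis
    using assms(2,3) finite_borelD(3)[OF assms(1)] by (intro integrable_const_bound[of f M]) auto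
qed

text \<open>
  Truncated multiples of the distance to the complement of \<open>U\<close> increase to its indicator.
\<close>

lemma open_indicator_limit:
  assumes "openin (mtopology_of X) U"
  shows "\<exists>h. (\<forall>j. lip_const X (real j) (h j) \<and> (\<forall>x. 0 \<le> h j x \<and> h j x \<le> 1)) \<and>
     (\<forall>x\<in>mspace X. (\<lambda>j. h j x) \<longlonglongrightarrow> indicator U x)"
proof (cases "mspace X - U = {}")
  case True
  then have "x \<in> U" if "x \<in> mspace X" for x using that by blast
  then show ?thesis by (intro exI[of _ "\<lambda>_ _. 1"]) (auto intro!: lip_const_const)
next
  case False
  define d where "d x = (INF y\<in>mspace X - U. mdist X x y)" for x
  have bdd: "bdd_below (mdist X x ` (mspace X - U))" for x by (rule bdd_belowI2[where m = 0]) auto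
  have d: "lip_const X 1 d"
  proof (rule lip_constI)
    fix x y assume xy: "x \<in> mspace X" "y \<in> mspace X"
    have "d x - mdist X x y \<le> d y"
      unfolding d_def[of y]
    proof (rule cINF_greatest[OF False])
      fix z assume z: "z \<in> mspace X - U"
      have "d x \<le> mdist X x z" unfolding d_def by (rule cINF_lower[OF bdd z])
      then show "d x - mdist X x y \<le> mdist X y z" using mdist_triangle[of x X y z] xy z by auto
    qed
    then show "d x - d y \<le> 1 * mdist X x y" by simp
  qed simp
  have d0: "d x = 0" if "x \<in> mspace X - U" for x
  proof (rule antisym)
    show "d x \<le> 0" unfolding d_def using cINF_lower[OF bdd that, of x] that by (simp add: mdist_self)
    show "0 \<le> d x" unfolding d_def by (rule cINF_greatest[OF False]) simp
  qed
  have dpos: "d x > 0" if xU: "x \<in> U" for x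
  proof -
    obtain r where r: "r > 0" "mball_of X x r \<subseteq> U"
      using assms xU unfolding openin_mtopology_of_iff by blast
    have "r \<le> d x" unfolding d_def
    proof (rule cINF_greatest[OF False])
      fix z assume "z \<in> mspace X - U"
      then have "z \<notin> mball_of X x r" "z \<in> mspace X" "x \<in> mspace X"
        using r xU assms openin_subset by fastforce+
      then show "r \<le> mdist X x z" by auto
    qed
    then show ?thesis using r by simp
  qed
  define h where "h j x = max 0 (min 1 (real j * d x))" for j x
  have "lip_const X (real j) (h j)" for j
    unfolding h_def using lip_const_max[OF lip_const_min[OF lip_const_cmult[OF d]]]
    by (metis abs_of_nat mult.right_neutral)
  moreover have "(\<lambda>j. h j x) \<longlonglongrightarrow> indicator U x" if x: "x \<in> mspace X" for x
  proof (cases "x \<in> U")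
    case True
    obtain N where N: "1 / d x < real N" using reals_Archimedean2 by blast
    have "\<forall>\<^sub>F j in sequentially. h j x = indicator U x"
    proof (rule eventually_sequentiallyI[of N])
      fix j assume "N \<le> j"
      then have "1 / d x < real j" using N by (meson less_le_trans of_nat_le_iff)
      then show "h j x = indicator U x" using dpos[OF True] True
        by (simp add: h_def divide_simps)
    qed
    then show ?thesis by (rule tendsto_eventually)
  next
    case False then show ?thesis using d0 x by (simp add: h_def)
  qed
  ultimately show ?thesis by (intro exI[of _ h]) (auto simp: h_def)
qed

text \<open>
  The sets whose indicator is an \<open>L\<^sup>1\<close>-limit of Lipschitz functions form a \<open>\<sigma>\<close>-algebra, and it contains
  the open sets.
\<close>

lemma Lipschitz_approx_indicator:
  assumes \<mu>: "finite_borel X \<mu>" and A: "A \<in> sets (borel_of X)" and "0 < \<epsilon>"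
  shows "\<exists>h L. lip_const X L h \<and> (\<forall>x. 0 \<le> h x \<and> h x \<le> 1) \<and> (\<integral>x. \<bar>h x - indicator A x\<bar> \<partial>\<mu>) < \<epsilon>"
proof -
  interpret finite_measure \<mu> using \<mu> finite_borelD by blast
  note sp = finite_borelD(3)[OF \<mu>] and st = finite_borelD(1)[OF \<mu>]
  note bm = lip_const_borel_measurable[OF \<mu>]
  have dom: "(\<lambda>j. \<integral>x. \<bar>g j x - h x\<bar> \<partial>\<mu>) \<longlonglongrightarrow> 0"
    if "\<And>j. g j \<in> borel_measurable \<mu>" "h \<in> borel_measurable \<mu>"
      "\<And>j x. 0 \<le> g j x \<and> g j x \<le> 1" "\<And>x. 0 \<le> h x \<and> h x \<le> 1"
      "\<And>x. x \<in> mspace X \<Longrightarrow> (\<lambda>j. g j x) \<longlonglongrightarrow> h x" for g :: "nat \<Rightarrow> 'a \<Rightarrow> real" and h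
  proof -
    have "(\<lambda>j. \<integral>x. \<bar>g j x - h x\<bar> \<partial>\<mu>) \<longlonglongrightarrow> (\<integral>x. 0 \<partial>\<mu>)"
    proof (rule integral_dominated_convergence[where w = "\<lambda>_. 1"])
      show "AE x in \<mu>. (\<lambda>j. \<bar>g j x - h x\<bar>) \<longlonglongrightarrow> 0"
        using that(5) sp by (intro AE_I2) (simp add: LIM_zero tendsto_rabs_zero)
      show "AE x in \<mu>. norm \<bar>g j x - h x\<bar> \<le> 1" for j
        using that(3)[of j] that(4) by (intro AE_I2) (smt (verit) real_norm_def)
    qed (use that in auto)
    then show ?thesis by simp
  qed
  have "A \<in> sigma_sets (mspace X) {U. openin (mtopology_of X) U}" using A sets_borel_of by blast
  then show ?thesis using \<open>0 < \<epsilon>\<close>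
  proof (induction arbitrary: \<epsilon> rule: sigma_sets.induct)
    case (Basic U)
    then have U: "openin (mtopology_of X) U" by simp
    then obtain h where h: "\<And>j. lip_const X (real j) (h j)" "\<And>j x. 0 \<le> h j x \<and> h j x \<le> 1"
        "\<And>x. x \<in> mspace X \<Longrightarrow> (\<lambda>j. h j x) \<longlonglongrightarrow> indicator U x"
      using open_indicator_limit[OF U] by auto
    have Um: "U \<in> sets \<mu>" using U st openin_borel_of by blast
    have "(\<lambda>j. \<integral>x. \<bar>h j x - indicator U x\<bar> \<partial>\<mu>) \<longlonglongrightarrow> 0"
      using h(3) Um by (intro dom bm[OF h(1)] h(2)) (auto simp: indicator_def)
    then have "\<forall>\<^sub>F j in sequentially. (\<integral>x. \<bar>h j x - indicator U x\<bar> \<partial>\<mu>) < \<epsilon>"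
      using Basic.prems order_tendstoD(2) by blast
    then obtain j where "(\<integral>x. \<bar>h j x - indicator U x\<bar> \<partial>\<mu>) < \<epsilon>"
      using eventually_happens'[OF sequentially_bot] by blast
    then show ?case using h by blast
  next
    case Empty
    then show ?case by (intro exI[of _ "\<lambda>_. 0"] exI[of _ 0]) (auto intro: lip_const_const)
  next
    case (Compl A)
    obtain h L where h: "lip_const X L h" "\<forall>x. 0 \<le> h x \<and> h x \<le> 1" "(\<integral>x. \<bar>h x - indicator A x\<bar> \<partial>\<mu>) < \<epsilon>"
      using Compl by blast
    have "(\<integral>x. \<bar>(1 - h x) - indicator (mspace X - A) x\<bar> \<partial>\<mu>) = (\<integral>x. \<bar>h x - indicator A x\<bar> \<partial>\<mu>)"
      by (rule Bochner_Integration.integral_cong) (auto simp: sp indicator_def)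
    moreover have "lip_const X (0 + L) (\<lambda>x. 1 - h x)"
      by (rule lip_const_diff[OF lip_const_const h(1)]) simp
    ultimately show ?case using h(2,3) by (intro exI[of _ "\<lambda>x. 1 - h x"] exI[of _ "0 + L"]) auto
  next
    case (Union a)
    have am: "a i \<in> sets \<mu>" for i using Union st sets_borel_of by blast
    define B where "B n = (\<Union>i<n. a i)" for n
    have Bm: "B n \<in> sets \<mu>" for n using am by (auto simp: B_def)
    have "(\<lambda>n. \<integral>x. \<bar>indicator (B n) x - indicator (\<Union>(range a)) x :: real\<bar> \<partial>\<mu>) \<longlonglongrightarrow> 0"
    proof (rule dom)
      fix x
      show "(\<lambda>n. indicator (B n) x :: real) \<longlonglongrightarrow> indicator (\<Union>(range a)) x"
      proof (cases "x \<in> \<Union>(range a)")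
        case True
        then obtain i where "x \<in> a i" by blast
        then have "\<forall>\<^sub>F n in sequentially. indicator (B n) x = (indicator (\<Union>(range a)) x :: real)"
          by (intro eventually_sequentiallyI[of "Suc i"]) (auto simp: B_def indicator_def)
        then show ?thesis by (rule tendsto_eventually)
      next
        case False then show ?thesis by (auto simp: B_def indicator_def)
      qed
    qed (use am Bm in \<open>auto simp: indicator_def\<close>)
    then have "\<forall>\<^sub>F n in sequentially. (\<integral>x. \<bar>indicator (B n) x - indicator (\<Union>(range a)) x\<bar> \<partial>\<mu>) < \<epsilon>/2"
      using \<open>\<epsilon> > 0\<close> order_tendstoD(2) half_gt_zero by blast
    then obtain n where n: "(\<integral>x. \<bar>indicator (B n) x - indicator (\<Union>(range a)) x\<bar> \<partial>\<mu>) < \<epsilon>/2"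
      using eventually_happens'[OF sequentially_bot] by blast
    have "\<exists>h L. lip_const X L h \<and> (\<forall>x. 0 \<le> h x \<and> h x \<le> 1) \<and> (\<integral>x. \<bar>h x - indicator (B m) x\<bar> \<partial>\<mu>) < \<delta>"
      if "\<delta> > 0" for \<delta> m
      using that
    proof (induction m arbitrary: \<delta>)
      case 0
      then show ?case
        by (intro exI[of _ "\<lambda>_. 0"] exI[of _ 0]) (auto simp: B_def intro: lip_const_const)
    next
      case (Suc m)
      obtain h L where h: "lip_const X L h" "\<forall>x. 0 \<le> h x \<and> h x \<le> 1"
          "(\<integral>x. \<bar>h x - indicator (B m) x\<bar> \<partial>\<mu>) < \<delta>/2"
        using Suc.IH[of "\<delta>/2"] Suc.prems by auto
      obtain h' L' where h': "lip_const X L' h'" "\<forall>x. 0 \<le> h' x \<and> h' x \<le> 1"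
          "(\<integral>x. \<bar>h' x - indicator (a m) x\<bar> \<partial>\<mu>) < \<delta>/2"
        using Union.IH[of "\<delta>/2" m] Suc.prems by auto
      define M where "M = max L L'"
      have L: "lip_const X M (\<lambda>x. max (h x) (h' x))"
        using h(1) h'(1) by (intro lip_const_max2; elim lip_const_mono; simp add: M_def)
      have B: "indicator (B (Suc m)) x = max (indicator (B m) x) (indicator (a m) x :: real)" for x
        by (auto simp: B_def indicator_def less_Suc_eq)
      have i1: "integrable \<mu> (\<lambda>x. \<bar>h x - indicator (B m) x\<bar>)"
        using h am Bm bm[OF h(1)]
        by (intro finite_borel_integrable[OF \<mu>, where M = 1]) (auto simp: indicator_def)
      have i2: "integrable \<mu> (\<lambda>x. \<bar>h' x - indicator (a m) x\<bar>)"
        using h' am Bm bm[OF h'(1)]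
        by (intro finite_borel_integrable[OF \<mu>, where M = 1]) (auto simp: indicator_def)
      have "(\<integral>x. \<bar>max (h x) (h' x) - indicator (B (Suc m)) x\<bar> \<partial>\<mu>) \<le>
          (\<integral>x. \<bar>h x - indicator (B m) x\<bar> + \<bar>h' x - indicator (a m) x\<bar> \<partial>\<mu>)"
      proof (rule integral_mono')
        show "integrable \<mu> (\<lambda>x. \<bar>h x - indicator (B m) x\<bar> + \<bar>h' x - indicator (a m) x\<bar>)"
          using i1 i2 by simp
      qed (auto simp: B max_def abs_if)
      also have "\<dots> < \<delta>" using i1 i2 h(3) h'(3) by simp
      finally show ?case using L h(2) h'(2)
        by (intro exI[of _ "\<lambda>x. max (h x) (h' x)"] exI[of _ M]) (auto simp: le_max_iff_disj)
    qed
    from this[of "\<epsilon>/2" n] \<open>\<epsilon> > 0\<close> obtain h L where h: "lip_const X L h" "\<forall>x. 0 \<le> h x \<and> h x \<le> 1"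
          "(\<integral>x. \<bar>h x - indicator (B n) x\<bar> \<partial>\<mu>) < \<epsilon>/2"
      by auto
    have Um: "\<Union>(range a) \<in> sets \<mu>" using am by auto
    have i1: "integrable \<mu> (\<lambda>x. \<bar>h x - indicator (B n) x\<bar>)"
      using h am Bm bm[OF h(1)]
      by (intro finite_borel_integrable[OF \<mu>, where M = 1]) (auto simp: indicator_def)
    have i2: "integrable \<mu> (\<lambda>x. \<bar>indicator (B n) x - indicator (\<Union>(range a)) x :: real\<bar>)"
      using Um Bm by (intro finite_borel_integrable[OF \<mu>, where M = 1] borel_measurable_abs
          borel_measurable_diff borel_measurable_indicator) (auto simp: indicator_def)
    have "(\<integral>x. \<bar>h x - indicator (\<Union>(range a)) x\<bar> \<partial>\<mu>) \<le>
        (\<integral>x. \<bar>h x - indicator (B n) x\<bar> + \<bar>indicator (B n) x - indicator (\<Union>(range a)) x\<bar> \<partial>\<mu>)"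
    proof (rule integral_mono')
      show "integrable \<mu> (\<lambda>x. \<bar>h x - indicator (B n) x\<bar> + \<bar>indicator (B n) x - indicator (\<Union>(range a)) x\<bar>)"
        using i1 i2 by simp
    qed auto
    also have "\<dots> < \<epsilon>" using i1 i2 h(3) n by simp
    finally show ?case using h by blast
  qed
qed

section \<open>Existence of the mass measure\<close>

definition msum :: "'a measure \<Rightarrow> 'a measure \<Rightarrow> 'a measure" where
  "msum \<mu> \<nu> = measure_of (space \<mu>) (sets \<mu>) (\<lambda>B. emeasure \<mu> B + emeasure \<nu> B)"

lemma sets_msum [simp, measurable_cong]: "sets (msum \<mu> \<nu>) = sets \<mu>"
  and space_msum [simp]: "space (msum \<mu> \<nu>) = space \<mu>"
  by (auto simp: msum_def)

lemma emeasure_msum: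
  assumes "sets \<nu> = sets \<mu>" "B \<in> sets \<mu>"
  shows "emeasure (msum \<mu> \<nu>) B = emeasure \<mu> B + emeasure \<nu> B"
proof (rule emeasure_measure_of[OF msum_def])
  show "countably_additive (sets (msum \<mu> \<nu>)) (\<lambda>B. emeasure \<mu> B + emeasure \<nu> B)"
    using assms(1) by (auto simp: countably_additive_def suminf_add[symmetric] suminf_emeasure)
qed (use assms sets.space_closed in \<open>auto simp: positive_def\<close>)

lemma nn_integral_msum:
  assumes \<nu>: "sets \<nu> = sets \<mu>" and f: "f \<in> borel_measurable \<mu>"
  shows "(\<integral>\<^sup>+x. f x \<partial>msum \<mu> \<nu>) = (\<integral>\<^sup>+x. f x \<partial>\<mu>) + (\<integral>\<^sup>+x. f x \<partial>\<nu>)"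
  using f
proof (induction rule: borel_measurable_induct)
  case (cong f g)
  have "space \<nu> = space \<mu>" using \<nu> by (rule sets_eq_imp_space_eq)
  then have "(\<integral>\<^sup>+x. f x \<partial>M) = (\<integral>\<^sup>+x. g x \<partial>M)" if "M \<in> {\<mu>, \<nu>, msum \<mu> \<nu>}" for M
    using cong(3) that by (intro nn_integral_cong) auto
  then show ?case using cong(4) by simp
next
  case (set A)
  then show ?case using \<nu> by (simp add: emeasure_msum)
next
  case (mult u c)
  have "u \<in> borel_measurable \<nu>" "u \<in> borel_measurable (msum \<mu> \<nu>)"
    using mult \<nu> by (simp_all cong: measurable_cong_sets)
  then show ?case using mult by (simp add: nn_integral_cmult distrib_left)
next
  case (add u v)
  have "u \<in> borel_measurable \<nu>" "u \<in> borel_measurable (msum \<mu> \<nu>)"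
    "v \<in> borel_measurable \<nu>" "v \<in> borel_measurable (msum \<mu> \<nu>)"
    using add \<nu> by (simp_all cong: measurable_cong_sets)
  then show ?case using add by (simp add: nn_integral_add ac_simps)
next
  case (seq U)
  have m: "U i \<in> borel_measurable \<nu>" "U i \<in> borel_measurable (msum \<mu> \<nu>)" for i
    using seq \<nu> by (simp_all cong: measurable_cong_sets)
  have eq: "(\<integral>\<^sup>+x. Sup (range U) x \<partial>M) = (SUP i. \<integral>\<^sup>+x. U i x \<partial>M)"
    if "\<And>i. U i \<in> borel_measurable M" for M
    using nn_integral_monotone_convergence_SUP[OF seq(3) that] by (simp add: image_image)
  have "(SUP i. (\<integral>\<^sup>+x. U i x \<partial>\<mu>) + (\<integral>\<^sup>+x. U i x \<partial>\<nu>)) =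
      (SUP i. (\<integral>\<^sup>+x. U i x \<partial>\<mu>)) + (SUP i. (\<integral>\<^sup>+x. U i x \<partial>\<nu>))"
    using seq(3) by (intro ennreal_SUP_add) (auto simp: mono_def le_fun_def intro!: nn_integral_mono)
  moreover have "U i \<in> borel_measurable \<mu>" for i using seq by auto
  ultimately show ?case using seq(4) m by (simp only: eq seq)
qed

lemma finite_borel_msum:
  assumes "finite_borel X \<mu>" "finite_borel X \<nu>"
  shows "finite_borel X (msum \<mu> \<nu>)"
proof -
  have "emeasure (msum \<mu> \<nu>) (space \<mu>) \<noteq> \<infinity>"
    using assms by (subst emeasure_msum) (auto simp: finite_borel_def finite_measure.finite_emeasure_space
        dest: finite_measure.emeasure_finite)
  then show ?thesis
    using assms by (auto simp: finite_borel_def intro!: finite_measureI)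
qed

lemma integral_msum:
  fixes f :: "'a \<Rightarrow> real"
  assumes \<mu>: "finite_borel X \<mu>" and \<nu>: "finite_borel X \<nu>"
    and f: "f \<in> borel_measurable (borel_of X)" "\<And>x. x \<in> mspace X \<Longrightarrow> 0 \<le> f x"
    "\<And>x. x \<in> mspace X \<Longrightarrow> f x \<le> M"
  shows "(\<integral>x. f x \<partial>msum \<mu> \<nu>) = (\<integral>x. f x \<partial>\<mu>) + (\<integral>x. f x \<partial>\<nu>)"
proof -
  have m: "f \<in> borel_measurable \<rho>" if "finite_borel X \<rho>" for \<rho>
    using f(1) finite_borelD[OF that] by (simp cong: measurable_cong_sets)
  have e: "ennreal (\<integral>x. f x \<partial>\<rho>) = (\<integral>\<^sup>+x. f x \<partial>\<rho>)" "0 \<le> (\<integral>x. f x \<partial>\<rho>)" if "finite_borel X \<rho>" for \<rho>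
  proof -
    have "integrable \<rho> f" using f by (intro finite_borel_integrable[OF that m[OF that], of M]) auto
    then show "ennreal (\<integral>x. f x \<partial>\<rho>) = (\<integral>\<^sup>+x. f x \<partial>\<rho>)"
      using f finite_borelD(3)[OF that] by (subst nn_integral_eq_integral) auto
    show "0 \<le> (\<integral>x. f x \<partial>\<rho>)" using f finite_borelD(3)[OF that] by (intro Bochner_Integration.integral_nonneg_AE) auto
  qed
  have "(\<integral>\<^sup>+x. f x \<partial>msum \<mu> \<nu>) = (\<integral>\<^sup>+x. f x \<partial>\<mu>) + (\<integral>\<^sup>+x. f x \<partial>\<nu>)"
    using m[OF \<mu>] finite_borelD(1)[OF \<mu>] finite_borelD(1)[OF \<nu>] by (intro nn_integral_msum) auto
  then have "ennreal (\<integral>x. f x \<partial>msum \<mu> \<nu>) = ennreal ((\<integral>x. f x \<partial>\<mu>) + (\<integral>x. f x \<partial>\<nu>))"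
    using e[OF \<mu>] e[OF \<nu>] e[OF finite_borel_msum[OF \<mu> \<nu>]] by (simp add: ennreal_plus)
  then show ?thesis
    using e[OF \<mu>] e[OF \<nu>] e[OF finite_borel_msum[OF \<mu> \<nu>]] by (subst (asm) ennreal_inj) auto
qed

definition restr :: "'a set \<Rightarrow> 'a measure \<Rightarrow> 'a measure" where
  "restr A \<mu> = density \<mu> (\<lambda>x. ennreal (indicator A x))"

lemma restr:
  assumes \<mu>: "finite_borel X \<mu>" and A: "A \<in> sets (borel_of X)"
  shows "finite_borel X (restr A \<mu>)"
    and "B \<in> sets (borel_of X) \<Longrightarrow> emeasure (restr A \<mu>) B = emeasure \<mu> (A \<inter> B)"
    and "f \<in> borel_measurable (borel_of X) \<Longrightarrow> (\<integral>x. f x \<partial>restr A \<mu>) = (\<integral>x. indicator A x * (f x :: real) \<partial>\<mu>)"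
proof -
  note st = finite_borelD(1)[OF \<mu>]
  interpret finite_measure \<mu> using \<mu> finite_borelD by blast
  show e: "emeasure (restr A \<mu>) B = emeasure \<mu> (A \<inter> B)" if "B \<in> sets (borel_of X)" for B
    using A that st by (simp add: restr_def emeasure_restricted ennreal_indicator)
  have "finite_measure (restr A \<mu>)"
    using e[of "mspace X"] finite_borelD(3)[OF \<mu>] sets.top[of "borel_of X"]
    by (intro finite_measureI) (simp add: restr_def)
  then show "finite_borel X (restr A \<mu>)" using st by (simp add: finite_borel_def restr_def)
  show "(\<integral>x. f x \<partial>restr A \<mu>) = (\<integral>x. indicator A x * f x \<partial>\<mu>)" if "f \<in> borel_measurable (borel_of X)"
    using that A st unfolding restr_def
    by (subst integral_density) (auto cong: measurable_cong_sets)
qed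

lemma tuples_first:
  assumes "(f, \<pi>) \<in> tuples k X" "lip_const X L h" "\<And>x. x \<in> mspace X \<Longrightarrow> \<bar>h x\<bar> \<le> M"
  shows "(\<lambda>x. f x * h x, \<pi>) \<in> tuples k X"
proof -
  obtain K where K: "K > 0" "(f, \<pi>) \<in> bdd_tuples k X K" using tuples_imp_bdd_tuples assms(1) by blast
  then have "lip_const X (K * \<bar>M\<bar> + K * L) (\<lambda>x. f x * h x)"
    using assms by (intro lip_const_mult) (force simp: bdd_tuples_def)+
  moreover have "\<bar>f x * h x\<bar> \<le> K * \<bar>M\<bar>" if "x \<in> mspace X" for x
    using K assms(3)[OF that] that unfolding abs_mult by (intro mult_mono) (auto simp: bdd_tuples_def)
  ultimately show ?thesis
    using assms(1) unfolding tuples_def lipschitz_fun_iff bounded_iff by (auto simp del: abs_mult)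
qed

lemma multilinear_split_first:
  assumes T: "multilinear k X T" and f: "(f, \<pi>) \<in> tuples k X"
    and h: "lip_const X L h" "\<And>x. x \<in> mspace X \<Longrightarrow> 0 \<le> h x \<and> h x \<le> 1"
  shows "(\<lambda>x. f x * h x, \<pi>) \<in> tuples k X" "(\<lambda>x. f x * (1 - h x), \<pi>) \<in> tuples k X"
    "T f \<pi> = T (\<lambda>x. f x * h x) \<pi> + T (\<lambda>x. f x * (1 - h x)) \<pi>"
proof -
  show 1: "(\<lambda>x. f x * h x, \<pi>) \<in> tuples k X"
    using h(2) by (intro tuples_first[OF f h(1), of 1]) (auto simp: abs_le_iff intro: order_trans[of _ 0])
  show 2: "(\<lambda>x. f x * (1 - h x), \<pi>) \<in> tuples k X"
    using h(2) by (intro tuples_first[OF f lip_const_diff[OF lip_const_const h(1)], of 0 _ 1]) auto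
  have "T (\<lambda>x. 1 * (f x * h x) + 1 * (f x * (1 - h x))) \<pi> =
      1 * T (\<lambda>x. f x * h x) \<pi> + 1 * T (\<lambda>x. f x * (1 - h x)) \<pi>"
    using T 1 2 unfolding multilinear_def by blast
  then show "T f \<pi> = T (\<lambda>x. f x * h x) \<pi> + T (\<lambda>x. f x * (1 - h x)) \<pi>"
    by (simp add: algebra_simps)
qed

lemma tuples_prod_Lip_nonneg: "(f, \<pi>) \<in> tuples k X \<Longrightarrow> 0 \<le> (\<Prod>p\<leftarrow>\<pi>. Lip X p)"
  by (intro prod_list_nonneg) (auto simp: tuples_def intro: Lip_nonneg)

lemma mass_bound_finite_borel: "mass_bound k X T \<mu> \<Longrightarrow> finite_borel X \<mu>"
  by (auto simp: mass_bound_def finite_borel_def)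

text \<open>
  Splitting \<open>f = f h + f (1 - h)\<close> with a Lipschitz function \<open>h\<close> close to the indicator of \<open>A\<close>, the two
  bounds can be applied to the two parts. Hence bounding measures can be glued along Borel sets.
\<close>

lemma mass_bound_glue:
  assumes T: "multilinear k X T" and \<mu>: "mass_bound k X T \<mu>" and \<nu>: "mass_bound k X T \<nu>"
    and A: "A \<in> sets (borel_of X)"
  shows "mass_bound k X T (msum (restr A \<mu>) (restr (mspace X - A) \<nu>))"
proof -
  have fin: "finite_borel X \<mu>" "finite_borel X \<nu>" using \<mu> \<nu> mass_bound_finite_borel by auto
  have A': "mspace X - A \<in> sets (borel_of X)" using A sets.compl_sets[of A "borel_of X"] by simp
  note r1 = restr[OF fin(1) A] and r2 = restr[OF fin(2) A']
  have "\<bar>T f \<pi>\<bar> \<le> (\<Prod>p\<leftarrow>\<pi>. Lip X p) * (\<integral>x. \<bar>f x\<bar> \<partial>msum (restr A \<mu>) (restr (mspace X - A) \<nu>))"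
    if f: "(f, \<pi>) \<in> tuples k X" for f \<pi>
  proof -
    define c where "c = (\<Prod>p\<leftarrow>\<pi>. Lip X p)"
    have c: "0 \<le> c" unfolding c_def using f by (rule tuples_prod_Lip_nonneg)
    obtain K where K: "K > 0" "(f, \<pi>) \<in> bdd_tuples k X K" using tuples_imp_bdd_tuples f by blast
    have fK: "lip_const X K f" "\<And>x. x \<in> mspace X \<Longrightarrow> \<bar>f x\<bar> \<le> K" using K by (auto simp: bdd_tuples_def)
    have fm: "(\<lambda>x. \<bar>f x\<bar>) \<in> borel_measurable (borel_of X)"
      using lip_const_measurable[OF fK(1)] by measurable
    have I: "(\<integral>x. \<bar>f x\<bar> \<partial>msum (restr A \<mu>) (restr (mspace X - A) \<nu>)) =
       (\<integral>x. indicator A x * \<bar>f x\<bar> \<partial>\<mu>) + (\<integral>x. indicator (mspace X - A) x * \<bar>f x\<bar> \<partial>\<nu>)"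
      using fK(2) by (simp add: integral_msum[OF r1(1) r2(1) fm, of K] r1(3)[OF fm] r2(3)[OF fm])
    have "\<bar>T f \<pi>\<bar> \<le> c * ((\<integral>x. indicator A x * \<bar>f x\<bar> \<partial>\<mu>) +
        (\<integral>x. indicator (mspace X - A) x * \<bar>f x\<bar> \<partial>\<nu>)) + e" if "e > 0" for e
    proof -
      (* The error of the approximation enters multiplied by c * K, which may be zero. *)
      define \<epsilon> where "\<epsilon> = e / (c * K + 1)"
      have cK: "0 \<le> c * K" using c K by simp
      then have \<epsilon>: "\<epsilon> > 0" "c * K * \<epsilon> \<le> e" using that by (auto simp: \<epsilon>_def divide_simps mult_left_mono mult.commute)
      obtain h L where h: "lip_const X L h" "\<And>x. 0 \<le> h x \<and> h x \<le> 1"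
          "(\<integral>x. \<bar>h x - indicator A x\<bar> \<partial>msum \<mu> \<nu>) < \<epsilon>"
        using Lipschitz_approx_indicator[OF finite_borel_msum[OF fin] A \<epsilon>(1)] by blast
      have hm: "(\<lambda>x. \<bar>h x - indicator A x\<bar>) \<in> borel_measurable (borel_of X)"
        using lip_const_measurable[OF h(1)] A by measurable
      have h1: "\<bar>h x - indicator A x\<bar> \<le> 1" for x using h(2)[of x] by (auto simp: indicator_def)
      have hs: "(\<integral>x. \<bar>h x - indicator A x\<bar> \<partial>\<mu>) + (\<integral>x. \<bar>h x - indicator A x\<bar> \<partial>\<nu>) < \<epsilon>"
        using h(3) h1 by (subst (asm) integral_msum[OF fin hm, of 1]) auto
      note s = multilinear_split_first[OF T f h(1) h(2)]
      have key: "\<bar>T (\<lambda>x. f x * g x) \<pi>\<bar> \<le> c * ((\<integral>x. indicator B x * \<bar>f x\<bar> \<partial>\<rho>) + K * (\<integral>x. \<bar>h x - indicator A x\<bar> \<partial>\<rho>))"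
        if tup: "(\<lambda>x. f x * g x, \<pi>) \<in> tuples k X" and \<rho>: "mass_bound k X T \<rho>"
          and B: "B \<in> sets (borel_of X)" and g: "\<And>x. 0 \<le> g x" "lip_const X L' g"
          "\<And>x. x \<in> mspace X \<Longrightarrow> g x \<le> 1"
          "\<And>x. x \<in> mspace X \<Longrightarrow> g x \<le> indicator B x + \<bar>h x - indicator A x\<bar>" for g B \<rho> L'
      proof -
        have f\<rho>: "finite_borel X \<rho>" using \<rho> mass_bound_finite_borel by blast
        note mc = measurable_cong_sets[OF finite_borelD(1)[OF f\<rho>] refl]
        have i1: "integrable \<rho> (\<lambda>x. indicator B x * \<bar>f x\<bar>)"
          using fm B K(1) fK(2) by (intro finite_borel_integrable[OF f\<rho>, of _ K]) (auto simp: mc indicator_def)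
        have i2: "integrable \<rho> (\<lambda>x. K * \<bar>h x - indicator A x\<bar>)"
          using hm h1 by (intro integrable_mult_right finite_borel_integrable[OF f\<rho>, of _ 1]) (auto simp: mc)
        have "\<bar>T (\<lambda>x. f x * g x) \<pi>\<bar> \<le> c * (\<integral>x. \<bar>f x * g x\<bar> \<partial>\<rho>)"
          using \<rho> tup unfolding mass_bound_def c_def by auto
        also have "\<dots> \<le> c * (\<integral>x. indicator B x * \<bar>f x\<bar> + K * \<bar>h x - indicator A x\<bar> \<partial>\<rho>)"
        proof (intro mult_left_mono[OF _ c] integral_mono)
          show "integrable \<rho> (\<lambda>x. \<bar>f x * g x\<bar>)"
          proof (rule finite_borel_integrable[OF f\<rho>, of _ K])
            show "(\<lambda>x. \<bar>f x * g x\<bar>) \<in> borel_measurable \<rho>"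
              using lip_const_measurable[OF fK(1)] lip_const_measurable[OF g(2)] by (simp add: mc)
            show "\<bar>\<bar>f x * g x\<bar>\<bar> \<le> K" if "x \<in> mspace X" for x
              using mult_mono[of "\<bar>f x\<bar>" K "g x" 1] g(1,3) fK(2) that K(1) by (simp add: abs_mult)
          qed
          show "\<bar>f x * g x\<bar> \<le> indicator B x * \<bar>f x\<bar> + K * \<bar>h x - indicator A x\<bar>" if x: "x \<in> space \<rho>" for x
          proof -
            have x: "x \<in> mspace X" using x finite_borelD(3)[OF f\<rho>] by simp
            have "\<bar>f x * g x\<bar> \<le> \<bar>f x\<bar> * (indicator B x + \<bar>h x - indicator A x\<bar>)"
              using g(1)[of x] g(4)[OF x] by (simp add: abs_mult mult_left_mono)
            also have "\<dots> \<le> indicator B x * \<bar>f x\<bar> + K * \<bar>h x - indicator A x\<bar>"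
              using mult_right_mono[OF fK(2)[OF x] abs_ge_zero, of "h x - indicator A x"]
              by (simp add: distrib_left mult.commute)
            finally show ?thesis .
          qed
        qed (use i1 i2 in auto)
        also have "\<dots> = c * ((\<integral>x. indicator B x * \<bar>f x\<bar> \<partial>\<rho>) + K * (\<integral>x. \<bar>h x - indicator A x\<bar> \<partial>\<rho>))"
          using i1 i2 by simp
        finally show ?thesis .
      qed
      have k1: "\<bar>T (\<lambda>x. f x * h x) \<pi>\<bar> \<le> c * ((\<integral>x. indicator A x * \<bar>f x\<bar> \<partial>\<mu>) + K * (\<integral>x. \<bar>h x - indicator A x\<bar> \<partial>\<mu>))"
        using h(2) by (intro key[OF s(1) \<mu> A _ h(1)]) (auto simp: indicator_def)
      have k2: "\<bar>T (\<lambda>x. f x * (1 - h x)) \<pi>\<bar> \<le> c * ((\<integral>x. indicator (mspace X - A) x * \<bar>f x\<bar> \<partial>\<nu>) + K * (\<integral>x. \<bar>h x - indicator A x\<bar> \<partial>\<nu>))"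
        using h(2) by (intro key[OF s(2) \<nu> A' _ lip_const_diff[OF lip_const_const h(1), of 0 1]]) (auto simp: indicator_def)
      have "c * K * ((\<integral>x. \<bar>h x - indicator A x\<bar> \<partial>\<mu>) + (\<integral>x. \<bar>h x - indicator A x\<bar> \<partial>\<nu>)) \<le> c * K * \<epsilon>"
        using hs cK by (intro mult_left_mono) auto
      then show ?thesis using k1 k2 \<epsilon>(2) s(3) by (simp add: algebra_simps)
    qed
    then have "\<bar>T f \<pi>\<bar> \<le> c * ((\<integral>x. indicator A x * \<bar>f x\<bar> \<partial>\<mu>) +
        (\<integral>x. indicator (mspace X - A) x * \<bar>f x\<bar> \<partial>\<nu>))" by (rule field_le_epsilon)
    then show ?thesis using I by (simp add: c_def)
  qed
  then show ?thesis
    using finite_borel_msum[OF r1(1) r2(1)] by (auto simp: mass_bound_def finite_borel_def)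
qed

text \<open>
  Since bounding measures can be glued, the setwise infimum of all of them is additive: near-optimal
  measures for two disjoint sets are combined into one. It is again a bound because a measure that is
  near-optimal for the whole space integrates every bounded function almost optimally.
\<close>

lemma mass_measure_exists:
  assumes T: "multilinear k X T" and ex: "mass_bound k X T \<mu>0"
  shows "\<exists>\<mu>. mass_bound k X T \<mu> \<and>
     (\<forall>\<nu>. mass_bound k X T \<nu> \<longrightarrow> (\<forall>A\<in>sets (borel_of X). emeasure \<mu> A \<le> emeasure \<nu> A))"
proof -
  let ?M = "{\<mu>. mass_bound k X T \<mu>}"
  let ?B = "sets (borel_of X)"
  define I where "I B = (INF \<mu>\<in>?M. emeasure \<mu> B)" for B
  have ne: "?M \<noteq> {}" using ex by blast
  have le: "I B \<le> emeasure \<mu> B" if "mass_bound k X T \<mu>" for \<mu> B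
    unfolding I_def using that by (intro INF_lower) auto
  have fin: "I B \<noteq> \<infinity>" for B
    using le[OF ex, of B] finite_measure.emeasure_finite[of \<mu>0 B] mass_bound_finite_borel[OF ex]
    by (auto simp: finite_borel_def top_unique)
  have near: "\<exists>\<mu>. mass_bound k X T \<mu> \<and> emeasure \<mu> B < I B + e" if "e > 0" for B and e :: ennreal
  proof -
    have "I B < I B + e" using fin[of B] that ennreal_add_left_cancel_less[of "I B" 0 e] by simp
    then show ?thesis unfolding I_def INF_less_iff by auto
  qed
  interpret S: sigma_algebra "mspace X" ?B
    using sets.sigma_algebra_axioms[of "borel_of X"] by simp
  have add: "I (A \<union> B) = I A + I B" if A: "A \<in> ?B" and B: "B \<in> ?B" and d: "A \<inter> B = {}" for A B
  proof (rule antisym)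
    show "I A + I B \<le> I (A \<union> B)"
      unfolding I_def[of "A \<union> B"]
    proof (rule INF_greatest)
      fix \<mu> assume "\<mu> \<in> ?M"
      then have \<mu>: "mass_bound k X T \<mu>" by simp
      then have "emeasure \<mu> (A \<union> B) = emeasure \<mu> A + emeasure \<mu> B"
        using A B d by (simp add: plus_emeasure mass_bound_def)
      then show "I A + I B \<le> emeasure \<mu> (A \<union> B)" using le[OF \<mu>] by (simp add: add_mono)
    qed
    show "I (A \<union> B) \<le> I A + I B"
    proof (rule ennreal_le_epsilon)
      fix e :: real assume e: "0 < e"
      define d' where "d' = ennreal (e / 2)"
      have d': "d' > 0" "d' + d' = ennreal e" using e by (auto simp: d'_def ennreal_plus[symmetric] simp del: ennreal_plus)
      obtain \<mu> where \<mu>: "mass_bound k X T \<mu>" "emeasure \<mu> A < I A + d'" using near[OF d'(1)] by blast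
      obtain \<nu> where \<nu>: "mass_bound k X T \<nu>" "emeasure \<nu> B < I B + d'" using near[OF d'(1)] by blast
      let ?g = "msum (restr A \<mu>) (restr (mspace X - A) \<nu>)"
      have A': "mspace X - A \<in> ?B" using A by auto
      have g: "mass_bound k X T ?g" by (rule mass_bound_glue[OF T \<mu>(1) \<nu>(1) A])
      note f\<mu> = mass_bound_finite_borel[OF \<mu>(1)] and f\<nu> = mass_bound_finite_borel[OF \<nu>(1)]
      have "A \<inter> (A \<union> B) = A" "(mspace X - A) \<inter> (A \<union> B) = B" using d S.sets_into_space[OF B] by auto
      then have "emeasure ?g (A \<union> B) = emeasure \<mu> A + emeasure \<nu> B"
        using A B restr(1)[OF f\<mu> A] restr(1)[OF f\<nu> A'] restr(2)[OF f\<mu> A, of "A \<union> B"] restr(2)[OF f\<nu> A', of "A \<union> B"]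
        by (subst emeasure_msum) (auto simp: finite_borel_def)
      then have "I (A \<union> B) \<le> emeasure \<mu> A + emeasure \<nu> B" using le[OF g] by metis
      also have "\<dots> \<le> (I A + d') + (I B + d')" using \<mu>(2) \<nu>(2) by (intro add_mono) auto
      also have "\<dots> = I A + I B + ennreal e" using d'(2) by (metis add.assoc add.commute)
      finally show "I (A \<union> B) \<le> I A + I B + ennreal e" .
    qed
  qed
  have pos: "positive ?B I"
    using le[OF ex, of "{}"] by (auto simp: positive_def)
  have ca: "countably_additive ?B I"
  proof (rule S.empty_continuous_imp_countably_additive[OF pos])
    show "additive ?B I" using add by (auto simp: additive_def)
    show "\<forall>A\<in>?B. I A \<noteq> \<infinity>" using fin by blast
    fix A :: "nat \<Rightarrow> 'a set" assume A: "range A \<subseteq> ?B" "decseq A" "(\<Inter>i. A i) = {}"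
    have "(\<lambda>i. emeasure \<mu>0 (A i)) \<longlonglongrightarrow> emeasure \<mu>0 (\<Inter>i. A i)"
      using A mass_bound_finite_borel[OF ex] finite_measure.emeasure_finite[of \<mu>0]
      by (intro Lim_emeasure_decseq) (auto simp: finite_borel_def)
    then have "(\<lambda>i. emeasure \<mu>0 (A i)) \<longlonglongrightarrow> 0" using A(3) by simp
    then show "(\<lambda>i. I (A i)) \<longlonglongrightarrow> 0"
      by (rule tendsto_sandwich[rotated 3]) (use le[OF ex] in auto)
  qed
  define \<mu> where "\<mu> = measure_of (mspace X) ?B I"
  have sets\<mu>: "sets \<mu> = ?B" unfolding \<mu>_def by (rule S.sets_measure_of_eq)
  have em: "emeasure \<mu> A = I A" if "A \<in> ?B" for A
    unfolding \<mu>_def using S.sigma_algebra_axioms pos ca that by (rule emeasure_measure_of_sigma)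
  have sp: "space \<mu> = mspace X" using sets\<mu> sets_eq_imp_space_eq[of \<mu> "borel_of X"] by simp
  have fb: "finite_borel X \<mu>"
    using fin em[of "mspace X"] S.top by (auto simp: finite_borel_def sets\<mu> sp intro!: finite_measureI)
  have "\<bar>T f \<pi>\<bar> \<le> (\<Prod>p\<leftarrow>\<pi>. Lip X p) * (\<integral>x. \<bar>f x\<bar> \<partial>\<mu>)" if f: "(f, \<pi>) \<in> tuples k X" for f \<pi>
  proof -
    define c where "c = (\<Prod>p\<leftarrow>\<pi>. Lip X p)"
    have c: "0 \<le> c" unfolding c_def using f by (rule tuples_prod_Lip_nonneg)
    obtain K where K: "K > 0" "(f, \<pi>) \<in> bdd_tuples k X K" using tuples_imp_bdd_tuples f by blast
    have fK: "lip_const X K f" "\<And>x. x \<in> mspace X \<Longrightarrow> \<bar>f x\<bar> \<le> K" using K by (auto simp: bdd_tuples_def)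
    have "\<bar>T f \<pi>\<bar> \<le> c * (\<integral>x. \<bar>f x\<bar> \<partial>\<mu>) + e" if "e > 0" for e
    proof -
      define d where "d = e / (c * K + 1)"
      have cK: "0 \<le> c * K" using c K by simp
      then have d: "d > 0" "c * (K * d) \<le> e"
        using that by (auto simp: d_def divide_simps mult_left_mono mult.commute mult.assoc)
      (* The measure dominates the infimum and has almost the same total mass, so comparing the
         integrals of K - |f| bounds the excess of the integral of |f| by K * d. *)
      obtain \<nu> where \<nu>: "mass_bound k X T \<nu>" "emeasure \<nu> (mspace X) < I (mspace X) + ennreal d"
        using near[of "ennreal d"] d by auto
      have f\<nu>: "finite_borel X \<nu>" using \<nu> mass_bound_finite_borel by blast
      interpret n: finite_measure \<nu> using f\<nu> by (simp add: finite_borel_def)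
      interpret m: finite_measure \<mu> using fb by (simp add: finite_borel_def)
      have "ennreal (measure \<nu> (mspace X)) < ennreal (measure \<mu> (mspace X) + d)"
        using \<nu>(2) em[OF S.top] d by (simp add: n.emeasure_eq_measure m.emeasure_eq_measure ennreal_plus)
      then have tot: "measure \<nu> (mspace X) \<le> measure \<mu> (mspace X) + d"
        using d by (simp add: ennreal_less_iff del: ennreal_plus)
      have gm: "(\<lambda>x. K - \<bar>f x\<bar>) \<in> borel_measurable \<rho>" "(\<lambda>x. \<bar>f x\<bar>) \<in> borel_measurable \<rho>" if "finite_borel X \<rho>" for \<rho>
        using lip_const_borel_measurable[OF that fK(1)] by auto
      have i: "integrable \<rho> (\<lambda>x. K - \<bar>f x\<bar>)" "integrable \<rho> (\<lambda>x. \<bar>f x\<bar>)" if "finite_borel X \<rho>" for \<rho>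
        using fK(2) K(1) by (auto intro!: finite_borel_integrable[OF that, of _ K] gm[OF that])
      have leM: "\<mu> \<le> \<nu>"
        using le[OF \<nu>(1)] em sets\<mu> finite_borelD(1)[OF f\<nu>]
        by (subst le_measure) auto
      have "(\<integral>\<^sup>+x. ennreal (K - \<bar>f x\<bar>) \<partial>\<mu>) \<le> (\<integral>\<^sup>+x. ennreal (K - \<bar>f x\<bar>) \<partial>\<nu>)"
        using leM sets\<mu> finite_borelD(1)[OF f\<nu>] by (intro nn_integral_mono_measure) auto
      then have "ennreal (\<integral>x. K - \<bar>f x\<bar> \<partial>\<mu>) \<le> ennreal (\<integral>x. K - \<bar>f x\<bar> \<partial>\<nu>)"
        using i[OF fb] i[OF f\<nu>] fK(2) finite_borelD(3)[OF f\<nu>] sp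
        by (subst (asm) (1 2) nn_integral_eq_integral) auto
      moreover have "0 \<le> (\<integral>x. K - \<bar>f x\<bar> \<partial>\<nu>)"
        using fK(2) finite_borelD(3)[OF f\<nu>] by (intro Bochner_Integration.integral_nonneg_AE) auto
      ultimately have "(\<integral>x. K - \<bar>f x\<bar> \<partial>\<mu>) \<le> (\<integral>x. K - \<bar>f x\<bar> \<partial>\<nu>)" by simp
      then have "K * measure \<mu> (mspace X) - (\<integral>x. \<bar>f x\<bar> \<partial>\<mu>) \<le> K * measure \<nu> (mspace X) - (\<integral>x. \<bar>f x\<bar> \<partial>\<nu>)"
        using i[OF fb] i[OF f\<nu>] finite_borelD(3)[OF f\<nu>] sp by (simp add: mult.commute)
      moreover have "K * measure \<nu> (mspace X) \<le> K * measure \<mu> (mspace X) + K * d"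
        using mult_left_mono[OF tot, of K] K(1) by (simp add: distrib_left)
      ultimately have "(\<integral>x. \<bar>f x\<bar> \<partial>\<nu>) \<le> (\<integral>x. \<bar>f x\<bar> \<partial>\<mu>) + K * d" by simp
      then have "c * (\<integral>x. \<bar>f x\<bar> \<partial>\<nu>) \<le> c * ((\<integral>x. \<bar>f x\<bar> \<partial>\<mu>) + K * d)" using c by (rule mult_left_mono)
      moreover have "\<bar>T f \<pi>\<bar> \<le> c * (\<integral>x. \<bar>f x\<bar> \<partial>\<nu>)" using \<nu>(1) f by (auto simp: mass_bound_def c_def)
      ultimately show ?thesis using d(2) by (simp add: distrib_left)
    qed
    then show ?thesis unfolding c_def by (rule field_le_epsilon)
  qed
  then have "mass_bound k X T \<mu>" using fb by (auto simp: mass_bound_def finite_borel_def)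
  then show ?thesis using em le by (intro exI[of _ \<mu>]) auto
qed

text \<open>
  The definite description in the mass measure is justified, because a minimal bounding measure is
  determined by its values on Borel sets.
\<close>

lemma mass_measure:
  assumes "current k X T"
  shows mass_bound_mass_measure: "mass_bound k X T (mass_measure k X T)"
    and mass_measure_minimal: "mass_bound k X T \<nu> \<Longrightarrow> A \<in> sets (borel_of X) \<Longrightarrow>
      emeasure (mass_measure k X T) A \<le> emeasure \<nu> A"
proof -
  let ?P = "\<lambda>\<mu>. mass_bound k X T \<mu> \<and>
     (\<forall>\<nu>. mass_bound k X T \<nu> \<longrightarrow> (\<forall>A\<in>sets (borel_of X). emeasure \<mu> A \<le> emeasure \<nu> A))"
  obtain \<mu> where \<mu>: "?P \<mu>" using mass_measure_exists assms unfolding current_def by metis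
  have "?P (mass_measure k X T)"
    unfolding mass_measure_def
  proof (rule theI[of ?P, OF \<mu>])
    fix \<nu> assume \<nu>: "?P \<nu>"
    show "\<nu> = \<mu>"
    proof (rule measure_eqI)
      show "sets \<nu> = sets \<mu>" using \<mu> \<nu> by (auto simp: mass_bound_def)
      fix A assume "A \<in> sets \<nu>"
      then have "A \<in> sets (borel_of X)" using \<nu> by (auto simp: mass_bound_def)
      then show "emeasure \<nu> A = emeasure \<mu> A" using \<mu> \<nu> by (intro antisym) blast+
    qed
  qed
  then show "mass_bound k X T (mass_measure k X T)"
    "mass_bound k X T \<nu> \<Longrightarrow> A \<in> sets (borel_of X) \<Longrightarrow> emeasure (mass_measure k X T) A \<le> emeasure \<nu> A"
    by blast+
qed

section \<open>Locality and convergence of the values of a current\<close>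

lemma tendsto_if_abs_diff_le:
  fixes l :: real
  assumes "\<And>n. \<bar>a n - l\<bar> \<le> e n" "e \<longlonglongrightarrow> 0"
  shows "a \<longlonglongrightarrow> l"
proof (rule LIM_zero_cancel, rule Lim_null_comparison[OF _ assms(2)])
  show "\<forall>\<^sub>F n in sequentially. norm (a n - l) \<le> e n" using assms(1) by simp
qed

lemma current_bound:
  assumes \<mu>: "mass_bound k X T \<mu>" and f: "(f, \<pi>) \<in> tuples k X" and L: "\<And>p. p \<in> set \<pi> \<Longrightarrow> lip_const X L p"
  shows "\<bar>T f \<pi>\<bar> \<le> L ^ k * (\<integral>x. \<bar>f x\<bar> \<partial>\<mu>)"
proof -
  have "(\<Prod>p\<leftarrow>\<pi>. Lip X p) \<le> L ^ length \<pi>" if "\<forall>p\<in>set \<pi>. lip_const X L p" for \<pi>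
    using that
  proof (induction \<pi>)
    case (Cons p \<pi>)
    then have "lipschitz_fun X q" if "q \<in> set (p # \<pi>)" for q
      using that unfolding lipschitz_fun_iff by blast
    then have "0 \<le> Lip X p" "0 \<le> (\<Prod>p\<leftarrow>\<pi>. Lip X p)"
      by (auto intro!: Lip_nonneg prod_list_nonneg)
    then show ?case using Cons by (auto intro!: mult_mono Lip_le simp: lip_const_nonneg)
  qed simp
  then have "(\<Prod>p\<leftarrow>\<pi>. Lip X p) * (\<integral>x. \<bar>f x\<bar> \<partial>\<mu>) \<le> L ^ k * (\<integral>x. \<bar>f x\<bar> \<partial>\<mu>)"
    using L f by (intro mult_right_mono) (auto simp: tuples_def)
  then show ?thesis using \<mu> f unfolding mass_bound_def by force
qed

lemma current_continuity:
  assumes T: "current k X T" and "(f, \<pi>) \<in> tuples k X" "\<And>j. (f, \<pi>s j) \<in> tuples k X"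
    and "\<And>i x. i < k \<Longrightarrow> x \<in> mspace X \<Longrightarrow> (\<lambda>j. (\<pi>s j ! i) x) \<longlonglongrightarrow> (\<pi> ! i) x"
    and "\<And>j i. i < k \<Longrightarrow> Lip X (\<pi>s j ! i) \<le> L"
  shows "(\<lambda>j. T f (\<pi>s j)) \<longlonglongrightarrow> T f \<pi>"
proof -
  have "continuity_axiom k X T" using T by (simp add: current_def)
  from this[unfolded continuity_axiom_def, rule_format, of f \<pi> \<pi>s L] show ?thesis
    using assms(2-5) by blast
qed

lemma tuples_list_update:
  assumes "(f, \<pi>) \<in> tuples k X" "lip_const X L p"
  shows "(f, \<pi>[i := p]) \<in> tuples k X"
  using assms set_update_subset_insert[of \<pi> i p] by (fastforce simp: tuples_def lipschitz_fun_iff)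

definition clamp_real :: "real \<Rightarrow> real \<Rightarrow> real" where
  "clamp_real \<delta> t = max (- \<delta>) (min \<delta> t)"

lemma abs_clamp_le: "0 \<le> \<delta> \<Longrightarrow> \<bar>clamp_real \<delta> t\<bar> \<le> \<delta>"
  by (auto simp: clamp_real_def)

lemma lip_const_clamp: "lip_const X L f \<Longrightarrow> lip_const X L (\<lambda>x. clamp_real \<delta> (f x))"
  unfolding clamp_real_def by (intro lip_const_max lip_const_min)

lemma lip_const_shrink:
  assumes "lip_const X L f" "0 \<le> \<delta>"
  shows "lip_const X L (\<lambda>x. f x - clamp_real \<delta> (f x))"
  using lip_const_compose[OF assms(1), of "\<lambda>t. t - clamp_real \<delta> t" 1] assms(2)
  by (auto simp: clamp_real_def max_def min_def abs_if)

text \<open>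
  Locality and the mass bound combine: only the region where \<open>\<pi> ! i\<close> differs from zero counts.
  The locality axiom applies after \<open>\<pi> ! i\<close> is replaced by its excess over a small threshold, which
  vanishes on an open neighbourhood of the zero set.
\<close>

lemma current_bound_nonzero:
  assumes T: "current k X T" and \<mu>: "mass_bound k X T \<mu>" and f: "(f, \<pi>) \<in> tuples k X"
    and L: "\<And>p. p \<in> set \<pi> \<Longrightarrow> lip_const X L p" and i: "i < k"
  shows "\<bar>T f \<pi>\<bar> \<le> L ^ k * (\<integral>x. (if (\<pi> ! i) x = 0 then 0 else \<bar>f x\<bar>) \<partial>\<mu>)"
proof -
  define p where "p = \<pi> ! i"
  have len: "length \<pi> = k" using f by (simp add: tuples_def)
  have p: "lip_const X L p" using i len L by (simp add: p_def)
  have L0: "0 \<le> L" using p lip_const_nonneg by blast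
  have f\<mu>: "finite_borel X \<mu>" using \<mu> mass_bound_finite_borel by blast
  obtain K where K: "(f, \<pi>) \<in> bdd_tuples k X K" using tuples_imp_bdd_tuples f by blast
  have fK: "lip_const X K f" "\<And>x. x \<in> mspace X \<Longrightarrow> \<bar>f x\<bar> \<le> K" using K by (auto simp: bdd_tuples_def)
  have fm: "f \<in> borel_measurable \<mu>" "p \<in> borel_measurable \<mu>"
    using lip_const_borel_measurable[OF f\<mu>] fK(1) p by auto
  have sp: "space \<mu> = mspace X" using f\<mu> finite_borelD by blast
  define J where "J = (\<integral>x. (if p x = 0 then 0 else \<bar>f x\<bar>) \<partial>\<mu>)"
  define \<pi>' where "\<pi>' \<delta> = \<pi>[i := \<lambda>x. p x - clamp_real \<delta> (p x)]" for \<delta>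
  have tup': "(f, \<pi>' \<delta>) \<in> tuples k X" and L': "\<And>q. q \<in> set (\<pi>' \<delta>) \<Longrightarrow> lip_const X L q" if "0 \<le> \<delta>" for \<delta>
    using tuples_list_update[OF f lip_const_shrink[OF p that]] lip_const_shrink[OF p that] L
      set_update_subset_insert[of \<pi> i "\<lambda>x. p x - clamp_real \<delta> (p x)"]
    by (auto simp: \<pi>'_def)
  have bound: "\<bar>T f (\<pi>' \<delta>)\<bar> \<le> L ^ k * J" if \<delta>: "\<delta> > 0" for \<delta>
  proof -
    (* Vanishes where p does, and equals 1 where the shrunken entry is not locally constant. *)
    define h where "h x = min 1 (1 / \<delta> * \<bar>p x\<bar>)" for x
    have h: "lip_const X (\<bar>1 / \<delta>\<bar> * L) h"
      unfolding h_def by (intro lip_const_min lip_const_cmult lip_const_abs p)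
    have h01: "0 \<le> h x \<and> h x \<le> 1" for x using \<delta> by (auto simp: h_def)
    note s = multilinear_split_first[OF _ tup' h h01, of T, OF _ less_imp_le[OF \<delta>]]
    have ml: "multilinear k X T" using T by (simp add: current_def)
    define U where "U = {x \<in> mspace X. \<bar>p x\<bar> < \<delta>}"
    have U: "U \<in> sets (borel_of X)"
    proof -
      have "U = (\<lambda>x. \<bar>p x\<bar>) -` {..<\<delta>} \<inter> space (borel_of X)" by (auto simp: U_def)
      then show ?thesis
        using measurable_sets[OF lip_const_measurable[OF lip_const_abs[OF p]], of "{..<\<delta>}"] by simp
    qed
    have "T (\<lambda>x. f x * (1 - h x)) (\<pi>' \<delta>) = 0"
    proof -
      (* Locality expects a cover by one set per entry; all of it is put into the i-th set. *)
      define B where "B j = (if j = i then U else {})" for j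
      have "x \<in> U" if "x \<in> mspace X" "f x * (1 - h x) \<noteq> 0" for x
        using that \<delta> by (auto simp: U_def h_def min_def divide_simps split: if_splits)
      then have 1: "{x \<in> mspace X. f x * (1 - h x) \<noteq> 0} \<subseteq> (\<Union>j<k. B j)"
        using i by (auto simp: B_def)
      have 2: "\<forall>j<k. B j \<in> sets (borel_of X) \<and> (\<exists>c. \<forall>x\<in>B j. (\<pi>' \<delta> ! j) x = c)"
        using U i len by (auto simp: B_def \<pi>'_def U_def clamp_real_def intro!: exI[of _ 0])
      show ?thesis using T s(2)[OF ml] 1 2 unfolding current_def locality_axiom_def by blast
    qed
    then have "\<bar>T f (\<pi>' \<delta>)\<bar> = \<bar>T (\<lambda>x. f x * h x) (\<pi>' \<delta>)\<bar>" using s(3)[OF ml] by simp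
    also have "\<dots> \<le> L ^ k * (\<integral>x. \<bar>f x * h x\<bar> \<partial>\<mu>)"
      using \<delta> by (intro current_bound[OF \<mu> s(1)[OF ml]] L') auto
    also have "(\<integral>x. \<bar>f x * h x\<bar> \<partial>\<mu>) \<le> J"
      unfolding J_def
    proof (rule integral_mono)
      have hm: "h \<in> borel_measurable \<mu>" using lip_const_borel_measurable[OF f\<mu> h] .
      show "integrable \<mu> (\<lambda>x. \<bar>f x * h x\<bar>)"
      proof (rule finite_borel_integrable[OF f\<mu>, of _ K])
        show "\<bar>\<bar>f x * h x\<bar>\<bar> \<le> K" if "x \<in> mspace X" for x
          using mult_mono[of "\<bar>f x\<bar>" K "h x" 1] h01[of x] fK(2)[OF that] by (simp add: abs_mult)
      qed (use fm hm in measurable)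
      show "integrable \<mu> (\<lambda>x. if p x = 0 then 0 else \<bar>f x\<bar>)"
        using fK(2) bdd_tuples_nonneg[OF K] fm
        by (intro finite_borel_integrable[OF f\<mu>, of _ K]) (auto intro!: measurable_If)
      show "\<bar>f x * h x\<bar> \<le> (if p x = 0 then 0 else \<bar>f x\<bar>)" for x
        using mult_left_mono[of "h x" 1 "\<bar>f x\<bar>"] h01[of x] by (auto simp: abs_mult h_def)
    qed
    finally show ?thesis using L0 by (simp add: mult_left_mono)
  qed
  have lim0: "(\<lambda>j. inverse (real (Suc j))) \<longlonglongrightarrow> 0" by (rule LIMSEQ_inverse_real_of_nat)
  have "(\<lambda>j. T f (\<pi>' (inverse (real (Suc j))))) \<longlonglongrightarrow> T f \<pi>"
  proof -
    have "(\<lambda>j. (\<pi>' (inverse (real (Suc j))) ! m) x) \<longlonglongrightarrow> (\<pi> ! m) x" for m x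
    proof (cases "m = i")
      case True
      have "\<bar>(\<pi>' (inverse (real (Suc j))) ! m) x - (\<pi> ! m) x\<bar> \<le> inverse (real (Suc j))" for j
        using True i len abs_clamp_le[of "inverse (real (Suc j))" "p x"] by (simp add: \<pi>'_def p_def)
      then show ?thesis using lim0 by (rule tendsto_if_abs_diff_le)
    qed (simp add: \<pi>'_def)
    moreover have "Lip X (\<pi>' (inverse (real (Suc j))) ! m) \<le> L" if "m < k" for j m
      using that len by (intro Lip_le L'[of "inverse (real (Suc j))"]) (auto simp: \<pi>'_def intro!: nth_mem)
    ultimately show ?thesis
      by (intro current_continuity[OF T f] tup') auto
  qed
  then have "(\<lambda>j. \<bar>T f (\<pi>' (inverse (real (Suc j))))\<bar>) \<longlonglongrightarrow> \<bar>T f \<pi>\<bar>" by (rule tendsto_rabs)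
  then have "\<bar>T f \<pi>\<bar> \<le> L ^ k * J"
    by (rule LIMSEQ_le_const2) (auto intro!: bound)
  then show ?thesis by (simp add: J_def p_def)
qed

text \<open>
  The entries are exchanged one at a time; each exchange changes the value by that of a tuple one of
  whose entries vanishes wherever the two old entries agree.
\<close>

lemma current_diff_bound:
  assumes T: "current k X T" and \<mu>: "mass_bound k X T \<mu>"
    and P: "(f, P) \<in> tuples k X" "\<And>p. p \<in> set P \<Longrightarrow> lip_const X L p"
    and Q: "(f, Q) \<in> tuples k X" "\<And>p. p \<in> set Q \<Longrightarrow> lip_const X L p"
  shows "\<bar>T f P - T f Q\<bar> \<le> (2 * L) ^ k * (\<Sum>j<k. \<integral>x. (if (P ! j) x = (Q ! j) x then 0 else \<bar>f x\<bar>) \<partial>\<mu>)"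
proof -
  let ?J = "\<lambda>j. \<integral>x. (if (P ! j) x = (Q ! j) x then 0 else \<bar>f x\<bar>) \<partial>\<mu>"
  have len: "length P = k" "length Q = k" using P Q by (auto simp: tuples_def)
  have "\<bar>T f (take m P @ drop m Q) - T f Q\<bar> \<le> (2 * L) ^ k * (\<Sum>j<m. ?J j)" if "m \<le> k" for m
    using that
  proof (induction m)
    case (Suc m)
    define R where "R = take m P @ drop m Q"
    have m: "m < k" using Suc by simp
    have lR: "length R = k" using len m by (simp add: R_def)
    have "set R \<subseteq> set P \<union> set Q" unfolding R_def using set_take_subset set_drop_subset by fastforce
    then have LR: "\<And>p. p \<in> set R \<Longrightarrow> lip_const X L p" using P(2) Q(2) by blast
    then have tR: "(f, R) \<in> tuples k X" using P(1) lR by (auto simp: tuples_def lipschitz_fun_iff)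
    have R1: "R[m := P ! m] = take (Suc m) P @ drop (Suc m) Q"
      using m len by (simp add: R_def list_update_append take_Suc_conv_app_nth Cons_nth_drop_Suc[symmetric])
    have R2: "R[m := Q ! m] = R"
      using m len by (metis R_def list_update_id nth_append_length_plus add.right_neutral Cons_nth_drop_Suc
          length_take min.absorb2 nth_append_length less_imp_le)
    have Lm: "lip_const X L (P ! m)" "lip_const X L (Q ! m)" using m len P(2) Q(2) by auto
    define d where "d = (\<lambda>x. 1 * (P ! m) x + (-1) * (Q ! m) x)"
    have d: "lip_const X (2 * L) d" using lip_const_diff[OF Lm] by (simp add: d_def)
    have "T f (R[m := d]) = 1 * T f (R[m := P ! m]) + (-1) * T f (R[m := Q ! m])"
      using T tR m Lm lipschitz_fun_iff unfolding current_def multilinear_def d_def by blast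
    then have e: "T f (take (Suc m) P @ drop (Suc m) Q) - T f R = T f (R[m := d])"
      using R1 R2 by simp
    have L0: "0 \<le> L" using Lm lip_const_nonneg by blast
    have "lip_const X (2 * L) q" if "q \<in> set (R[m := d])" for q
    proof -
      have "q = d \<or> q \<in> set R" using that set_update_subset_insert[of R m d] by blast
      then show ?thesis using d LR lip_const_mono[of X L q "2 * L"] L0 by auto
    qed
    from current_bound_nonzero[OF T \<mu> tuples_list_update[OF tR d, of m] this m]
    have "\<bar>T f (R[m := d])\<bar> \<le> (2 * L) ^ k * ?J m"
      using m lR by (simp add: d_def)
    then show ?case using Suc e unfolding R_def[symmetric] by (simp add: distrib_left)
  qed simp
  from this[of k] show ?thesis using len by simp
qed

text \<open>
  For fixed first entry, the continuity axiom gives a modulus of continuity with respect to uniform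
  convergence that is valid for all tuples with a given Lipschitz bound.
\<close>

lemma current_uniformly_continuous:
  assumes T: "current k X T" and P: "(f, P) \<in> tuples k X" and "\<eta> > 0"
  shows "\<exists>\<epsilon>>0. \<forall>Q. (f, Q) \<in> tuples k X \<and> (\<forall>q\<in>set Q. lip_const X L q) \<and>
     (\<forall>j<k. \<forall>x\<in>mspace X. \<bar>(Q ! j) x - (P ! j) x\<bar> \<le> \<epsilon>) \<longrightarrow> \<bar>T f Q - T f P\<bar> < \<eta>"
proof (rule ccontr)
  assume "\<not> ?thesis"
  then have "\<forall>n. \<exists>Q. (f, Q) \<in> tuples k X \<and> (\<forall>q\<in>set Q. lip_const X L q) \<and>
     (\<forall>j<k. \<forall>x\<in>mspace X. \<bar>(Q ! j) x - (P ! j) x\<bar> \<le> inverse (real (Suc n))) \<and> \<not> \<bar>T f Q - T f P\<bar> < \<eta>"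
    by (metis inverse_positive_iff_positive of_nat_0_less_iff zero_less_Suc)
  then obtain Q where Q: "\<And>n. (f, Q n) \<in> tuples k X" "\<And>n q. q \<in> set (Q n) \<Longrightarrow> lip_const X L q"
     "\<And>n j x. j < k \<Longrightarrow> x \<in> mspace X \<Longrightarrow> \<bar>(Q n ! j) x - (P ! j) x\<bar> \<le> inverse (real (Suc n))"
     "\<And>n. \<not> \<bar>T f (Q n) - T f P\<bar> < \<eta>"
    by metis
  have "(\<lambda>n. (Q n ! j) x) \<longlonglongrightarrow> (P ! j) x" if "j < k" "x \<in> mspace X" for j x
    using Q(3)[OF that] LIMSEQ_inverse_real_of_nat by (rule tendsto_if_abs_diff_le)
  moreover have "Lip X (Q n ! j) \<le> L" if "j < k" for n j
    using that Q(1)[of n] by (intro Lip_le Q(2)[of _ n]) (auto simp: tuples_def)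
  ultimately have "(\<lambda>n. T f (Q n)) \<longlonglongrightarrow> T f P"
    by (intro current_continuity[OF T P Q(1)]) auto
  from tendstoD[OF this \<open>\<eta> > 0\<close>] have "\<forall>\<^sub>F n in sequentially. \<bar>T f (Q n) - T f P\<bar> < \<eta>"
    by (simp add: dist_real_def)
  then show False using Q(4) by (simp add: eventually_False)
qed

text \<open>
  The continuity axiom asks for convergence at every point. With respect to the mass measure,
  convergence almost everywhere suffices: the part of the difference of the functional entries that
  exceeds a small threshold lives on a set of small measure, where locality makes its contribution
  small, and what remains is uniformly small.
\<close>

lemma current_tendsto:
  assumes T: "current k X T" and \<mu>: "mass_bound k X T \<mu>" and N: "N \<in> null_sets \<mu>"
    and fn: "\<And>n. (fn n, Pn n) \<in> bdd_tuples k X K" and f: "(f, P) \<in> bdd_tuples k X K"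
    and limf: "\<And>x. x \<in> mspace X - N \<Longrightarrow> (\<lambda>n. fn n x) \<longlonglongrightarrow> f x"
    and limP: "\<And>x j. x \<in> mspace X - N \<Longrightarrow> j < k \<Longrightarrow> (\<lambda>n. (Pn n ! j) x) \<longlonglongrightarrow> (P ! j) x"
  shows "(\<lambda>n. T (fn n) (Pn n)) \<longlonglongrightarrow> T f P"
proof -
  have f\<mu>: "finite_borel X \<mu>" using \<mu> mass_bound_finite_borel by blast
  interpret finite_measure \<mu> using f\<mu> finite_borelD by blast
  have sp: "space \<mu> = mspace X" using f\<mu> finite_borelD by blast
  have K0: "0 \<le> K" using f bdd_tuples_nonneg by blast
  have AE: "AE x in \<mu>. Q x" if "\<And>x. x \<in> mspace X - N \<Longrightarrow> Q x" for Q
    using N that by (intro AE_I'[OF N]) (auto simp: sp)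
  have ml: "multilinear k X T" using T by (simp add: current_def)
  have fP: "(f, Pn n) \<in> tuples k X" for n
    using fn[of n] f bdd_tuples_imp_tuples[of f "Pn n" k X K] by (auto simp: bdd_tuples_def)
  have fmeas: "fn n \<in> borel_measurable \<mu>" "f \<in> borel_measurable \<mu>" for n
    using fn[of n] f lip_const_borel_measurable[OF f\<mu>] by (auto simp: bdd_tuples_def)
  have fb: "\<bar>fn n x\<bar> \<le> K" "\<bar>f x\<bar> \<le> K" if "x \<in> mspace X" for n x
    using fn[of n] f that by (auto simp: bdd_tuples_def)
  have len: "length (Pn n) = k" "length P = k" for n using fn[of n] f by (auto simp: bdd_tuples_def)
  have lip: "lip_const X K (Pn n ! j)" "lip_const X K (P ! j)" if "j < k" for n j
    using fn[of n] f that by (auto simp: bdd_tuples_def)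
  have "(\<lambda>n. T (fn n) (Pn n) - T f (Pn n)) \<longlonglongrightarrow> 0"
  proof -
    have "(\<lambda>n. \<integral>x. \<bar>fn n x - f x\<bar> \<partial>\<mu>) \<longlonglongrightarrow> (\<integral>x. 0 \<partial>\<mu>)"
    proof (rule integral_dominated_convergence[where w = "\<lambda>_. 2 * K"])
      show "AE x in \<mu>. (\<lambda>n. \<bar>fn n x - f x\<bar>) \<longlonglongrightarrow> 0"
        using limf by (intro AE tendsto_rabs_zero LIM_zero)
      show "AE x in \<mu>. norm \<bar>fn n x - f x\<bar> \<le> 2 * K" for n
      proof (rule AE_I2)
        fix x assume "x \<in> space \<mu>"
        then show "norm \<bar>fn n x - f x\<bar> \<le> 2 * K" using fb(1)[of x n] fb(2)[of x] sp by auto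
      qed
    qed (use fmeas in auto)
    then have lim: "(\<lambda>n. K ^ k * (\<integral>x. \<bar>fn n x - f x\<bar> \<partial>\<mu>)) \<longlonglongrightarrow> 0"
      by (auto intro: tendsto_mult_right_zero)
    have "\<bar>T (fn n) (Pn n) - T f (Pn n)\<bar> \<le> K ^ k * (\<integral>x. \<bar>fn n x - f x\<bar> \<partial>\<mu>)" for n
    proof -
      have lin: "T (\<lambda>x. 1 * fn n x + (-1) * f x) (Pn n) = 1 * T (fn n) (Pn n) + (-1) * T f (Pn n)"
        using ml fP[of n] bdd_tuples_imp_tuples[OF fn[of n]] unfolding multilinear_def by blast
      have "(\<lambda>x. fn n x - f x, Pn n) \<in> bdd_tuples k X (2 * K)"
      proof -
        have "lip_const X (K + K) (\<lambda>x. fn n x - f x)"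
          using fn[of n] f by (intro lip_const_diff) (auto simp: bdd_tuples_def)
        moreover have "\<bar>fn n x - f x\<bar> \<le> 2 * K" if "x \<in> mspace X" for x using fb(1)[OF that, of n] fb(2)[OF that] by auto
        ultimately show ?thesis
          using fn[of n] K0 by (auto simp: bdd_tuples_def intro: lip_const_mono[of X K])
      qed
      from current_bound[where T = T, OF \<mu> bdd_tuples_imp_tuples[OF this]]
      have "\<bar>T (\<lambda>x. fn n x - f x) (Pn n)\<bar> \<le> K ^ k * (\<integral>x. \<bar>fn n x - f x\<bar> \<partial>\<mu>)"
        using fn[of n] by (simp add: bdd_tuples_def)
      then show ?thesis using lin by simp
    qed
    then show ?thesis by (intro tendsto_if_abs_diff_le[OF _ lim]) simp
  qed
  moreover have "(\<lambda>n. T f (Pn n)) \<longlonglongrightarrow> T f P"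
  proof (rule LIMSEQ_I)
    fix r :: real assume r: "0 < r"
    obtain \<epsilon> where \<epsilon>: "\<epsilon> > 0" and uc: "\<And>Q. (f, Q) \<in> tuples k X \<Longrightarrow> (\<And>q. q \<in> set Q \<Longrightarrow> lip_const X (3 * K) q) \<Longrightarrow>
       (\<And>j x. j < k \<Longrightarrow> x \<in> mspace X \<Longrightarrow> \<bar>(Q ! j) x - (P ! j) x\<bar> \<le> \<epsilon>) \<Longrightarrow> \<bar>T f Q - T f P\<bar> < r / 2"
      using current_uniformly_continuous[OF T bdd_tuples_imp_tuples[OF f], of "r/2" "3 * K"] r by auto
    (* Differs from P by at most \<epsilon>, and from Pn n only where Pn n is further than \<epsilon> from P. *)
    define Q where "Q n = map (\<lambda>j x. (P ! j) x + clamp_real \<epsilon> ((Pn n ! j) x - (P ! j) x)) [0..<k]" for n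
    have lQ: "lip_const X (3 * K) q" if q: "q \<in> set (Q n)" for q n
    proof -
      obtain j where j: "j < k" "q = (\<lambda>x. (P ! j) x + clamp_real \<epsilon> ((Pn n ! j) x - (P ! j) x))"
        using q by (auto simp: Q_def)
      have "lip_const X (K + (K + K)) q"
        unfolding j(2) by (intro lip_const_add lip_const_clamp lip_const_diff lip j(1))
      then show ?thesis by simp
    qed
    have tQ: "(f, Q n) \<in> tuples k X" for n
      using lQ fP[of n] by (auto simp: tuples_def lipschitz_fun_iff Q_def)
    have c1: "\<bar>T f (Q n) - T f P\<bar> < r / 2" for n
      using \<epsilon> by (intro uc tQ lQ) (auto simp: Q_def clamp_real_def)
    define err where "err n = (2 * (3 * K)) ^ k * (\<Sum>j<k. \<integral>x. (if (Pn n ! j) x = (Q n ! j) x then 0 else \<bar>f x\<bar>) \<partial>\<mu>)" for n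
    have "(\<lambda>n. (2 * (3 * K)) ^ k * (\<Sum>j<k. \<integral>x. (if (Pn n ! j) x = (Q n ! j) x then 0 else \<bar>f x\<bar>) \<partial>\<mu>)) \<longlonglongrightarrow>
        (2 * (3 * K)) ^ k * (\<Sum>j<k. \<integral>x. 0 \<partial>\<mu>)"
    proof (intro tendsto_mult tendsto_const tendsto_sum)
      fix j assume "j \<in> {..<k}"
      then have j: "j < k" by simp
      have Qj: "Q n ! j = (\<lambda>x. (P ! j) x + clamp_real \<epsilon> ((Pn n ! j) x - (P ! j) x))" for n
        using j by (simp add: Q_def)
      have m: "Pn n ! j \<in> borel_measurable \<mu>" "Q n ! j \<in> borel_measurable \<mu>" for n
        using lip_const_borel_measurable[OF f\<mu>] lip[OF j] lQ[of "Q n ! j" n] j by (auto simp: Q_def)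
      show "(\<lambda>n. \<integral>x. (if (Pn n ! j) x = (Q n ! j) x then 0 else \<bar>f x\<bar>) \<partial>\<mu>) \<longlonglongrightarrow> (\<integral>x. 0 \<partial>\<mu>)"
      proof (rule integral_dominated_convergence[where w = "\<lambda>_. K"])
        show "AE x in \<mu>. (\<lambda>n. if (Pn n ! j) x = (Q n ! j) x then 0 else \<bar>f x\<bar>) \<longlonglongrightarrow> 0"
        proof (rule AE)
          fix x assume x: "x \<in> mspace X - N"
          have "\<forall>\<^sub>F n in sequentially. \<bar>(Pn n ! j) x - (P ! j) x\<bar> < \<epsilon>"
            using tendstoD[OF limP[OF x j] \<epsilon>] by (simp add: dist_real_def)
          then have "\<forall>\<^sub>F n in sequentially. (if (Pn n ! j) x = (Q n ! j) x then 0 else \<bar>f x\<bar>) = 0"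
            by eventually_elim (auto simp: Qj clamp_real_def)
          then show "(\<lambda>n. if (Pn n ! j) x = (Q n ! j) x then 0 else \<bar>f x\<bar>) \<longlonglongrightarrow> 0"
            by (rule tendsto_eventually)
        qed
        show "AE x in \<mu>. norm (if (Pn n ! j) x = (Q n ! j) x then 0 else \<bar>f x\<bar>) \<le> K" for n
          using fb(2) K0 by (intro AE_I2) (auto simp: sp)
        show "(\<lambda>x. if (Pn n ! j) x = (Q n ! j) x then 0 else \<bar>f x\<bar>) \<in> borel_measurable \<mu>" for n
          using m fmeas(2) by (intro measurable_If) auto
      qed auto
    qed
    then have "err \<longlonglongrightarrow> 0" by (simp add: err_def[abs_def])
    then have "\<forall>\<^sub>F n in sequentially. err n < r / 2"
      using r by (intro order_tendstoD(2)) auto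
    then obtain M where M: "\<And>n. n \<ge> M \<Longrightarrow> err n < r / 2"
      unfolding eventually_sequentially by blast
    have c2: "\<bar>T f (Pn n) - T f (Q n)\<bar> < r / 2" if "n \<ge> M" for n
    proof -
      have "lip_const X (3 * K) p" if p: "p \<in> set (Pn n)" for p
      proof (rule lip_const_mono[of X K])
        show "lip_const X K p" using fn[of n] p by (simp add: bdd_tuples_def)
      qed (use K0 in simp)
      then have "\<bar>T f (Pn n) - T f (Q n)\<bar> \<le> err n"
        unfolding err_def by (intro current_diff_bound[OF T \<mu> fP _ tQ lQ]) auto
      then show ?thesis using M[OF \<open>n \<ge> M\<close>] by linarith
    qed
    have "norm (T f (Pn n) - T f P) < r" if "n \<ge> M" for n
      using c1[of n] c2[OF that] unfolding real_norm_def by linarith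
    then show "\<exists>M. \<forall>n\<ge>M. norm (T f (Pn n) - T f P) < r" by blast
  qed
  ultimately show ?thesis using tendsto_add by fastforce
qed

lemma current_cong_AE:
  assumes "current k X T" "mass_bound k X T \<mu>" "N \<in> null_sets \<mu>"
    and P: "(f, P) \<in> tuples k X" and Q: "(g, Q) \<in> tuples k X"
    and eq: "\<And>x. x \<in> mspace X - N \<Longrightarrow> f x = g x" "\<And>x j. x \<in> mspace X - N \<Longrightarrow> j < k \<Longrightarrow> (P ! j) x = (Q ! j) x"
  shows "T f P = T g Q"
proof -
  obtain K K' where K: "(f, P) \<in> bdd_tuples k X K" "(g, Q) \<in> bdd_tuples k X K'"
    using P Q tuples_imp_bdd_tuples by metis
  have "(\<lambda>_::nat. T f P) \<longlonglongrightarrow> T g Q"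
    using bdd_tuples_mono[OF K(1), of "max K K'"] bdd_tuples_mono[OF K(2), of "max K K'"] eq
    by (intro current_tendsto[OF assms(1-3), where K = "max K K'"]) auto
  then show ?thesis by (simp add: LIMSEQ_const_iff)
qed

section \<open>The support in terms of values\<close>

lemma cutoff_function:
  assumes a: "a \<in> mspace X" and r: "r > 0"
  shows "\<exists>h. lip_const X (1 / r) h \<and> (\<forall>x. 0 \<le> h x \<and> h x \<le> 1) \<and> (\<forall>x. mdist X a x \<le> r \<longrightarrow> h x = 1) \<and>
    (\<forall>x. 2 * r \<le> mdist X a x \<longrightarrow> h x = 0)"
proof -
  define h where "h x = max 0 (min 1 (2 - 1 / r * mdist X a x))" for x
  have "lip_const X (0 + \<bar>1 / r\<bar> * 1) (\<lambda>x. 2 - 1 / r * mdist X a x)"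
    by (intro lip_const_diff lip_const_const lip_const_cmult lip_const_mdist a) simp
  then have "lip_const X (1 / r) h" unfolding h_def using r by (intro lip_const_max lip_const_min) simp
  then show ?thesis using r by (intro exI[of _ h]) (auto simp: h_def divide_simps)
qed

text \<open>
  If a current annihilates all tuples supported in a ball, removing the concentric ball of half the
  radius from its mass measure leaves a bounding measure; by minimality the smaller ball is a null set.
\<close>

lemma spt_nonvanishing:
  assumes T: "current k X T" and a: "a \<in> spt k X T" and r: "r > 0"
  shows "\<exists>f \<pi>. (f, \<pi>) \<in> tuples k X \<and> (\<forall>x\<in>mspace X. r \<le> mdist X a x \<longrightarrow> f x = 0) \<and> T f \<pi> \<noteq> 0"
proof (rule ccontr)
  assume contra: "\<not> ?thesis"
  define \<mu> where "\<mu> = mass_measure k X T"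
  have \<mu>: "mass_bound k X T \<mu>" using T mass_bound_mass_measure unfolding \<mu>_def by blast
  have f\<mu>: "finite_borel X \<mu>" using \<mu> mass_bound_finite_borel by blast
  have aX: "a \<in> mspace X" using a by (simp add: spt_def)
  define B where "B = mball_of X a (r/2)"
  have B: "B \<in> sets (borel_of X)" "mspace X - B \<in> sets (borel_of X)"
    using mball_of_borel[of X a "r/2"] sets.compl_sets[of B "borel_of X"] by (simp_all add: B_def)
  obtain h where h: "lip_const X (1 / (r/2)) h" "\<And>x. 0 \<le> h x \<and> h x \<le> 1" "\<And>x. mdist X a x \<le> r/2 \<Longrightarrow> h x = 1"
      "\<And>x. r \<le> mdist X a x \<Longrightarrow> h x = 0"
    using cutoff_function[OF aX, of "r/2"] r by auto
  have ml: "multilinear k X T" using T by (simp add: current_def)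
  have "\<bar>T f \<pi>\<bar> \<le> (\<Prod>p\<leftarrow>\<pi>. Lip X p) * (\<integral>x. \<bar>f x\<bar> \<partial>restr (mspace X - B) \<mu>)" if f: "(f, \<pi>) \<in> tuples k X" for f \<pi>
  proof -
    obtain K where K: "(f, \<pi>) \<in> bdd_tuples k X K" using tuples_imp_bdd_tuples f by blast
    have fK: "lip_const X K f" "\<And>x. x \<in> mspace X \<Longrightarrow> \<bar>f x\<bar> \<le> K" using K by (auto simp: bdd_tuples_def)
    have fm: "f \<in> borel_measurable (borel_of X)" "f \<in> borel_measurable \<mu>" "h \<in> borel_measurable \<mu>"
      using lip_const_measurable[OF fK(1)] lip_const_borel_measurable[OF f\<mu>] fK(1) h(1) by auto
    note s = multilinear_split_first[OF ml f h(1) h(2)]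
    have "T (\<lambda>x. f x * h x) \<pi> = 0" using contra s(1) h(4) by force
    then have "\<bar>T f \<pi>\<bar> = \<bar>T (\<lambda>x. f x * (1 - h x)) \<pi>\<bar>" using s(3) by simp
    also have "\<dots> \<le> (\<Prod>p\<leftarrow>\<pi>. Lip X p) * (\<integral>x. \<bar>f x * (1 - h x)\<bar> \<partial>\<mu>)"
      using \<mu> s(2) unfolding mass_bound_def by auto
    also have "(\<integral>x. \<bar>f x * (1 - h x)\<bar> \<partial>\<mu>) \<le> (\<integral>x. indicator (mspace X - B) x * \<bar>f x\<bar> \<partial>\<mu>)"
    proof (rule integral_mono)
      have K0: "0 \<le> K" using bdd_tuples_nonneg[OF K] .
      show "integrable \<mu> (\<lambda>x. \<bar>f x * (1 - h x)\<bar>)"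
      proof (rule finite_borel_integrable[OF f\<mu>, of _ K])
        show "\<bar>\<bar>f x * (1 - h x)\<bar>\<bar> \<le> K" if "x \<in> mspace X" for x
          using mult_mono[of "\<bar>f x\<bar>" K "1 - h x" 1] h(2)[of x] fK(2)[OF that] by (simp add: abs_mult)
      qed (use fm in measurable)
      show "integrable \<mu> (\<lambda>x. indicator (mspace X - B) x * \<bar>f x\<bar>)"
        using fm B(2) finite_borelD(1)[OF f\<mu>] K0 fK(2)
        by (intro finite_borel_integrable[OF f\<mu>, of _ K] borel_measurable_times
            borel_measurable_indicator borel_measurable_abs) (auto simp: indicator_def)
      show "\<bar>f x * (1 - h x)\<bar> \<le> indicator (mspace X - B) x * \<bar>f x\<bar>" if "x \<in> space \<mu>" for x
      proof (cases "x \<in> B")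
        case True
        then show ?thesis using h(3)[of x] by (simp add: B_def)
      next
        case False
        then show ?thesis
          using that finite_borelD(3)[OF f\<mu>] h(2)[of x] mult_left_mono[of "1 - h x" 1 "\<bar>f x\<bar>"]
          by (simp add: abs_mult)
      qed
    qed
    also have "\<dots> = (\<integral>x. \<bar>f x\<bar> \<partial>restr (mspace X - B) \<mu>)"
      using restr(3)[OF f\<mu> B(2), of "\<lambda>x. \<bar>f x\<bar>"] fm(1) by simp
    finally show ?thesis using tuples_prod_Lip_nonneg[OF f] by (simp add: mult_left_mono)
  qed
  then have "mass_bound k X T (restr (mspace X - B) \<mu>)"
    using restr(1)[OF f\<mu> B(2)] by (auto simp: mass_bound_def finite_borel_def)
  then have "emeasure \<mu> B \<le> emeasure (restr (mspace X - B) \<mu>) B"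
    unfolding \<mu>_def using mass_measure_minimal[OF T _ B(1)] by blast
  also have "\<dots> = 0" using restr(2)[OF f\<mu> B(2) B(1)] Diff_disjoint[of B "mspace X"] by (simp add: Int_commute)
  finally have "emeasure \<mu> B = 0" by simp
  moreover have "emeasure \<mu> B > 0" using a r by (simp add: spt_def B_def \<mu>_def)
  ultimately show False by simp
qed

lemma in_spt_if_nonvanishing:
  assumes T: "current k X T" and a: "a \<in> mspace X"
    and nv: "\<And>r. r > 0 \<Longrightarrow> \<exists>f \<pi>. (f, \<pi>) \<in> tuples k X \<and>
      (\<forall>x\<in>mspace X. r \<le> mdist X a x \<longrightarrow> f x = 0) \<and> T f \<pi> \<noteq> 0"
  shows "a \<in> spt k X T"
proof -
  let ?\<mu> = "mass_measure k X T"
  have \<mu>: "mass_bound k X T ?\<mu>" using T mass_bound_mass_measure by blast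
  have f\<mu>: "finite_borel X ?\<mu>" using \<mu> mass_bound_finite_borel by blast
  have "emeasure ?\<mu> (mball_of X a r) > 0" if r: "r > 0" for r
  proof (rule ccontr)
    assume "\<not> ?thesis"
    then have N: "mball_of X a r \<in> null_sets ?\<mu>"
      using mball_of_borel[of X a r] finite_borelD(1)[OF f\<mu>] by (simp add: null_sets_def)
    obtain f \<pi> where f: "(f, \<pi>) \<in> tuples k X" "\<forall>x\<in>mspace X. r \<le> mdist X a x \<longrightarrow> f x = 0" "T f \<pi> \<noteq> 0"
      using nv[OF r] by blast
    have "AE x in ?\<mu>. \<bar>f x\<bar> = 0"
      using f(2) finite_borelD(3)[OF f\<mu>] a by (intro AE_I'[OF N]) force
    then have "(\<integral>x. \<bar>f x\<bar> \<partial>?\<mu>) = 0" by (rule integral_eq_zero_AE)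
    moreover have "\<bar>T f \<pi>\<bar> \<le> (\<Prod>p\<leftarrow>\<pi>. Lip X p) * (\<integral>x. \<bar>f x\<bar> \<partial>?\<mu>)"
      using \<mu> f(1) unfolding mass_bound_def by blast
    ultimately show False using f(3) by simp
  qed
  then show ?thesis using a by (simp add: spt_def)
qed

section \<open>Separability of the support\<close>

text \<open>
  Separability of a subset is expressed by colourings with countably many colours whose classes have
  small diameter. In this form it passes to subsets, countable unions and Lipschitz images without
  choosing dense sequences.
\<close>

definition separable_subset :: "'a metric \<Rightarrow> 'a set \<Rightarrow> bool" where
  "separable_subset X A \<longleftrightarrow>
     (\<forall>\<epsilon>>0. \<exists>c :: 'a \<Rightarrow> nat. \<forall>x\<in>A. \<forall>y\<in>A. c x = c y \<longrightarrow> mdist X x y \<le> \<epsilon>)"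

lemma separable_subsetE:
  assumes "separable_subset X A" "\<epsilon> > 0"
  obtains c :: "'a \<Rightarrow> nat" where "\<And>x y. x \<in> A \<Longrightarrow> y \<in> A \<Longrightarrow> c x = c y \<Longrightarrow> mdist X x y \<le> \<epsilon>"
  using assms unfolding separable_subset_def by metis

lemma separable_subset_mono: "separable_subset X A \<Longrightarrow> B \<subseteq> A \<Longrightarrow> separable_subset X B"
  unfolding separable_subset_def by (meson subsetD)

lemma separable_subset_UN:
  assumes "\<And>i::nat. separable_subset X (A i)"
  shows "separable_subset X (\<Union>i. A i)"
  unfolding separable_subset_def
proof (intro allI impI)
  fix \<epsilon> :: real assume "\<epsilon> > 0"
  then have "\<forall>i. \<exists>c :: 'a \<Rightarrow> nat. \<forall>x\<in>A i. \<forall>y\<in>A i. c x = c y \<longrightarrow> mdist X x y \<le> \<epsilon>"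
    using assms unfolding separable_subset_def by blast
  then obtain c :: "nat \<Rightarrow> 'a \<Rightarrow> nat"
    where c: "\<And>i x y. x \<in> A i \<Longrightarrow> y \<in> A i \<Longrightarrow> c i x = c i y \<Longrightarrow> mdist X x y \<le> \<epsilon>"
    by metis
  define i where "i x = (LEAST i. x \<in> A i)" for x
  have i: "x \<in> A (i x)" if "x \<in> (\<Union>i. A i)" for x
    using that unfolding i_def by (auto intro: LeastI)
  show "\<exists>c :: 'a \<Rightarrow> nat. \<forall>x\<in>\<Union>i. A i. \<forall>y\<in>\<Union>i. A i. c x = c y \<longrightarrow> mdist X x y \<le> \<epsilon>"
  proof (intro exI[of _ "\<lambda>x. prod_encode (i x, c (i x) x)"] ballI impI)
    fix x y assume xy: "x \<in> (\<Union>i. A i)" "y \<in> (\<Union>i. A i)"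
      and "prod_encode (i x, c (i x) x) = prod_encode (i y, c (i y) y)"
    then have "i x = i y" "c (i x) x = c (i y) y" by (auto dest: injD[OF inj_prod_encode])
    then show "mdist X x y \<le> \<epsilon>" using c[of x "i x" y] i[OF xy(1)] i[OF xy(2)] by simp
  qed
qed

lemma separable_subset_Lipschitz_image:
  assumes B: "separable_subset X B" and g: "Lipschitz_continuous_map (submetric X B) Y g" and "B \<subseteq> mspace X"
  shows "separable_subset Y (g ` B)"
  unfolding separable_subset_def
proof (intro allI impI)
  fix \<epsilon> :: real assume \<epsilon>: "\<epsilon> > 0"
  obtain L where L: "L > 0" "\<And>x y. x \<in> B \<Longrightarrow> y \<in> B \<Longrightarrow> mdist Y (g x) (g y) \<le> L * mdist X x y"
    using g assms(3) unfolding Lipschitz_continuous_map_pos by (auto simp: Int_absorb2)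
  then obtain c :: "'a \<Rightarrow> nat" where c: "\<And>x y. x \<in> B \<Longrightarrow> y \<in> B \<Longrightarrow> c x = c y \<Longrightarrow> mdist X x y \<le> \<epsilon> / L"
    using separable_subsetE[OF B, of "\<epsilon> / L"] \<epsilon> by (metis divide_pos_pos)
  define h where "h = inv_into B g"
  have h: "h z \<in> B" "g (h z) = z" if "z \<in> g ` B" for z
    using that by (auto simp: h_def inv_into_into f_inv_into_f)
  show "\<exists>c :: 'b \<Rightarrow> nat. \<forall>x\<in>g ` B. \<forall>y\<in>g ` B. c x = c y \<longrightarrow> mdist Y x y \<le> \<epsilon>"
  proof (intro exI[of _ "\<lambda>z. c (h z)"] ballI impI)
    fix x y assume xy: "x \<in> g ` B" "y \<in> g ` B" and e: "c (h x) = c (h y)"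
    have "mdist Y x y \<le> L * mdist X (h x) (h y)" using L(2)[of "h x" "h y"] h[OF xy(1)] h[OF xy(2)] by simp
    also have "\<dots> \<le> L * (\<epsilon> / L)" using c[OF _ _ e] h[OF xy(1)] h[OF xy(2)] L(1) by (intro mult_left_mono) auto
    finally show "mdist Y x y \<le> \<epsilon>" using L(1) by simp
  qed
qed

lemma separable_euclidean_space: "separable_subset (euclidean_space_metric k) A"
  unfolding separable_subset_def
proof (intro allI impI)
  fix \<epsilon> :: real assume \<epsilon>: "\<epsilon> > 0"
  define m where "m = (real k + 1) / \<epsilon>"
  have m: "m > 0" "real k / m \<le> \<epsilon>" using \<epsilon> by (auto simp: m_def divide_simps mult_left_mono)
  show "\<exists>c :: (nat \<Rightarrow> real) \<Rightarrow> nat. \<forall>x\<in>A. \<forall>y\<in>A. c x = c y \<longrightarrow> mdist (euclidean_space_metric k) x y \<le> \<epsilon>"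
  proof (intro exI[of _ "\<lambda>x. to_nat (map (\<lambda>i. \<lfloor>x i * m\<rfloor>) [0..<k])"] ballI impI)
    fix x y :: "nat \<Rightarrow> real"
    assume "to_nat (map (\<lambda>i. \<lfloor>x i * m\<rfloor>) [0..<k]) = to_nat (map (\<lambda>i. \<lfloor>y i * m\<rfloor>) [0..<k])"
    then have "map (\<lambda>i. \<lfloor>x i * m\<rfloor>) [0..<k] = map (\<lambda>i. \<lfloor>y i * m\<rfloor>) [0..<k]" by (rule injD[OF inj_to_nat])
    then have fl: "\<lfloor>x i * m\<rfloor> = \<lfloor>y i * m\<rfloor>" if "i < k" for i using that by (simp add: map_eq_conv)
    have "\<bar>x i - y i\<bar> \<le> 1 / m" if "i < k" for i
    proof -
      have "\<bar>x i * m - y i * m\<bar> < 1" using fl[OF that] by linarith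
      then have "\<bar>x i - y i\<bar> * m < 1" using m(1) by (simp add: abs_mult left_diff_distrib[symmetric])
      then show ?thesis using m(1) by (simp add: divide_simps)
    qed
    then have "(\<Sum>i<k. \<bar>x i - y i\<bar>) \<le> (\<Sum>i<k. 1 / m)" by (intro sum_mono) auto
    moreover have "sqrt (\<Sum>i<k. (x i - y i)\<^sup>2) \<le> (\<Sum>i<k. \<bar>x i - y i\<bar>)"
      using L2_set_le_sum_abs[of "\<lambda>i. x i - y i" "{..<k}"] by (simp add: L2_set_def)
    ultimately show "mdist (euclidean_space_metric k) x y \<le> \<epsilon>" using m(2) by simp
  qed
qed

text \<open>
  A set of measure zero has, for every \<open>\<delta>\<close>, at least one countable cover by sets of diameter at most
  \<open>\<delta>\<close>, since an infimum over no covers would be infinite.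
\<close>

lemma separable_if_hausdorff_zero:
  assumes "hausdorff k X A = 0"
  shows "separable_subset X A"
  unfolding separable_subset_def
proof (intro allI impI)
  fix \<epsilon> :: real assume \<epsilon>: "\<epsilon> > 0"
  have "hausdorff_pre k X (ennreal \<epsilon>) A \<le> hausdorff k X A"
    unfolding hausdorff_def using \<epsilon> by (intro SUP_upper) auto
  then have "hausdorff_pre k X (ennreal \<epsilon>) A < top" using assms by (simp add: top.not_eq_extremum)
  then obtain E :: "nat \<Rightarrow> 'a set"
    where E: "\<And>i. mdiam X (E i) \<le> ennreal \<epsilon>" "A \<subseteq> (\<Union>i. E i)"
    unfolding hausdorff_pre_def INF_less_iff by auto
  define i where "i x = (LEAST i. x \<in> E i)" for x
  have i: "x \<in> E (i x)" if "x \<in> A" for x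
    using E(2) that unfolding i_def by (auto intro: LeastI)
  show "\<exists>c :: 'a \<Rightarrow> nat. \<forall>x\<in>A. \<forall>y\<in>A. c x = c y \<longrightarrow> mdist X x y \<le> \<epsilon>"
  proof (intro exI[of _ i] ballI impI)
    fix x y assume xy: "x \<in> A" "y \<in> A" "i x = i y"
    have "ennreal (mdist X x y) \<le> mdiam X (E (i x))"
      unfolding mdiam_def using i[OF xy(1)] i[OF xy(2)] xy(3) by (intro SUP_upper2[of x] SUP_upper2[of y]) auto
    then have "ennreal (mdist X x y) \<le> ennreal \<epsilon>" using E(1) order_trans by blast
    then show "mdist X x y \<le> \<epsilon>" using \<epsilon> by (simp add: ennreal_le_iff)
  qed
qed

lemma countably_rectifiable_separable:
  assumes "countably_rectifiable k X S"
  shows "separable_subset X S"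
proof -
  obtain B :: "nat \<Rightarrow> (nat \<Rightarrow> real) set" and g
    where B: "\<And>i. B i \<subseteq> mspace (euclidean_space_metric k)"
      "\<And>i. Lipschitz_continuous_map (submetric (euclidean_space_metric k) (B i)) X (g i)"
      and h: "hausdorff k X (S - (\<Union>i. g i ` B i)) = 0"
    using assms unfolding countably_rectifiable_def by blast
  define A where "A i = (case i of 0 \<Rightarrow> S - (\<Union>i. g i ` B i) | Suc j \<Rightarrow> g j ` B j)" for i
  have "separable_subset X (A i)" for i
    using separable_if_hausdorff_zero[OF h]
      separable_subset_Lipschitz_image[OF separable_euclidean_space B(2) B(1)]
    by (auto simp: A_def split: nat.split)
  then have "separable_subset X (\<Union>i. A i)" by (rule separable_subset_UN)
  moreover have "S \<subseteq> (\<Union>i. A i)"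
  proof
    fix x assume x: "x \<in> S"
    show "x \<in> (\<Union>i. A i)"
    proof (cases "\<exists>j. x \<in> g j ` B j")
      case True
      then obtain j where "x \<in> A (Suc j)" by (auto simp: A_def)
      then show ?thesis by blast
    next
      case False
      then have "x \<in> A 0" using x by (auto simp: A_def)
      then show ?thesis by blast
    qed
  qed
  ultimately show ?thesis by (rule separable_subset_mono)
qed

lemma separable_subset_dense:
  assumes "separable_subset X A"
  shows "\<exists>D. countable D \<and> D \<subseteq> A \<and> (\<forall>x\<in>A. \<forall>\<epsilon>>0. \<exists>d\<in>D. mdist X d x < \<epsilon>)"
proof -
  have "\<forall>n. \<exists>c :: 'a \<Rightarrow> nat. \<forall>x\<in>A. \<forall>y\<in>A. c x = c y \<longrightarrow> mdist X x y \<le> inverse (real (Suc n))"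
    using assms unfolding separable_subset_def by simp
  then obtain c :: "nat \<Rightarrow> 'a \<Rightarrow> nat"
    where c: "\<And>n x y. x \<in> A \<Longrightarrow> y \<in> A \<Longrightarrow> c n x = c n y \<Longrightarrow> mdist X x y \<le> inverse (real (Suc n))"
    by metis
  define p where "p n i = (SOME x. x \<in> A \<and> c n x = i)" for n i
  define D where "D = (\<lambda>(n, i). p n i) ` {(n, i). \<exists>x\<in>A. c n x = i}"
  have p: "p n (c n x) \<in> A" "c n (p n (c n x)) = c n x" if "x \<in> A" for n x
    using someI[of "\<lambda>y. y \<in> A \<and> c n y = c n x" x] that by (auto simp: p_def)
  have "countable D" unfolding D_def by (intro countable_image countableI_type)
  moreover have "D \<subseteq> A" using p by (auto simp: D_def)
  moreover have "\<exists>d\<in>D. mdist X d x < \<epsilon>" if x: "x \<in> A" and "\<epsilon> > 0" for x \<epsilon>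
  proof -
    obtain n where n: "inverse (real (Suc n)) < \<epsilon>" using reals_Archimedean[OF \<open>\<epsilon> > 0\<close>] by blast
    have "p n (c n x) \<in> D" using x by (auto simp: D_def)
    moreover have "mdist X (p n (c n x)) x < \<epsilon>"
      using c[OF p(1)[OF x] x p(2)[OF x]] n by (rule le_less_trans)
    ultimately show ?thesis by blast
  qed
  ultimately show ?thesis by blast
qed

text \<open>
  In general the complement of the support is a union of possibly uncountably many null balls. Here
  the measure is concentrated on a separable set, whose points outside the support are covered by
  countably many null balls.
\<close>

lemma integer_rectifiable_spt:
  assumes T: "integer_rectifiable k X T" and k: "k \<ge> 1"
  shows "\<exists>N\<in>null_sets (mass_measure k X T). mspace X - spt k X T \<subseteq> N"
    and "separable_subset X (spt k X T)"
proof -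
  define \<mu> where "\<mu> = mass_measure k X T"
  have "current k X T" using T by (simp add: integer_rectifiable_def)
  then have f\<mu>: "finite_borel X \<mu>"
    unfolding \<mu>_def using mass_bound_mass_measure mass_bound_finite_borel by blast
  have ballm: "mball_of X x r \<in> sets \<mu>" for x r
    unfolding finite_borelD(1)[OF f\<mu>] by (rule mball_of_borel)
  obtain S N where S: "countably_rectifiable k X S" and N: "N \<in> null_sets \<mu>" "mspace X - S \<subseteq> N"
  proof -
    have "k \<noteq> 0" using k by simp
    then show ?thesis
      using T that unfolding integer_rectifiable_def \<mu>_def if_not_P[OF \<open>k \<noteq> 0\<close>] by blast
  qed
  have sep: "separable_subset X S" using S by (rule countably_rectifiable_separable)
  have SX: "S \<subseteq> mspace X" using S by (simp add: countably_rectifiable_def)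
  define A where "A n = {x \<in> S. mball_of X x (inverse (real (Suc n))) \<in> null_sets \<mu>}" for n
  have "\<forall>n. \<exists>D. countable D \<and> D \<subseteq> A n \<and> (\<forall>x\<in>A n. \<forall>\<epsilon>>0. \<exists>d\<in>D. mdist X d x < \<epsilon>)"
    by (rule allI, rule separable_subset_dense, rule separable_subset_mono[OF sep]) (auto simp: A_def)
  then obtain D where D: "\<And>n. countable (D n)" "\<And>n. D n \<subseteq> A n"
      "\<And>n x \<epsilon>. x \<in> A n \<Longrightarrow> \<epsilon> > 0 \<Longrightarrow> \<exists>d\<in>D n. mdist X d x < \<epsilon>"
    by metis
  define N' where "N' = N \<union> (\<Union>n. \<Union>d\<in>D n. mball_of X d (inverse (real (Suc n))))"
  have "(\<Union>d\<in>D n. mball_of X d (inverse (real (Suc n)))) \<in> null_sets \<mu>" for n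
    using D(1,2)[of n] by (intro null_sets_UN') (auto simp: A_def)
  then have N': "N' \<in> null_sets \<mu>" unfolding N'_def by (intro null_sets.Un N(1) null_sets_UN)
  have "x \<in> N'" if x: "x \<in> mspace X - spt k X T" for x
  proof (cases "x \<in> S")
    case True
    obtain r where r: "r > 0" "emeasure \<mu> (mball_of X x r) = 0"
      using x by (auto simp: spt_def \<mu>_def not_gr_zero)
    obtain n where n: "inverse (real (Suc n)) < r" using reals_Archimedean[OF r(1)] by blast
    have "mball_of X x (inverse (real (Suc n))) \<subseteq> mball_of X x r" using n by auto
    moreover have "mball_of X x r \<in> null_sets \<mu>" using r(2) ballm by (simp add: null_sets_def)
    ultimately have "x \<in> A n" using True ballm null_sets_subset unfolding A_def by blast
    then obtain d where d: "d \<in> D n" "mdist X d x < inverse (real (Suc n))"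
      using D(3)[of x n "inverse (real (Suc n))"] by auto
    then have "x \<in> mball_of X d (inverse (real (Suc n)))"
      using x D(2)[of n] SX by (auto simp: A_def)
    then show ?thesis using d(1) unfolding N'_def by blast
  next
    case False
    then show ?thesis using x N(2) by (auto simp: N'_def)
  qed
  then show "\<exists>N\<in>null_sets (mass_measure k X T). mspace X - spt k X T \<subseteq> N"
    using N' unfolding \<mu>_def by blast
  show "separable_subset X (spt k X T)"
    unfolding separable_subset_def
  proof (intro allI impI)
    fix \<epsilon> :: real assume "\<epsilon> > 0"
    then have \<epsilon>: "\<epsilon> / 3 > 0" by simp
    have "\<exists>s\<in>S. mdist X x s < \<epsilon> / 3" if x: "x \<in> spt k X T" for x
    proof (rule ccontr)
      assume "\<not> ?thesis"
      then have "mball_of X x (\<epsilon> / 3) \<subseteq> N" using N(2) by auto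
      then have "emeasure \<mu> (mball_of X x (\<epsilon> / 3)) = 0"
        using null_sets_subset[OF N(1) ballm] by (auto simp: null_sets_def)
      moreover have "0 < emeasure \<mu> (mball_of X x (\<epsilon> / 3))"
        using x \<epsilon> unfolding spt_def \<mu>_def by blast
      ultimately show False by simp
    qed
    then obtain s where s: "\<And>x. x \<in> spt k X T \<Longrightarrow> s x \<in> S \<and> mdist X x (s x) < \<epsilon> / 3" by metis
    obtain c :: "'a \<Rightarrow> nat" where c: "\<And>x y. x \<in> S \<Longrightarrow> y \<in> S \<Longrightarrow> c x = c y \<Longrightarrow> mdist X x y \<le> \<epsilon> / 3"
      using separable_subsetE[OF sep \<epsilon>] by blast
    show "\<exists>c :: 'a \<Rightarrow> nat. \<forall>x\<in>spt k X T. \<forall>y\<in>spt k X T. c x = c y \<longrightarrow> mdist X x y \<le> \<epsilon>"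
    proof (intro exI[of _ "\<lambda>x. c (s x)"] ballI impI)
      fix x y assume xy: "x \<in> spt k X T" "y \<in> spt k X T" "c (s x) = c (s y)"
      have m: "x \<in> mspace X" "y \<in> mspace X" "s x \<in> mspace X" "s y \<in> mspace X"
        using xy s SX by (auto simp: spt_def)
      have "mdist X x y \<le> mdist X x (s x) + mdist X (s x) (s y) + mdist X y (s y)"
        using mdist_triangle[of x X "s x" y] mdist_triangle[of "s x" X "s y" y] m
        by (simp add: mdist_commute)
      then show "mdist X x y \<le> \<epsilon>" using s[OF xy(1)] s[OF xy(2)] c[of "s x" "s y"] xy(3) by linarith
    qed
  qed
qed

section \<open>Transport of tuples and linked sequences\<close>

definition agree_along :: "nat \<Rightarrow> 'y set \<Rightarrow> ('y \<Rightarrow> 'b) \<Rightarrow> ('y \<Rightarrow> 'c) \<Rightarrow>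
    ('b \<Rightarrow> real) \<Rightarrow> ('b \<Rightarrow> real) list \<Rightarrow> ('c \<Rightarrow> real) \<Rightarrow> ('c \<Rightarrow> real) list \<Rightarrow> bool" where
  "agree_along k Y \<phi> \<phi>' f \<pi> f' \<pi>' \<longleftrightarrow>
     (\<forall>y\<in>Y. f (\<phi> y) = f' (\<phi>' y) \<and> (\<forall>i<k. (\<pi> ! i) (\<phi> y) = (\<pi>' ! i) (\<phi>' y)))"

lemma clamp_real_id: "\<bar>t\<bar> \<le> \<delta> \<Longrightarrow> clamp_real \<delta> t = t"
  by (auto simp: clamp_real_def)

text \<open>
  The key to comparing currents in different spaces. McShane extension keeps the Lipschitz constants,
  and clamping restores the bound of the first entry without changing it on \<open>Y\<close>.
\<close>

lemma transport_tuple: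
  assumes f: "(f, \<pi>) \<in> bdd_tuples k W K"
    and \<phi>: "\<And>y. y \<in> Y \<Longrightarrow> \<phi> y \<in> mspace W" "\<And>y. y \<in> Y \<Longrightarrow> \<phi>' y \<in> mspace W'"
    and iso: "\<And>x y. x \<in> Y \<Longrightarrow> y \<in> Y \<Longrightarrow> mdist W (\<phi> x) (\<phi> y) = mdist W' (\<phi>' x) (\<phi>' y)"
  shows "\<exists>f' \<pi>'. (f', \<pi>') \<in> bdd_tuples k W' K \<and> agree_along k Y \<phi> \<phi>' f \<pi> f' \<pi>'"
proof -
  have K: "0 \<le> K" using f bdd_tuples_nonneg by blast
  have ext: "\<exists>u'. lip_const W' K u' \<and> (\<forall>y\<in>Y. u' (\<phi>' y) = u (\<phi> y))" if u: "lip_const W K u" for u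
  proof (rule McShane_extension[OF K \<phi>(2)])
    fix x y assume xy: "x \<in> Y" "y \<in> Y"
    then show "u (\<phi> x) - u (\<phi> y) \<le> K * mdist W' (\<phi>' x) (\<phi>' y)"
      using lip_constD[OF u \<phi>(1) \<phi>(1), of x y] iso[OF xy] by simp
  qed
  have fK: "lip_const W K f" "\<And>x. x \<in> mspace W \<Longrightarrow> \<bar>f x\<bar> \<le> K" "length \<pi> = k"
    using f by (auto simp: bdd_tuples_def)
  obtain g where g: "lip_const W' K g" "\<And>y. y \<in> Y \<Longrightarrow> g (\<phi>' y) = f (\<phi> y)"
    using ext[OF fK(1)] by blast
  have "\<forall>i. \<exists>u'. i < k \<longrightarrow> lip_const W' K u' \<and> (\<forall>y\<in>Y. u' (\<phi>' y) = (\<pi> ! i) (\<phi> y))"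
    using ext f by (auto simp: bdd_tuples_def)
  then obtain p where p: "\<And>i. i < k \<Longrightarrow> lip_const W' K (p i)"
      "\<And>i y. i < k \<Longrightarrow> y \<in> Y \<Longrightarrow> p i (\<phi>' y) = (\<pi> ! i) (\<phi> y)"
    by metis
  have "(\<lambda>x. clamp_real K (g x), map p [0..<k]) \<in> bdd_tuples k W' K"
    using g(1) p(1) K by (auto simp: bdd_tuples_def abs_clamp_le intro: lip_const_clamp)
  moreover have "agree_along k Y \<phi> \<phi>' f \<pi> (\<lambda>x. clamp_real K (g x)) (map p [0..<k])"
    using g(2) p(2) fK(2)[OF \<phi>(1)] by (auto simp: agree_along_def clamp_real_id)
  ultimately show ?thesis by blast
qed

text \<open>
  This relation holds between two currents that are approached, uniformly on bounded tuples, by a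
  common sequence of functionals on spaces that embed isometrically on either side. The approximating
  functionals themselves no longer occur in it.
\<close>

definition linked :: "nat \<Rightarrow> 'b metric \<Rightarrow> 'b functional \<Rightarrow> 'c metric \<Rightarrow> 'c functional \<Rightarrow>
    (nat \<Rightarrow> 'y set) \<Rightarrow> (nat \<Rightarrow> 'y \<Rightarrow> 'b) \<Rightarrow> (nat \<Rightarrow> 'y \<Rightarrow> 'c) \<Rightarrow> bool" where
  "linked k Z S Z' S' Y \<phi> \<phi>' \<longleftrightarrow>
     (\<forall>n::nat. \<forall>y\<in>Y n. \<phi> n y \<in> mspace Z \<and> \<phi>' n y \<in> mspace Z') \<and>
     (\<forall>n. \<forall>x\<in>Y n. \<forall>y\<in>Y n. mdist Z (\<phi> n x) (\<phi> n y) = mdist Z' (\<phi>' n x) (\<phi>' n y)) \<and>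
     (\<forall>K. \<forall>\<epsilon>>0. \<forall>\<^sub>F n in sequentially. \<forall>f \<pi> f' \<pi>'.
        (f, \<pi>) \<in> bdd_tuples k Z K \<and> (f', \<pi>') \<in> bdd_tuples k Z' K \<and>
        agree_along k (Y n) (\<phi> n) (\<phi>' n) f \<pi> f' \<pi>' \<longrightarrow> \<bar>S f \<pi> - S' f' \<pi>'\<bar> < \<epsilon>)"

lemma linkedD:
  assumes "linked k Z S Z' S' Y \<phi> \<phi>'"
  shows "y \<in> Y n \<Longrightarrow> \<phi> n y \<in> mspace Z" "y \<in> Y n \<Longrightarrow> \<phi>' n y \<in> mspace Z'"
    "x \<in> Y n \<Longrightarrow> y \<in> Y n \<Longrightarrow> mdist Z (\<phi> n x) (\<phi> n y) = mdist Z' (\<phi>' n x) (\<phi>' n y)"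
  using assms unfolding linked_def by blast+

lemma linked_eventually:
  assumes "linked k Z S Z' S' Y \<phi> \<phi>'" "\<epsilon> > 0"
  shows "\<forall>\<^sub>F n in sequentially. \<forall>f \<pi> f' \<pi>'.
        (f, \<pi>) \<in> bdd_tuples k Z K \<and> (f', \<pi>') \<in> bdd_tuples k Z' K \<and>
        agree_along k (Y n) (\<phi> n) (\<phi>' n) f \<pi> f' \<pi>' \<longrightarrow> \<bar>S f \<pi> - S' f' \<pi>'\<bar> < \<epsilon>"
  using assms unfolding linked_def by blast

lemma agree_along_sym: "agree_along k Y \<phi> \<phi>' f \<pi> f' \<pi>' \<Longrightarrow> agree_along k Y \<phi>' \<phi> f' \<pi>' f \<pi>"
  by (simp add: agree_along_def)

lemma linked_sym:
  assumes l: "linked k Z S Z' S' Y \<phi> \<phi>'"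
  shows "linked k Z' S' Z S Y \<phi>' \<phi>"
  unfolding linked_def
proof (intro conjI allI impI ballI)
  fix K \<epsilon> :: real assume "\<epsilon> > 0"
  from linked_eventually[OF l this, of K]
  show "\<forall>\<^sub>F n in sequentially. \<forall>f \<pi> f' \<pi>'.
        (f, \<pi>) \<in> bdd_tuples k Z' K \<and> (f', \<pi>') \<in> bdd_tuples k Z K \<and>
        agree_along k (Y n) (\<phi>' n) (\<phi> n) f \<pi> f' \<pi>' \<longrightarrow> \<bar>S' f \<pi> - S f' \<pi>'\<bar> < \<epsilon>"
    by (rule eventually_mono) (metis abs_minus_commute agree_along_sym)
qed (use linkedD[OF l] in auto)

lemma linked_subseq:
  assumes l: "linked k Z S Z' S' Y \<phi> \<phi>'" and s: "strict_mono s"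
  shows "linked k Z S Z' S' (\<lambda>n. Y (s n)) (\<lambda>n. \<phi> (s n)) (\<lambda>n. \<phi>' (s n))"
  unfolding linked_def
proof (intro conjI allI impI ballI)
  fix K \<epsilon> :: real assume "\<epsilon> > 0"
  from eventually_subseq[OF s linked_eventually[OF l this, of K]]
  show "\<forall>\<^sub>F n in sequentially. \<forall>f \<pi> f' \<pi>'.
        (f, \<pi>) \<in> bdd_tuples k Z K \<and> (f', \<pi>') \<in> bdd_tuples k Z' K \<and>
        agree_along k (Y (s n)) (\<phi> (s n)) (\<phi>' (s n)) f \<pi> f' \<pi>' \<longrightarrow> \<bar>S f \<pi> - S' f' \<pi>'\<bar> < \<epsilon>" .
qed (use linkedD[OF l] in auto)

lemma linked_transport:
  assumes l: "linked k Z S Z' S' Y \<phi> \<phi>'" and f: "(f, \<pi>) \<in> bdd_tuples k Z K"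
  obtains f' \<pi>' where "(f', \<pi>') \<in> bdd_tuples k Z' K" "agree_along k (Y n) (\<phi> n) (\<phi>' n) f \<pi> f' \<pi>'"
  using transport_tuple[OF f, of "Y n" "\<phi> n" "\<phi>' n" Z'] linkedD[OF l] by blast

section \<open>Following points of the support\<close>

lemma multilinear_zero_first:
  assumes "multilinear k X T" "(f, \<pi>) \<in> tuples k X"
  shows "T (\<lambda>_. 0) \<pi> = 0"
proof -
  have "T (\<lambda>x. 0 * f x + 0 * f x) \<pi> = 0 * T f \<pi> + 0 * T f \<pi>"
    using assms unfolding multilinear_def by blast
  then show ?thesis by simp
qed

text \<open>
  If \<open>f\<close> vanished on a late piece, then \<open>(f, \<pi>)\<close> and \<open>(0, \<pi>)\<close> would agree along it with the same
  tuple on the other side, so the fixed nonzero value \<open>S f \<pi>\<close> would be close to \<open>0\<close>.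
\<close>

lemma linked_nonzero_meets:
  assumes l: "linked k Z S Z' S' Y \<phi> \<phi>'" and S: "current k Z S"
    and f: "(f, \<pi>) \<in> tuples k Z" "S f \<pi> \<noteq> 0"
  shows "\<forall>\<^sub>F n in sequentially. \<exists>y\<in>Y n. f (\<phi> n y) \<noteq> 0"
proof -
  obtain K where K: "(f, \<pi>) \<in> bdd_tuples k Z K" using f tuples_imp_bdd_tuples by blast
  then have K0: "(\<lambda>_. 0, \<pi>) \<in> bdd_tuples k Z K"
    using bdd_tuples_nonneg[OF K] by (auto simp: bdd_tuples_def intro: lip_const_const)
  have z: "S (\<lambda>_. 0) \<pi> = 0" using S f(1) multilinear_zero_first unfolding current_def by blast
  have "\<bar>S f \<pi>\<bar> / 2 > 0" using f by simp
  from linked_eventually[OF l this, of K] show ?thesis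
  proof (rule eventually_mono)
    fix n
    assume *: "\<forall>f' \<pi>' g \<tau>. (f', \<pi>') \<in> bdd_tuples k Z K \<and> (g, \<tau>) \<in> bdd_tuples k Z' K \<and>
      agree_along k (Y n) (\<phi> n) (\<phi>' n) f' \<pi>' g \<tau> \<longrightarrow> \<bar>S f' \<pi>' - S' g \<tau>\<bar> < \<bar>S f \<pi>\<bar> / 2"
    obtain f' \<pi>' where t: "(f', \<pi>') \<in> bdd_tuples k Z' K" "agree_along k (Y n) (\<phi> n) (\<phi>' n) f \<pi> f' \<pi>'"
      using linked_transport[OF l K] by blast
    show "\<exists>y\<in>Y n. f (\<phi> n y) \<noteq> 0"
    proof (rule ccontr)
      assume "\<not> ?thesis"
      then have "agree_along k (Y n) (\<phi> n) (\<phi>' n) (\<lambda>_. 0) \<pi> f' \<pi>'"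
        using t(2) by (auto simp: agree_along_def)
      then have "\<bar>S (\<lambda>_. 0) \<pi> - S' f' \<pi>'\<bar> < \<bar>S f \<pi>\<bar> / 2" using * K0 t(1) by blast
      moreover have "\<bar>S f \<pi> - S' f' \<pi>'\<bar> < \<bar>S f \<pi>\<bar> / 2" using * K t by blast
      ultimately show False using z by linarith
    qed
  qed
qed

text \<open>
  The chosen points are almost nearest to \<open>x\<close>, so that they are defined for every \<open>n\<close> and not only
  once the pieces have come close to \<open>x\<close>.
\<close>

lemma spt_sequence:
  assumes l: "linked k Z S Z' S' Y \<phi> \<phi>'" and S: "current k Z S" and ne: "\<And>n. Y n \<noteq> {}"
    and x: "x \<in> spt k Z S"
  shows "\<exists>y. (\<forall>n. y n \<in> Y n) \<and> (\<lambda>n. mdist Z (\<phi> n (y n)) x) \<longlonglongrightarrow> 0"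
proof -
  define D where "D n = (INF y\<in>Y n. mdist Z (\<phi> n y) x)" for n
  have "\<exists>y\<in>Y n. mdist Z (\<phi> n y) x < D n + inverse (real (Suc n))" for n
    unfolding D_def using ne by (intro cInf_lessD[of "(\<lambda>y. mdist Z (\<phi> n y) x) ` Y n", simplified]) auto
  then obtain y where y: "\<And>n. y n \<in> Y n" "\<And>n. mdist Z (\<phi> n (y n)) x < D n + inverse (real (Suc n))"
    by metis
  have xZ: "x \<in> mspace Z" using x by (simp add: spt_def)
  have "D \<longlonglongrightarrow> 0"
  proof (rule LIMSEQ_I)
    fix r :: real assume r: "0 < r"
    obtain f \<pi> where f: "(f, \<pi>) \<in> tuples k Z" "\<forall>z\<in>mspace Z. r \<le> mdist Z x z \<longrightarrow> f z = 0" "S f \<pi> \<noteq> 0"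
      using spt_nonvanishing[OF S x r] by blast
    have "\<forall>\<^sub>F n in sequentially. norm (D n - 0) < r"
      using linked_nonzero_meets[OF l S f(1,3)]
    proof (rule eventually_mono)
      fix n assume "\<exists>y\<in>Y n. f (\<phi> n y) \<noteq> 0"
      then obtain v where v: "v \<in> Y n" "mdist Z (\<phi> n v) x < r"
        using f(2) linkedD(1)[OF l] by (metis mdist_commute not_le_imp_less)
      have "D n \<le> mdist Z (\<phi> n v) x"
        unfolding D_def by (rule cINF_lower[OF bdd_belowI2[where m = 0] v(1)]) simp
      moreover have "0 \<le> D n" unfolding D_def by (rule cINF_greatest[OF ne]) simp
      ultimately show "norm (D n - 0) < r" using v by simp
    qed
    then show "\<exists>M. \<forall>n\<ge>M. norm (D n - 0) < r" by (simp add: eventually_sequentially)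
  qed
  then have lim: "(\<lambda>n. D n + inverse (real (Suc n))) \<longlonglongrightarrow> 0"
    using tendsto_add[OF _ LIMSEQ_inverse_real_of_nat] by fastforce
  have "(\<lambda>n. mdist Z (\<phi> n (y n)) x) \<longlonglongrightarrow> 0"
  proof (rule tendsto_if_abs_diff_le[OF _ lim])
    show "\<bar>mdist Z (\<phi> n (y n)) x - 0\<bar> \<le> D n + inverse (real (Suc n))" for n
      using y(2)[of n] by simp
  qed
  then show ?thesis using y(1) by blast
qed

text \<open>
  The mass of \<open>S\<close> near \<open>x\<close> is seen by a tuple supported near \<open>x\<close>. Its transport, cut off near the
  corresponding point of the other space, is seen by \<open>S'\<close> with a value bounded away from zero.
\<close>

lemma spt_transport:
  assumes l: "linked k Z S Z' S' Y \<phi> \<phi>'" and S: "current k Z S" and x: "x \<in> spt k Z S"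
    and y: "\<And>n. y n \<in> Y n" "(\<lambda>n. mdist Z (\<phi> n (y n)) x) \<longlonglongrightarrow> 0" and r: "r > 0"
  shows "\<exists>K \<eta>. 0 < K \<and> 0 < \<eta> \<and> (\<forall>\<^sub>F n in sequentially. \<exists>g \<tau>. (g, \<tau>) \<in> bdd_tuples k Z' K \<and>
     (\<forall>z\<in>mspace Z'. r \<le> mdist Z' (\<phi>' n (y n)) z \<longrightarrow> g z = 0) \<and> \<eta> \<le> \<bar>S' g \<tau>\<bar>)"
proof -
  (* The support of f has radius r/4 around x, hence r/2 around the approximating point, where the
     cutoff function still equals 1. *)
  have r4: "r / 4 > 0" using r by simp
  obtain f \<pi> where f: "(f, \<pi>) \<in> tuples k Z" "\<forall>z\<in>mspace Z. r/4 \<le> mdist Z x z \<longrightarrow> f z = 0" "S f \<pi> \<noteq> 0"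
    using spt_nonvanishing[OF S x r4] by blast
  obtain K0 where K0: "K0 > 0" "(f, \<pi>) \<in> bdd_tuples k Z K0" using f tuples_imp_bdd_tuples by blast
  define K where "K = K0 * 1 + K0 * (2 / r)"
  have K: "K0 \<le> K" "K > 0" using K0 r by (auto simp: K_def add_pos_nonneg)
  have xZ: "x \<in> mspace Z" using x by (simp add: spt_def)
  define \<eta> where "\<eta> = \<bar>S f \<pi>\<bar> / 2"
  have \<eta>: "\<eta> > 0" using f by (simp add: \<eta>_def)
  have "\<forall>\<^sub>F n in sequentially. mdist Z (\<phi> n (y n)) x < r/4"
    using y(2) r4 by (rule order_tendstoD(2))
  from eventually_conj[OF this linked_eventually[OF l \<eta>, of K]]
  have "\<forall>\<^sub>F n in sequentially. \<exists>g \<tau>. (g, \<tau>) \<in> bdd_tuples k Z' K \<and>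
     (\<forall>z\<in>mspace Z'. r \<le> mdist Z' (\<phi>' n (y n)) z \<longrightarrow> g z = 0) \<and> \<eta> \<le> \<bar>S' g \<tau>\<bar>"
  proof (rule eventually_mono)
    fix n
    assume *: "mdist Z (\<phi> n (y n)) x < r/4 \<and> (\<forall>f \<pi> f' \<pi>'.
        (f, \<pi>) \<in> bdd_tuples k Z K \<and> (f', \<pi>') \<in> bdd_tuples k Z' K \<and>
        agree_along k (Y n) (\<phi> n) (\<phi>' n) f \<pi> f' \<pi>' \<longrightarrow> \<bar>S f \<pi> - S' f' \<pi>'\<bar> < \<eta>)"
    obtain f' \<pi>' where t: "(f', \<pi>') \<in> bdd_tuples k Z' K0" "agree_along k (Y n) (\<phi> n) (\<phi>' n) f \<pi> f' \<pi>'"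
      using linked_transport[OF l K0(2)] by blast
    let ?a = "\<phi>' n (y n)"
    have a: "?a \<in> mspace Z'" "\<phi> n (y n) \<in> mspace Z" using linkedD[OF l] y(1) by auto
    obtain h where h: "lip_const Z' (1 / (r/2)) h" "\<And>z. 0 \<le> h z \<and> h z \<le> 1"
        "\<And>z. mdist Z' ?a z \<le> r/2 \<Longrightarrow> h z = 1" "\<And>z. r \<le> mdist Z' ?a z \<Longrightarrow> h z = 0"
      using cutoff_function[OF a(1), of "r/2"] r by auto
    define g where "g z = f' z * h z" for z
    have "(g, \<pi>') \<in> bdd_tuples k Z' K"
    proof -
      have f': "lip_const Z' K0 f'" "\<And>z. z \<in> mspace Z' \<Longrightarrow> \<bar>f' z\<bar> \<le> K0" using t(1) by (auto simp: bdd_tuples_def)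
      have "lip_const Z' (K0 * 1 + K0 * (1 / (r/2))) g"
        unfolding g_def using h(2) K0(1) by (intro lip_const_mult f' h(1)) (auto simp: abs_le_iff intro: order_trans[of _ 0])
      moreover have "\<bar>g z\<bar> \<le> K" if "z \<in> mspace Z'" for z
        using mult_mono[of "\<bar>f' z\<bar>" K0 "h z" 1] f'(2)[OF that] h(2)[of z] K K0(1) by (simp add: g_def abs_mult)
      ultimately show ?thesis
        using t(1) K lip_const_mono[of Z' K0 _ K] by (simp add: bdd_tuples_def K_def)
    qed
    moreover have "agree_along k (Y n) (\<phi> n) (\<phi>' n) f \<pi> g \<pi>'"
      unfolding agree_along_def
    proof (intro ballI conjI)
      fix v assume v: "v \<in> Y n"
      have fv: "f (\<phi> n v) = f' (\<phi>' n v)" using t(2) v by (simp add: agree_along_def)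
      show "f (\<phi> n v) = g (\<phi>' n v)"
      proof (cases "mdist Z' ?a (\<phi>' n v) \<le> r/2")
        case True
        then show ?thesis using fv h(3) by (simp add: g_def)
      next
        case False
        then have "r/2 < mdist Z (\<phi> n (y n)) (\<phi> n v)" using linkedD(3)[OF l y(1) v] by simp
        also have "\<dots> \<le> mdist Z (\<phi> n (y n)) x + mdist Z x (\<phi> n v)"
          by (rule mdist_triangle[OF a(2) xZ linkedD(1)[OF l v]])
        finally have "r/4 \<le> mdist Z x (\<phi> n v)" using * by linarith
        then show ?thesis using f(2) fv linkedD(1)[OF l v] by (simp add: g_def)
      qed
      show "\<forall>i<k. (\<pi> ! i) (\<phi> n v) = (\<pi>' ! i) (\<phi>' n v)" using t(2) v by (simp add: agree_along_def)
    qed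
    moreover have "(f, \<pi>) \<in> bdd_tuples k Z K" using K0(2) K(1) by (rule bdd_tuples_mono)
    ultimately have "\<bar>S f \<pi> - S' g \<pi>'\<bar> < \<eta>" using * by blast
    then have "\<eta> \<le> \<bar>S' g \<pi>'\<bar>" unfolding \<eta>_def by linarith
    then show "\<exists>g \<tau>. (g, \<tau>) \<in> bdd_tuples k Z' K \<and>
     (\<forall>z\<in>mspace Z'. r \<le> mdist Z' ?a z \<longrightarrow> g z = 0) \<and> \<eta> \<le> \<bar>S' g \<tau>\<bar>"
      using \<open>(g, \<pi>') \<in> bdd_tuples k Z' K\<close> h(4) by (intro exI[of _ g] exI[of _ \<pi>']) (auto simp: g_def)
  qed
  then show ?thesis using K(2) \<eta> by blast
qed

text \<open>
  The cut-off tuples that detect \<open>x\<close> from the other space are eventually supported in any given ball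
  around the limit \<open>z\<close>.
\<close>

lemma transported_limit_in_spt:
  assumes l: "linked k Z S Z' S' Y \<phi> \<phi>'" and S: "current k Z S" "current k Z' S'" and x: "x \<in> spt k Z S"
    and y: "\<And>n. y n \<in> Y n" "(\<lambda>n. mdist Z (\<phi> n (y n)) x) \<longlonglongrightarrow> 0"
    and z: "z \<in> mspace Z'" "(\<lambda>n. mdist Z' (\<phi>' n (y n)) z) \<longlonglongrightarrow> 0"
  shows "z \<in> spt k Z' S'"
proof (rule in_spt_if_nonvanishing[OF S(2) z(1)])
  fix r :: real assume r: "r > 0"
  then have r2: "r/2 > 0" by simp
  obtain K \<eta> where \<eta>: "0 < \<eta>" and ev: "\<forall>\<^sub>F n in sequentially. \<exists>g \<tau>. (g, \<tau>) \<in> bdd_tuples k Z' K \<and>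
     (\<forall>z\<in>mspace Z'. r/2 \<le> mdist Z' (\<phi>' n (y n)) z \<longrightarrow> g z = 0) \<and> \<eta> \<le> \<bar>S' g \<tau>\<bar>"
    using spt_transport[OF l S(1) x y r2] by blast
  have "\<forall>\<^sub>F n in sequentially. mdist Z' (\<phi>' n (y n)) z < r/2"
    using z(2) r2 by (rule order_tendstoD(2))
  from eventually_happens'[OF sequentially_bot eventually_conj[OF this ev]]
  obtain n g \<tau> where n: "mdist Z' (\<phi>' n (y n)) z < r/2" and g: "(g, \<tau>) \<in> bdd_tuples k Z' K"
     "\<And>w. w \<in> mspace Z' \<Longrightarrow> r/2 \<le> mdist Z' (\<phi>' n (y n)) w \<Longrightarrow> g w = 0" "\<eta> \<le> \<bar>S' g \<tau>\<bar>"
    by blast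
  have "g w = 0" if w: "w \<in> mspace Z'" "r \<le> mdist Z' z w" for w
  proof (rule g(2)[OF w(1)])
    have "mdist Z' z w \<le> mdist Z' z (\<phi>' n (y n)) + mdist Z' (\<phi>' n (y n)) w"
      by (rule mdist_triangle[OF z(1) linkedD(2)[OF l y(1)] w(1)])
    then show "r/2 \<le> mdist Z' (\<phi>' n (y n)) w" using n w(2) by (simp add: mdist_commute)
  qed
  then show "\<exists>f \<pi>. (f, \<pi>) \<in> tuples k Z' \<and> (\<forall>w\<in>mspace Z'. r \<le> mdist Z' z w \<longrightarrow> f w = 0) \<and> S' f \<pi> \<noteq> 0"
    using g(1,3) \<eta> bdd_tuples_imp_tuples by (intro exI[of _ g] exI[of _ \<tau>]) auto
qed

text \<open>
  Only boundedly many disjoint balls can each carry a fixed amount of a finite measure, so a sequence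
  whose balls do is totally bounded.
\<close>

lemma convergent_subsequence_if_mass:
  assumes \<mu>: "finite_borel X \<mu>" and X: "mcomplete_of X" and p: "\<And>n::nat. p n \<in> mspace X"
    and mass: "\<And>r. r > 0 \<Longrightarrow> \<exists>\<eta>>0. \<forall>\<^sub>F n in sequentially. \<eta> \<le> measure \<mu> (mball_of X (p n) r)"
  shows "\<exists>s l. strict_mono s \<and> l \<in> mspace X \<and> (\<lambda>n. mdist X (p (s n)) l) \<longlonglongrightarrow> 0"
proof -
  interpret M: Metric_space "mspace X" "mdist X" by simp
  interpret finite_measure \<mu> using \<mu> finite_borelD by blast
  have "M.mtotally_bounded (range p)"
    unfolding M.mtotally_bounded_def
  proof (intro allI impI)
    fix \<epsilon> :: real assume \<epsilon>: "\<epsilon> > 0"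
    (* Balls of half the radius around \<epsilon>-separated points are disjoint; a separated set of maximal
       cardinality is an \<epsilon>-net. *)
    then obtain \<eta> N where \<eta>: "\<eta> > 0" and N: "\<And>n. n \<ge> N \<Longrightarrow> \<eta> \<le> measure \<mu> (mball_of X (p n) (\<epsilon>/2))"
      using mass[of "\<epsilon>/2"] unfolding eventually_sequentially by auto
    define sep where "sep F \<longleftrightarrow> finite F \<and> F \<subseteq> {N..} \<and>
      (\<forall>i\<in>F. \<forall>j\<in>F. i \<noteq> j \<longrightarrow> \<epsilon> \<le> mdist X (p i) (p j))" for F
    have card: "real (card F) * \<eta> \<le> measure \<mu> (space \<mu>)" if F: "sep F" for F
    proof -
      have disj: "disjoint_family_on (\<lambda>i. mball_of X (p i) (\<epsilon>/2)) F"
        unfolding disjoint_family_on_def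
      proof (intro ballI impI, rule ccontr)
        fix i j assume ij: "i \<in> F" "j \<in> F" "i \<noteq> j" "mball_of X (p i) (\<epsilon>/2) \<inter> mball_of X (p j) (\<epsilon>/2) \<noteq> {}"
        then obtain w where w: "w \<in> mspace X" "mdist X (p i) w < \<epsilon>/2" "mdist X (p j) w < \<epsilon>/2" by auto
        have "mdist X (p i) (p j) \<le> mdist X (p i) w + mdist X w (p j)"
          by (rule mdist_triangle[OF p w(1) p])
        then have "mdist X (p i) (p j) < \<epsilon>" using w by (simp add: mdist_commute)
        then show False using F ij unfolding sep_def by force
      qed
      have "real (card F) * \<eta> = (\<Sum>i\<in>F. \<eta>)" by simp
      also have "\<dots> \<le> (\<Sum>i\<in>F. measure \<mu> (mball_of X (p i) (\<epsilon>/2)))"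
        using F N by (intro sum_mono) (auto simp: sep_def)
      also have "\<dots> = measure \<mu> (\<Union>i\<in>F. mball_of X (p i) (\<epsilon>/2))"
        using F disj finite_borelD(1)[OF \<mu>] mball_of_borel[of X]
        by (intro finite_measure_finite_Union[symmetric]) (auto simp: sep_def)
      also have "\<dots> \<le> measure \<mu> (space \<mu>)" by (rule bounded_measure)
      finally show ?thesis .
    qed
    obtain B :: nat where B: "measure \<mu> (space \<mu>) / \<eta> < real B" using reals_Archimedean2 by blast
    have "\<forall>F. sep F \<longrightarrow> card F < B"
    proof (intro allI impI)
      fix F assume "sep F"
      then have "real (card F) \<le> measure \<mu> (space \<mu>) / \<eta>" using card \<eta> by (simp add: pos_le_divide_eq)
      then show "card F < B" using B by linarith
    qed
    moreover have "sep {}" by (simp add: sep_def)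
    ultimately obtain F where F: "sep F" "\<And>G. sep G \<Longrightarrow> card G \<le> card F"
      using ex_has_greatest_nat[of sep "{}" card B] by blast
    show "\<exists>K. finite K \<and> K \<subseteq> range p \<and> range p \<subseteq> (\<Union>x\<in>K. M.mball x \<epsilon>)"
    proof (intro exI[of _ "p ` (F \<union> {..<N})"] conjI)
      show "finite (p ` (F \<union> {..<N}))" using F(1) by (simp add: sep_def)
      show "p ` (F \<union> {..<N}) \<subseteq> range p" by blast
      have "\<exists>i\<in>F \<union> {..<N}. mdist X (p i) (p n) < \<epsilon>" for n
      proof (cases "n < N")
        case True
        then show ?thesis using \<epsilon> mdist_self[OF p] by (intro bexI[of _ n]) auto
      next
        case False
        show ?thesis
        proof (rule ccontr)
          assume "\<not> ?thesis"
          then have far: "\<And>i. i \<in> F \<Longrightarrow> \<epsilon> \<le> mdist X (p i) (p n)" by force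
          then have "n \<notin> F" using \<epsilon> mdist_self[OF p, of n] by force
          moreover have "sep (insert n F)"
            using F(1) far False by (auto simp: sep_def mdist_commute)
          ultimately show False using F(2)[of "insert n F"] F(1) by (simp add: sep_def)
        qed
      qed
      then show "range p \<subseteq> (\<Union>x\<in>p ` (F \<union> {..<N}). M.mball x \<epsilon>)" using p by fastforce
    qed
  qed
  then obtain s where s: "strict_mono s" "M.MCauchy (p \<circ> s)"
    unfolding M.mtotally_bounded_sequentially by blast
  moreover have "M.mcomplete" using X by (simp add: mcomplete_of_def)
  ultimately obtain l where "limitin M.mtopology (p \<circ> s) l sequentially" unfolding M.mcomplete_def by blast
  then show ?thesis using s(1) unfolding M.limitin_metric_dist_null by auto
qed

lemma transported_subsequence_converges:
  assumes l: "linked k Z S Z' S' Y \<phi> \<phi>'" and S: "current k Z S" "current k Z' S'" and Z': "mcomplete_of Z'"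
    and x: "x \<in> spt k Z S" and y: "\<And>n. y n \<in> Y n" "(\<lambda>n. mdist Z (\<phi> n (y n)) x) \<longlonglongrightarrow> 0"
  shows "\<exists>s z. strict_mono s \<and> z \<in> mspace Z' \<and> (\<lambda>n. mdist Z' (\<phi>' (s n) (y (s n))) z) \<longlonglongrightarrow> 0"
proof -
  let ?\<mu> = "mass_measure k Z' S'"
  have \<mu>: "mass_bound k Z' S' ?\<mu>" using S(2) mass_bound_mass_measure by blast
  have f\<mu>: "finite_borel Z' ?\<mu>" using \<mu> mass_bound_finite_borel by blast
  interpret finite_measure ?\<mu> using f\<mu> finite_borelD by blast
  show ?thesis
  proof (rule convergent_subsequence_if_mass[OF f\<mu> Z'])
    show "\<phi>' n (y n) \<in> mspace Z'" for n using linkedD(2)[OF l y(1)] .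
    fix r :: real assume r: "r > 0"
    obtain K \<eta> where K: "0 < K" "0 < \<eta>" and ev: "\<forall>\<^sub>F n in sequentially. \<exists>g \<tau>. (g, \<tau>) \<in> bdd_tuples k Z' K \<and>
     (\<forall>z\<in>mspace Z'. r \<le> mdist Z' (\<phi>' n (y n)) z \<longrightarrow> g z = 0) \<and> \<eta> \<le> \<bar>S' g \<tau>\<bar>"
      using spt_transport[OF l S(1) x y r] by blast
    from ev have "\<forall>\<^sub>F n in sequentially. \<eta> / K ^ Suc k \<le> measure ?\<mu> (mball_of Z' (\<phi>' n (y n)) r)"
    proof (rule eventually_mono)
      fix n
      let ?B = "mball_of Z' (\<phi>' n (y n)) r"
      assume "\<exists>g \<tau>. (g, \<tau>) \<in> bdd_tuples k Z' K \<and>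
        (\<forall>z\<in>mspace Z'. r \<le> mdist Z' (\<phi>' n (y n)) z \<longrightarrow> g z = 0) \<and> \<eta> \<le> \<bar>S' g \<tau>\<bar>"
      then obtain g \<tau> where g: "(g, \<tau>) \<in> bdd_tuples k Z' K" "\<eta> \<le> \<bar>S' g \<tau>\<bar>"
        "\<And>z. z \<in> mspace Z' \<Longrightarrow> r \<le> mdist Z' (\<phi>' n (y n)) z \<Longrightarrow> g z = 0" by blast
      have gK: "lip_const Z' K g" "\<And>z. z \<in> mspace Z' \<Longrightarrow> \<bar>g z\<bar> \<le> K" using g(1) by (auto simp: bdd_tuples_def)
      have B: "?B \<in> sets ?\<mu>" unfolding finite_borelD(1)[OF f\<mu>] by (rule mball_of_borel)
      have a: "\<phi>' n (y n) \<in> mspace Z'" using linkedD(2)[OF l y(1)] .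
      have "\<eta> \<le> K ^ k * (\<integral>z. \<bar>g z\<bar> \<partial>?\<mu>)"
        using current_bound[OF \<mu> bdd_tuples_imp_tuples[OF g(1)], of K] g(1,2) by (auto simp: bdd_tuples_def)
      also have "(\<integral>z. \<bar>g z\<bar> \<partial>?\<mu>) \<le> (\<integral>z. K * indicator ?B z \<partial>?\<mu>)"
      proof (rule integral_mono)
        show "integrable ?\<mu> (\<lambda>z. \<bar>g z\<bar>)"
          using gK lip_const_borel_measurable[OF f\<mu>] by (intro finite_borel_integrable[OF f\<mu>, of _ K]) auto
        show "integrable ?\<mu> (\<lambda>z. K * indicator ?B z)"
          using B by (intro integrable_mult_right integrable_real_indicator) (auto simp: less_top[symmetric])
        show "\<bar>g z\<bar> \<le> K * indicator ?B z" if "z \<in> space ?\<mu>" for z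
        proof (cases "z \<in> ?B")
          case True
          then show ?thesis using gK(2) by auto
        next
          case False
          then show ?thesis using that a g(3)[of z] finite_borelD(3)[OF f\<mu>] by auto
        qed
      qed
      also have "(\<integral>z. K * indicator ?B z \<partial>?\<mu>) = K * measure ?\<mu> ?B"
        using B sets.sets_into_space[OF B] by (simp add: Int_absorb2)
      finally show "\<eta> / K ^ Suc k \<le> measure ?\<mu> ?B" using K(1) by (simp add: divide_simps ac_simps)
    qed
    moreover have "0 < \<eta> / K ^ Suc k" using K by simp
    ultimately show "\<exists>\<eta>>0. \<forall>\<^sub>F n in sequentially. \<eta> \<le> measure ?\<mu> (mball_of Z' (\<phi>' n (y n)) r)" by blast
  qed
qed

section \<open>The limiting isometry\<close>

lemma tendsto_mdist:
  assumes "a \<in> mspace X" "b \<in> mspace X" "\<And>n. p n \<in> mspace X" "\<And>n. q n \<in> mspace X"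
    and p: "(\<lambda>n. mdist X (p n) a) \<longlonglongrightarrow> 0" and q: "(\<lambda>n. mdist X (q n) b) \<longlonglongrightarrow> 0"
  shows "(\<lambda>n. mdist X (p n) (q n)) \<longlonglongrightarrow> mdist X a b"
proof (rule tendsto_if_abs_diff_le)
  show "(\<lambda>n. mdist X (p n) a + mdist X (q n) b) \<longlonglongrightarrow> 0" using tendsto_add[OF p q] by simp
  fix n
  have "mdist X (p n) (q n) \<le> mdist X (p n) a + (mdist X a b + mdist X b (q n))"
    using mdist_triangle[of "p n" X a "q n"] mdist_triangle[of a X b "q n"] assms(1-4) by fastforce
  moreover have "mdist X a b \<le> mdist X a (p n) + (mdist X (p n) (q n) + mdist X (q n) b)"
    using mdist_triangle[of a X "p n" b] mdist_triangle[of "p n" X "q n" b] assms(1-4) by fastforce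
  ultimately show "\<bar>mdist X (p n) (q n) - mdist X a b\<bar> \<le> mdist X (p n) a + mdist X (q n) b"
    by (simp add: mdist_commute abs_le_iff)
qed

lemma convergent_if_nearly_convergent:
  assumes X: "mcomplete_of X" and p: "\<And>n::nat. p n \<in> mspace X"
    and near: "\<And>\<epsilon>. \<epsilon> > 0 \<Longrightarrow> \<exists>l\<in>mspace X. \<forall>\<^sub>F n in sequentially. mdist X (p n) l < \<epsilon>"
  shows "\<exists>l\<in>mspace X. (\<lambda>n. mdist X (p n) l) \<longlonglongrightarrow> 0"
proof -
  interpret M: Metric_space "mspace X" "mdist X" by simp
  have "M.MCauchy p"
    unfolding M.MCauchy_def
  proof (intro conjI allI impI)
    show "range p \<subseteq> mspace X" using p by blast
    fix \<epsilon> :: real assume "\<epsilon> > 0"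
    then obtain l N where l: "l \<in> mspace X" and N: "\<And>n. n \<ge> N \<Longrightarrow> mdist X (p n) l < \<epsilon> / 2"
      using near[of "\<epsilon> / 2"] unfolding eventually_sequentially by auto
    have "mdist X (p n) (p m) < \<epsilon>" if "n \<ge> N" "m \<ge> N" for n m
      using mdist_triangle[OF p l p, of n m] N[OF that(1)] N[OF that(2)] by (simp add: mdist_commute)
    then show "\<exists>N. \<forall>n n'. N \<le> n \<longrightarrow> N \<le> n' \<longrightarrow> mdist X (p n) (p n') < \<epsilon>" by blast
  qed
  moreover have "M.mcomplete" using X by (simp add: mcomplete_of_def)
  ultimately obtain l where "limitin M.mtopology p l sequentially" unfolding M.mcomplete_def by blast
  then show ?thesis unfolding M.limitin_metric_dist_null by auto
qed

text \<open>
  A diagonal argument makes the transported sequences converge for all points of a countable dense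
  subset of the support; since transport preserves distances, they then converge for all points.
\<close>

lemma common_convergent_subsequence:
  assumes l: "linked k Z S Z' S' Y \<phi> \<phi>'" and S: "current k Z S" "current k Z' S'" and Z': "mcomplete_of Z'"
    and sep: "separable_subset Z (spt k Z S)"
    and y: "\<And>x n. x \<in> spt k Z S \<Longrightarrow> y x n \<in> Y n"
      "\<And>x. x \<in> spt k Z S \<Longrightarrow> (\<lambda>n. mdist Z (\<phi> n (y x n)) x) \<longlonglongrightarrow> 0"
  shows "\<exists>s \<Psi>. strict_mono s \<and> (\<forall>x\<in>spt k Z S. \<Psi> x \<in> mspace Z' \<and>
     (\<lambda>n. mdist Z' (\<phi>' (s n) (y x (s n))) (\<Psi> x)) \<longlonglongrightarrow> 0)"
proof -
  obtain D where D: "countable D" "D \<subseteq> spt k Z S"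
      "\<And>x \<epsilon>. x \<in> spt k Z S \<Longrightarrow> \<epsilon> > 0 \<Longrightarrow> \<exists>d\<in>D. mdist Z d x < \<epsilon>"
    using separable_subset_dense[OF sep] by blast
  define conv where "conv x s \<longleftrightarrow> (\<exists>z\<in>mspace Z'. (\<lambda>n. mdist Z' (\<phi>' (s n) (y x (s n))) z) \<longlonglongrightarrow> 0)"
    for x and s :: "nat \<Rightarrow> nat"
  (* The membership condition covers empty D, where the enumeration returns an arbitrary point. *)
  define P where "P j s \<longleftrightarrow> (from_nat_into D j \<in> D \<longrightarrow> conv (from_nat_into D j) s)" for j s
  have sub: "conv x (s \<circ> r)" if "conv x s" "strict_mono r" for x s r
    using that(1) LIMSEQ_subseq_LIMSEQ[OF _ that(2)] unfolding conv_def by (fastforce simp: o_def)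
  interpret subseqs P
  proof
    fix j and s :: "nat \<Rightarrow> nat" assume s: "strict_mono s"
    let ?d = "from_nat_into D j"
    show "\<exists>r. strict_mono r \<and> P j (s \<circ> r)"
    proof (cases "?d \<in> D")
      case True
      then have d: "?d \<in> spt k Z S" using D by blast
      have "(\<lambda>n. mdist Z (\<phi> (s n) (y ?d (s n))) ?d) \<longlonglongrightarrow> 0"
        using LIMSEQ_subseq_LIMSEQ[OF y(2)[OF d] s] by (simp add: o_def)
      from transported_subsequence_converges[OF linked_subseq[OF l s] S Z' d, of "\<lambda>n. y ?d (s n)", OF y(1)[OF d] this]
      show ?thesis by (auto simp: P_def conv_def)
    next
      case False
      then show ?thesis using strict_mono_id by (auto simp: P_def)
    qed
  qed
  define s where "s = diagseq"
  have s: "strict_mono s" using subseq_diagseq by (simp add: s_def)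
  have convD: "conv d s" if d: "d \<in> D" for d
  proof -
    obtain j where j: "from_nat_into D j = d" using d D(1) from_nat_into_surj by metis
    have "P j (diagseq \<circ> ((+) (Suc j)))"
    proof (rule diagseq_holds)
      fix r s' :: "nat \<Rightarrow> nat" and n assume "strict_mono r" "P n s'"
      then show "P n (s' \<circ> r)" using sub by (auto simp: P_def)
    qed
    then have "conv d (diagseq \<circ> ((+) (Suc j)))" using j d by (simp add: P_def)
    then obtain z where z: "z \<in> mspace Z'"
        "(\<lambda>n. mdist Z' (\<phi>' (s (n + Suc j)) (y d (s (n + Suc j)))) z) \<longlonglongrightarrow> 0"
      unfolding conv_def s_def by (auto simp: add.commute)
    from LIMSEQ_offset[OF z(2)] z(1) show ?thesis unfolding conv_def by blast
  qed
  have "conv x s" if x: "x \<in> spt k Z S" for x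
    unfolding conv_def
  proof (rule convergent_if_nearly_convergent[OF Z'])
    show "\<phi>' (s n) (y x (s n)) \<in> mspace Z'" for n using linkedD(2)[OF l y(1)[OF x]] .
    fix \<epsilon> :: real assume "\<epsilon> > 0"
    then have \<epsilon>: "\<epsilon>/2 > 0" by simp
    obtain d where d: "d \<in> D" "mdist Z d x < \<epsilon>/2" using D(3)[OF x \<epsilon>] by blast
    have dS: "d \<in> spt k Z S" using d D by blast
    obtain z where z: "z \<in> mspace Z'" "(\<lambda>n. mdist Z' (\<phi>' (s n) (y d (s n))) z) \<longlonglongrightarrow> 0"
      using convD[OF d(1)] unfolding conv_def by blast
    have "(\<lambda>n. mdist Z (\<phi> (s n) (y d (s n))) (\<phi> (s n) (y x (s n)))) \<longlonglongrightarrow> mdist Z d x"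
      using LIMSEQ_subseq_LIMSEQ[OF y(2)[OF dS] s] LIMSEQ_subseq_LIMSEQ[OF y(2)[OF x] s] dS x
      by (intro tendsto_mdist linkedD(1)[OF l] y(1)) (auto simp: spt_def o_def)
    then have "\<forall>\<^sub>F n in sequentially. mdist Z (\<phi> (s n) (y d (s n))) (\<phi> (s n) (y x (s n))) < \<epsilon>/2"
      using d(2) by (rule order_tendstoD(2))
    moreover have "\<forall>\<^sub>F n in sequentially. mdist Z' (\<phi>' (s n) (y d (s n))) z < \<epsilon>/2"
      using z(2) \<epsilon> by (rule order_tendstoD(2))
    ultimately have "\<forall>\<^sub>F n in sequentially. mdist Z' (\<phi>' (s n) (y x (s n))) z < \<epsilon>"
    proof eventually_elim
      case (elim n)
      have "mdist Z' (\<phi>' (s n) (y x (s n))) z \<le>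
          mdist Z' (\<phi>' (s n) (y x (s n))) (\<phi>' (s n) (y d (s n))) + mdist Z' (\<phi>' (s n) (y d (s n))) z"
        by (rule mdist_triangle[OF linkedD(2)[OF l y(1)[OF x]] linkedD(2)[OF l y(1)[OF dS]] z(1)])
      then show ?case
        using elim linkedD(3)[OF l y(1)[OF dS] y(1)[OF x], of "s n"] by (simp add: mdist_commute)
    qed
    then show "\<exists>l\<in>mspace Z'. \<forall>\<^sub>F n in sequentially. mdist Z' (\<phi>' (s n) (y x (s n))) l < \<epsilon>"
      using z(1) by blast
  qed
  then have "\<forall>x. \<exists>z. x \<in> spt k Z S \<longrightarrow> z \<in> mspace Z' \<and> (\<lambda>n. mdist Z' (\<phi>' (s n) (y x (s n))) z) \<longlonglongrightarrow> 0"
    unfolding conv_def by blast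
  then obtain \<Psi> where "\<And>x. x \<in> spt k Z S \<Longrightarrow> \<Psi> x \<in> mspace Z' \<and>
      (\<lambda>n. mdist Z' (\<phi>' (s n) (y x (s n))) (\<Psi> x)) \<longlonglongrightarrow> 0"
    by metis
  then show ?thesis using s by blast
qed

text \<open>
  The value does not depend on the extension, since two extensions agree almost everywhere.
\<close>

lemma on_spt_eq:
  assumes T: "current k X T" and N: "N \<in> null_sets (mass_measure k X T)" "mspace X - spt k X T \<subseteq> N"
    and f: "(f, \<pi>) \<in> tuples k (submetric X (spt k X T))" and F: "(F, P) \<in> tuples k X"
    and eq: "\<And>x. x \<in> spt k X T \<Longrightarrow> F x = f x \<and> (\<forall>i<k. (P ! i) x = (\<pi> ! i) x)"
  shows "on_spt k X T f \<pi> = T F P"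
proof -
  have "T G Q = T F P" if "(G, Q) \<in> tuples k X"
    "\<forall>x\<in>spt k X T. G x = f x \<and> (\<forall>i<k. (Q ! i) x = (\<pi> ! i) x)" for G Q
    using that eq N(2)
    by (intro current_cong_AE[OF T mass_bound_mass_measure[OF T] N(1) _ F]) (auto simp: subset_iff)
  then have "(THE r. \<forall>G Q. (G, Q) \<in> tuples k X \<and>
      (\<forall>x\<in>spt k X T. G x = f x \<and> (\<forall>i<k. (Q ! i) x = (\<pi> ! i) x)) \<longrightarrow> T G Q = r) = T F P"
    using F eq by (intro the_equality) blast+
  then show ?thesis using f unfolding on_spt_def by simp
qed

lemma tuples_compose_isometric:
  assumes \<phi>: "isometric_embedding X Y \<phi>" and g: "(g, \<tau>) \<in> tuples k Y"
  shows "(g \<circ> \<phi>, map (\<lambda>t. t \<circ> \<phi>) \<tau>) \<in> tuples k X"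
proof -
  have "Lipschitz_continuous_map X Y \<phi>"
    using \<phi> unfolding isometric_embedding_def Lipschitz_continuous_map_def by (auto intro!: exI[of _ 1])
  moreover have "(g \<circ> \<phi>) ` mspace X \<subseteq> g ` mspace Y" using \<phi> by (auto simp: isometric_embedding_def)
  then have "bounded ((g \<circ> \<phi>) ` mspace X)"
    using g by (auto simp: tuples_def intro: bounded_subset)
  ultimately show ?thesis
    using g Lipschitz_continuous_map_compose[of X Y \<phi> euclidean_metric] by (auto simp: tuples_def)
qed

text \<open>
  Surjectivity follows by running the subsequence argument backwards from a point of \<open>spt S'\<close>. For the
  pushforward, transporting a tuple on \<open>Z'\<close> back to \<open>Z\<close> along the pieces gives bounded tuples which on
  the support of \<open>S\<close> converge pointwise to the pullback under \<open>\<Psi>\<close>.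
\<close>

lemma linked_limit_isometry:
  assumes l: "linked k Z S Z' S' Y \<phi> \<phi>'" and S: "current k Z S" "current k Z' S'"
    and Z: "mcomplete_of Z" and ne: "\<And>n. Y n \<noteq> {}"
    and N: "N \<in> null_sets (mass_measure k Z S)" "mspace Z - spt k Z S \<subseteq> N"
    and y: "\<And>x n. x \<in> spt k Z S \<Longrightarrow> y x n \<in> Y n"
      "\<And>x. x \<in> spt k Z S \<Longrightarrow> (\<lambda>n. mdist Z (\<phi> n (y x n)) x) \<longlonglongrightarrow> 0"
    and \<Psi>: "\<And>x. x \<in> spt k Z S \<Longrightarrow> \<Psi> x \<in> mspace Z'"
      "\<And>x. x \<in> spt k Z S \<Longrightarrow> (\<lambda>n. mdist Z' (\<phi>' n (y x n)) (\<Psi> x)) \<longlonglongrightarrow> 0"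
  shows "isometry (submetric Z (spt k Z S)) (submetric Z' (spt k Z' S')) \<Psi>"
    and "pushforward k Z' \<Psi> (on_spt k Z S) = S'"
proof -
  have sp: "spt k Z S \<subseteq> mspace Z" "spt k Z' S' \<subseteq> mspace Z'" by (auto simp: spt_def)
  note m1 = linkedD(1)[OF l y(1)] and m2 = linkedD(2)[OF l y(1)]
  have dist: "mdist Z' (\<Psi> a) (\<Psi> b) = mdist Z a b" if a: "a \<in> spt k Z S" and b: "b \<in> spt k Z S" for a b
  proof -
    have "(\<lambda>n. mdist Z' (\<phi>' n (y a n)) (\<phi>' n (y b n))) \<longlonglongrightarrow> mdist Z' (\<Psi> a) (\<Psi> b)"
      using a b by (intro tendsto_mdist m2 \<Psi>)
    moreover have "(\<lambda>n. mdist Z (\<phi> n (y a n)) (\<phi> n (y b n))) \<longlonglongrightarrow> mdist Z a b"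
      using a b sp by (intro tendsto_mdist m1 y(2)) auto
    moreover have "mdist Z (\<phi> n (y a n)) (\<phi> n (y b n)) = mdist Z' (\<phi>' n (y a n)) (\<phi>' n (y b n))" for n
      by (rule linkedD(3)[OF l y(1)[OF a] y(1)[OF b]])
    ultimately show ?thesis by (simp add: LIMSEQ_unique)
  qed
  have into: "\<Psi> x \<in> spt k Z' S'" if x: "x \<in> spt k Z S" for x
    by (rule transported_limit_in_spt[OF l S x y(1)[OF x] y(2)[OF x] \<Psi>(1)[OF x] \<Psi>(2)[OF x]])
  have onto: "\<exists>x\<in>spt k Z S. \<Psi> x = x'" if x': "x' \<in> spt k Z' S'" for x'
  proof -
    note l' = linked_sym[OF l]
    obtain w where w: "\<And>n. w n \<in> Y n" "(\<lambda>n. mdist Z' (\<phi>' n (w n)) x') \<longlonglongrightarrow> 0"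
      using spt_sequence[OF l' S(2) ne x'] by blast
    obtain s z where s: "strict_mono s" and z: "z \<in> mspace Z" "(\<lambda>n. mdist Z (\<phi> (s n) (w (s n))) z) \<longlonglongrightarrow> 0"
      using transported_subsequence_converges[OF l' S(2,1) Z x' w] by blast
    have w': "(\<lambda>n. mdist Z' (\<phi>' (s n) (w (s n))) x') \<longlonglongrightarrow> 0"
      using LIMSEQ_subseq_LIMSEQ[OF w(2) s] by (simp add: o_def)
    have zS: "z \<in> spt k Z S"
      by (rule transported_limit_in_spt[OF linked_subseq[OF l' s] S(2,1) x' w(1) w' z])
    have "(\<lambda>n. mdist Z (\<phi> (s n) (y z (s n))) (\<phi> (s n) (w (s n)))) \<longlonglongrightarrow> mdist Z z z"
      using LIMSEQ_subseq_LIMSEQ[OF y(2)[OF zS] s]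
      by (intro tendsto_mdist z m1[OF zS] linkedD(1)[OF l w(1)]) (simp add: o_def)
    moreover have "(\<lambda>n. mdist Z' (\<phi>' (s n) (y z (s n))) (\<phi>' (s n) (w (s n)))) \<longlonglongrightarrow> mdist Z' (\<Psi> z) x'"
      using LIMSEQ_subseq_LIMSEQ[OF \<Psi>(2)[OF zS] s] x' sp(2)
      by (intro tendsto_mdist w' m2[OF zS] linkedD(2)[OF l w(1)] \<Psi>(1)[OF zS]) (auto simp: o_def)
    moreover have "mdist Z (\<phi> (s n) (y z (s n))) (\<phi> (s n) (w (s n))) =
        mdist Z' (\<phi>' (s n) (y z (s n))) (\<phi>' (s n) (w (s n)))" for n
      by (rule linkedD(3)[OF l y(1)[OF zS] w(1)])
    ultimately have "mdist Z' (\<Psi> z) x' = mdist Z z z" by (simp add: LIMSEQ_unique)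
    then have "\<Psi> z = x'" using mdist_self[OF z(1)] mdist_zero[OF \<Psi>(1)[OF zS], of x'] x' sp(2) by auto
    then show ?thesis using zS by blast
  qed
  have eqI: "spt k Z S \<inter> mspace Z = spt k Z S" "spt k Z' S' \<inter> mspace Z' = spt k Z' S'" using sp by auto
  show iso: "isometry (submetric Z (spt k Z S)) (submetric Z' (spt k Z' S')) \<Psi>"
    unfolding isometry_def isometric_embedding_def mspace_submetric mdist_submetric eqI
  proof (intro conjI)
    show "\<Psi> ` spt k Z S = spt k Z' S'" using into onto by force
  qed (use dist into in auto)
  have emb: "isometric_embedding (submetric Z (spt k Z S)) Z' \<Psi>"
    unfolding isometric_embedding_def mspace_submetric mdist_submetric eqI
    using dist \<Psi>(1) by auto
  have "S' g \<tau> = on_spt k Z S (g \<circ> \<Psi>) (map (\<lambda>t. t \<circ> \<Psi>) \<tau>)" if g: "(g, \<tau>) \<in> tuples k Z'" for g \<tau>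
  proof -
    obtain K where K: "(g, \<tau>) \<in> bdd_tuples k Z' K" using g tuples_imp_bdd_tuples by blast
    have len: "length \<tau> = k" using g by (simp add: tuples_def)
    have "\<forall>n. \<exists>G P. (G, P) \<in> bdd_tuples k Z K \<and> agree_along k (Y n) (\<phi> n) (\<phi>' n) G P g \<tau>"
      using linked_transport[OF linked_sym[OF l] K] agree_along_sym by metis
    then obtain G P where GP: "\<And>n. (G n, P n) \<in> bdd_tuples k Z K"
        "\<And>n. agree_along k (Y n) (\<phi> n) (\<phi>' n) (G n) (P n) g \<tau>"
      by metis
    obtain F Q where FQ: "(F, Q) \<in> bdd_tuples k Z K" "agree_along k (spt k Z S) \<Psi> id g \<tau> F Q"
      using transport_tuple[OF K, of "spt k Z S" \<Psi> id Z] \<Psi>(1) sp(1) dist by auto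
    have pw: "(\<lambda>n. u n x) \<longlonglongrightarrow> v (\<Psi> x)"
      if x: "x \<in> spt k Z S" and u: "\<And>n. lip_const Z K (u n)" and v: "lip_const Z' K v"
        and uv: "\<And>n z. z \<in> Y n \<Longrightarrow> u n (\<phi> n z) = v (\<phi>' n z)" for u v x
    proof (rule tendsto_if_abs_diff_le)
      show "(\<lambda>n. K * mdist Z (\<phi> n (y x n)) x + K * mdist Z' (\<phi>' n (y x n)) (\<Psi> x)) \<longlonglongrightarrow> 0"
        using tendsto_add[OF tendsto_mult_right_zero[OF y(2)[OF x]] tendsto_mult_right_zero[OF \<Psi>(2)[OF x]]] by simp
      fix n
      have "\<bar>u n (\<phi> n (y x n)) - u n x\<bar> \<le> K * mdist Z (\<phi> n (y x n)) x"
        using x sp by (intro lip_constD[OF u] m1) auto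
      moreover have "\<bar>v (\<phi>' n (y x n)) - v (\<Psi> x)\<bar> \<le> K * mdist Z' (\<phi>' n (y x n)) (\<Psi> x)"
        by (intro lip_constD[OF v] m2 \<Psi> x)
      ultimately show "\<bar>u n x - v (\<Psi> x)\<bar> \<le>
          K * mdist Z (\<phi> n (y x n)) x + K * mdist Z' (\<phi>' n (y x n)) (\<Psi> x)"
        using uv[OF y(1)[OF x]] by (simp add: abs_le_iff)
    qed
    have "(\<lambda>n. S (G n) (P n)) \<longlonglongrightarrow> S F Q"
    proof (rule current_tendsto[OF S(1) mass_bound_mass_measure[OF S(1)] N(1) GP(1) FQ(1)])
      fix x assume "x \<in> mspace Z - N"
      then have x: "x \<in> spt k Z S" using N(2) by blast
      show "(\<lambda>n. G n x) \<longlonglongrightarrow> F x"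
        using pw[OF x, of G g] GP K FQ(2) x by (simp add: bdd_tuples_def agree_along_def)
      show "(\<lambda>n. (P n ! j) x) \<longlonglongrightarrow> (Q ! j) x" if j: "j < k" for j
      proof -
        have "lip_const Z K (P n ! j)" for n using GP(1)[of n] j by (simp add: bdd_tuples_def)
        from pw[OF x this, of "\<tau> ! j"] show ?thesis
          using GP(2) K FQ(2) x j by (simp add: bdd_tuples_def agree_along_def)
      qed
    qed
    moreover have "(\<lambda>n. S (G n) (P n)) \<longlonglongrightarrow> S' g \<tau>"
    proof (rule LIMSEQ_I)
      fix r :: real assume "0 < r"
      from linked_eventually[OF l this, of K]
      have "\<forall>\<^sub>F n in sequentially. norm (S (G n) (P n) - S' g \<tau>) < r"
        by (rule eventually_mono) (use GP K in auto)
      then show "\<exists>M. \<forall>n\<ge>M. norm (S (G n) (P n) - S' g \<tau>) < r" by (simp add: eventually_sequentially)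
    qed
    ultimately have "S' g \<tau> = S F Q" by (rule LIMSEQ_unique[rotated])
    also have "\<dots> = on_spt k Z S (g \<circ> \<Psi>) (map (\<lambda>t. t \<circ> \<Psi>) \<tau>)"
      using FQ len by (intro on_spt_eq[OF S(1) N tuples_compose_isometric[OF emb g], symmetric]
          bdd_tuples_imp_tuples[of F Q k Z K]) (auto simp: agree_along_def)
    finally show ?thesis .
  qed
  moreover have "S' g \<tau> = 0" if "(g, \<tau>) \<notin> tuples k Z'" for g \<tau>
    using S(2) that by (simp add: current_def)
  ultimately show "pushforward k Z' \<Psi> (on_spt k Z S) = S'"
    by (auto simp: pushforward_def fun_eq_iff)
qed

section \<open>Flat convergence links the limits\<close>

text \<open>
  The boundary is evaluated as \<open>V(1, f, \<pi>)\<close>. There \<open>f\<close> is a functional entry, so it contributes its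
  Lipschitz constant, whereas in \<open>U(f, \<pi>)\<close> it contributes its supremum; both are at most \<open>K\<close>.
\<close>

lemma flat_norm_bound:
  assumes f: "(f, \<pi>) \<in> bdd_tuples k Z K" and A: "flat_norm k Z A < ennreal m"
  shows "\<bar>A f \<pi>\<bar> \<le> K ^ Suc k * m"
proof -
  obtain U V where U: "integral_current k Z U" and V: "integral_current (k + 1) Z V"
      and AUV: "A = (\<lambda>f \<pi>. U f \<pi> + boundary (k + 1) Z V f \<pi>)"
      and m: "mass k Z U + mass (k + 1) Z V < ennreal m"
    using A unfolding flat_norm_def INF_less_iff by auto
  have K: "0 \<le> K" using f bdd_tuples_nonneg by blast
  let ?\<mu> = "mass_measure k Z U" and ?\<nu> = "mass_measure (k + 1) Z V"
  have \<mu>: "mass_bound k Z U ?\<mu>" and \<nu>: "mass_bound (k + 1) Z V ?\<nu>"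
    using U V mass_bound_mass_measure by (auto simp: integral_current_def integer_rectifiable_def)
  note f\<mu> = mass_bound_finite_borel[OF \<mu>] and f\<nu> = mass_bound_finite_borel[OF \<nu>]
  interpret u: finite_measure ?\<mu> using f\<mu> finite_borelD by blast
  interpret v: finite_measure ?\<nu> using f\<nu> finite_borelD by blast
  have fK: "lip_const Z K f" "\<And>x. x \<in> mspace Z \<Longrightarrow> \<bar>f x\<bar> \<le> K" "length \<pi> = k"
      "\<And>p. p \<in> set \<pi> \<Longrightarrow> lip_const Z K p"
    using f by (auto simp: bdd_tuples_def)
  have "\<bar>U f \<pi>\<bar> \<le> K ^ k * (\<integral>x. \<bar>f x\<bar> \<partial>?\<mu>)"
    by (rule current_bound[OF \<mu> bdd_tuples_imp_tuples[OF f] fK(4)])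
  also have "\<dots> \<le> K ^ k * (\<integral>x. K \<partial>?\<mu>)"
    using fK finite_borelD(3)[OF f\<mu>] lip_const_borel_measurable[OF f\<mu> fK(1)]
    by (intro mult_left_mono integral_mono finite_borel_integrable[OF f\<mu>, of _ K]) (use K in auto)
  finally have 1: "\<bar>U f \<pi>\<bar> \<le> K ^ Suc k * measure ?\<mu> (mspace Z)"
    using finite_borelD(3)[OF f\<mu>] by (simp add: ac_simps)
  have t: "(\<lambda>_. 1, f # \<pi>) \<in> tuples (k + 1) Z"
    using fK by (auto simp: tuples_def lipschitz_fun_iff bounded_iff intro: lip_const_const[of 0])
  have "\<bar>V (\<lambda>_. 1) (f # \<pi>)\<bar> \<le> K ^ (k + 1) * (\<integral>x. \<bar>1\<bar> \<partial>?\<nu>)"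
    by (rule current_bound[OF \<nu> t]) (use fK in auto)
  then have 2: "\<bar>boundary (k + 1) Z V f \<pi>\<bar> \<le> K ^ Suc k * measure ?\<nu> (mspace Z)"
    using bdd_tuples_imp_tuples[OF f] finite_borelD(3)[OF f\<nu>] by (simp add: boundary_def)
  have "ennreal (measure ?\<mu> (mspace Z) + measure ?\<nu> (mspace Z)) < ennreal m"
    using m v.emeasure_eq_measure[of "mspace Z"] by (simp add: mass_def u.emeasure_eq_measure)
  then have "measure ?\<mu> (mspace Z) + measure ?\<nu> (mspace Z) \<le> m"
    by (simp add: ennreal_less_iff del: ennreal_plus)
  then have "K ^ Suc k * (measure ?\<mu> (mspace Z) + measure ?\<nu> (mspace Z)) \<le> K ^ Suc k * m"
    using K by (intro mult_left_mono) auto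
  then show ?thesis using 1 2 unfolding AUV by (simp add: distrib_left)
qed

lemma on_spt_cong:
  assumes "(f, \<pi>) \<in> tuples k (submetric X (spt k X T))" "(f', \<pi>') \<in> tuples k (submetric X (spt k X T))"
    and "\<And>x. x \<in> spt k X T \<Longrightarrow> f x = f' x \<and> (\<forall>i<k. (\<pi> ! i) x = (\<pi>' ! i) x)"
  shows "on_spt k X T f \<pi> = on_spt k X T f' \<pi>'"
proof -
  have "(\<forall>x\<in>spt k X T. F x = f x \<and> (\<forall>i<k. (P ! i) x = (\<pi> ! i) x)) \<longleftrightarrow>
      (\<forall>x\<in>spt k X T. F x = f' x \<and> (\<forall>i<k. (P ! i) x = (\<pi>' ! i) x))" for F P
    using assms(3) by auto
  then show ?thesis using assms(1,2) by (simp add: on_spt_def)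
qed

text \<open>
  The functional on the support of \<open>T\<^sub>n\<close> sees only the values of a tuple there. Hence both
  pushforwards take the same value on tuples that agree along the \<open>n\<close>-th piece.
\<close>

lemma flat_limits_linked:
  assumes \<phi>: "\<And>n. isometric_embedding (submetric (X n) (spt k (X n) (T n))) Z (\<phi> n)"
    and \<phi>': "\<And>n. isometric_embedding (submetric (X n) (spt k (X n) (T n))) Z' (\<phi>' n)"
    and lim: "(\<lambda>n. flat_dist k Z (pushforward k Z (\<phi> n) (on_spt k (X n) (T n))) S) \<longlonglongrightarrow> 0"
    and lim': "(\<lambda>n. flat_dist k Z' (pushforward k Z' (\<phi>' n) (on_spt k (X n) (T n))) S') \<longlonglongrightarrow> 0"
  shows "linked k Z S Z' S' (\<lambda>n. spt k (X n) (T n)) \<phi> \<phi>'"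
proof -
  have sp: "spt k (X n) (T n) \<inter> mspace (X n) = spt k (X n) (T n)" for n by (auto simp: spt_def)
  note emb = \<phi>[unfolded isometric_embedding_def mspace_submetric mdist_submetric sp]
    and emb' = \<phi>'[unfolded isometric_embedding_def mspace_submetric mdist_submetric sp]
  show ?thesis
    unfolding linked_def
  proof (intro conjI allI impI ballI)
    fix K \<epsilon> :: real assume \<epsilon>: "\<epsilon> > 0"
    define c where "c = 2 * \<bar>K ^ Suc k\<bar> + 1"
    define m where "m = \<epsilon> / c"
    have c: "c > 0" by (simp add: c_def add_nonneg_pos)
    then have m: "m > 0" "2 * (K ^ Suc k * m) < \<epsilon>"
    proof -
      show m0: "m > 0" using c \<epsilon> by (simp add: m_def)
      have "2 * (K ^ Suc k * m) \<le> (2 * \<bar>K ^ Suc k\<bar>) * m"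
        using mult_right_mono[OF abs_ge_self[of "K ^ Suc k"], of m] m0 by simp
      also have "\<dots> < c * m" using m0 by (simp add: c_def)
      finally show "2 * (K ^ Suc k * m) < \<epsilon>" using c by (simp add: m_def)
    qed
    have m': "0 < ennreal m" using m by simp
    from eventually_conj[OF order_tendstoD(2)[OF lim m'] order_tendstoD(2)[OF lim' m']]
    show "\<forall>\<^sub>F n in sequentially. \<forall>f \<pi> f' \<pi>'.
        (f, \<pi>) \<in> bdd_tuples k Z K \<and> (f', \<pi>') \<in> bdd_tuples k Z' K \<and>
        agree_along k (spt k (X n) (T n)) (\<phi> n) (\<phi>' n) f \<pi> f' \<pi>' \<longrightarrow> \<bar>S f \<pi> - S' f' \<pi>'\<bar> < \<epsilon>"
    proof (rule eventually_mono, intro allI impI, elim conjE)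
      fix n f \<pi> f' \<pi>'
      assume fd: "flat_dist k Z (pushforward k Z (\<phi> n) (on_spt k (X n) (T n))) S < ennreal m"
          "flat_dist k Z' (pushforward k Z' (\<phi>' n) (on_spt k (X n) (T n))) S' < ennreal m"
        and t: "(f, \<pi>) \<in> bdd_tuples k Z K" "(f', \<pi>') \<in> bdd_tuples k Z' K"
        and a: "agree_along k (spt k (X n) (T n)) (\<phi> n) (\<phi>' n) f \<pi> f' \<pi>'"
      note t' = t[THEN bdd_tuples_imp_tuples]
      have len: "length \<pi> = k" "length \<pi>' = k" using t by (auto simp: bdd_tuples_def)
      have "pushforward k Z (\<phi> n) (on_spt k (X n) (T n)) f \<pi> =
          pushforward k Z' (\<phi>' n) (on_spt k (X n) (T n)) f' \<pi>'"
        using on_spt_cong[OF tuples_compose_isometric[OF \<phi> t'(1)] tuples_compose_isometric[OF \<phi>' t'(2)]]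
          a t' len by (simp add: pushforward_def agree_along_def)
      moreover have "\<bar>pushforward k Z (\<phi> n) (on_spt k (X n) (T n)) f \<pi> - S f \<pi>\<bar> \<le> K ^ Suc k * m"
        using flat_norm_bound[OF t(1) fd(1)[unfolded flat_dist_def]] .
      moreover have "\<bar>pushforward k Z' (\<phi>' n) (on_spt k (X n) (T n)) f' \<pi>' - S' f' \<pi>'\<bar> \<le> K ^ Suc k * m"
        using flat_norm_bound[OF t(2) fd(2)[unfolded flat_dist_def]] .
      ultimately show "\<bar>S f \<pi> - S' f' \<pi>'\<bar> < \<epsilon>" using m(2) by linarith
    qed
  qed (use emb emb' in \<open>auto simp: Pi_iff\<close>)
qed

theorem theorem1p3:
  fixes k :: nat and C D :: real
    and X :: "nat \<Rightarrow> 'a metric" and T :: "nat \<Rightarrow> 'a functional"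
    and Z :: "'b metric" and Z' :: "'c metric"
    and \<phi> :: "nat \<Rightarrow> 'a \<Rightarrow> 'b" and \<phi>' :: "nat \<Rightarrow> 'a \<Rightarrow> 'c"
    and S :: "'b functional" and S' :: "'c functional"
  assumes "k \<ge> 1" and "C > 0" and "D > 0"
    and "\<And>n. mcomplete_of (X n)"
    and "\<And>n. integral_current k (X n) (T n)"
    and "\<And>n. mass k (X n) (T n) + mass (k - 1) (X n) (boundary k (X n) (T n)) \<le> ennreal C"
    and "\<And>n. mdiam (X n) (spt k (X n) (T n)) \<le> ennreal D"
    and "mcomplete_of Z" and "mcomplete_of Z'"
    and "\<And>n. isometric_embedding (submetric (X n) (spt k (X n) (T n))) Z (\<phi> n)"
    and "\<And>n. isometric_embedding (submetric (X n) (spt k (X n) (T n))) Z' (\<phi>' n)"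
    and "integral_current k Z S" and "integral_current k Z' S'"
    and "(\<lambda>n. flat_dist k Z (pushforward k Z (\<phi> n) (on_spt k (X n) (T n))) S) \<longlonglongrightarrow> 0"
    and "(\<lambda>n. flat_dist k Z' (pushforward k Z' (\<phi>' n) (on_spt k (X n) (T n))) S') \<longlonglongrightarrow> 0"
    and "S \<noteq> (\<lambda>f \<pi>. 0)"
  shows "S' \<noteq> (\<lambda>f \<pi>. 0) \<and>
    (\<exists>\<Psi>. isometry (submetric Z (spt k Z S)) (submetric Z' (spt k Z' S')) \<Psi> \<and>
         pushforward k Z' \<Psi> (on_spt k Z S) = S')"
proof -
  define Y where "Y n = spt k (X n) (T n)" for n
  have l: "linked k Z S Z' S' Y \<phi> \<phi>'"
    unfolding Y_def using assms(10,11,14,15) by (rule flat_limits_linked)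
  have ir: "integer_rectifiable k Z S" "current k Z S" "current k Z' S'"
    using assms(12,13) by (auto simp: integral_current_def integer_rectifiable_def)
  note S = ir(2,3)
  obtain f \<pi> where f: "S f \<pi> \<noteq> 0" using assms(16) by (auto simp: fun_eq_iff)
  then have ft: "(f, \<pi>) \<in> tuples k Z" using S(1) by (auto simp: current_def)
  obtain K where K: "(f, \<pi>) \<in> bdd_tuples k Z K" using ft tuples_imp_bdd_tuples by blast
  have "S' \<noteq> (\<lambda>f \<pi>. 0)"
  proof
    assume S'0: "S' = (\<lambda>f \<pi>. 0)"
    have "\<bar>S f \<pi>\<bar> > 0" using f by simp
    from eventually_happens'[OF sequentially_bot linked_eventually[OF l this, of K]]
    obtain n where n: "\<And>f' \<pi>' g \<tau>. (f', \<pi>') \<in> bdd_tuples k Z K \<Longrightarrow> (g, \<tau>) \<in> bdd_tuples k Z' K \<Longrightarrow>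
        agree_along k (Y n) (\<phi> n) (\<phi>' n) f' \<pi>' g \<tau> \<Longrightarrow> \<bar>S f' \<pi>' - S' g \<tau>\<bar> < \<bar>S f \<pi>\<bar>"
      by blast
    obtain g \<tau> where "(g, \<tau>) \<in> bdd_tuples k Z' K" "agree_along k (Y n) (\<phi> n) (\<phi>' n) f \<pi> g \<tau>"
      using linked_transport[OF l K] by blast
    from n[OF K this] show False using S'0 by simp
  qed
  moreover have "\<exists>\<Psi>. isometry (submetric Z (spt k Z S)) (submetric Z' (spt k Z' S')) \<Psi> \<and>
         pushforward k Z' \<Psi> (on_spt k Z S) = S'"
  proof -
    obtain N where N: "N \<in> null_sets (mass_measure k Z S)" "mspace Z - spt k Z S \<subseteq> N"
      using integer_rectifiable_spt(1)[OF ir(1) assms(1)] by blast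
    have sep: "separable_subset Z (spt k Z S)" using integer_rectifiable_spt(2)[OF ir(1) assms(1)] .
    obtain M where M: "\<And>n. n \<ge> M \<Longrightarrow> Y n \<noteq> {}"
      using linked_nonzero_meets[OF l S(1) ft f] unfolding eventually_sequentially by blast
    (* Early pieces may be empty; the sequences of points start where they no longer are. *)
    have shift: "strict_mono (\<lambda>n. n + M)" by (simp add: strict_mono_def)
    note l1 = linked_subseq[OF l shift]
    have ne: "Y (n + M) \<noteq> {}" for n using M by simp
    have "\<forall>x. \<exists>y. x \<in> spt k Z S \<longrightarrow> (\<forall>n. y n \<in> Y (n + M)) \<and> (\<lambda>n. mdist Z (\<phi> (n + M) (y n)) x) \<longlonglongrightarrow> 0"
      using spt_sequence[OF l1 S(1) ne] by blast
    then obtain y where y: "\<And>x n. x \<in> spt k Z S \<Longrightarrow> y x n \<in> Y (n + M)"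
        "\<And>x. x \<in> spt k Z S \<Longrightarrow> (\<lambda>n. mdist Z (\<phi> (n + M) (y x n)) x) \<longlonglongrightarrow> 0"
      by metis
    obtain s \<Psi> where s: "strict_mono s" and \<Psi>: "\<And>x. x \<in> spt k Z S \<Longrightarrow> \<Psi> x \<in> mspace Z'"
        "\<And>x. x \<in> spt k Z S \<Longrightarrow> (\<lambda>n. mdist Z' (\<phi>' (s n + M) (y x (s n))) (\<Psi> x)) \<longlonglongrightarrow> 0"
      using common_convergent_subsequence[OF l1 S assms(9) sep y] by blast
    have y2: "(\<lambda>n. mdist Z (\<phi> (s n + M) (y x (s n))) x) \<longlonglongrightarrow> 0" if "x \<in> spt k Z S" for x
      using LIMSEQ_subseq_LIMSEQ[OF y(2)[OF that] s] by (simp add: o_def)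
    show ?thesis
      using linked_limit_isometry[OF linked_subseq[OF l1 s] S assms(8) ne N, where y = "\<lambda>x n. y x (s n)" and \<Psi> = \<Psi>]
        y(1) y2 \<Psi> by blast
  qed
  ultimately show ?thesis by blast
qed

end
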